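(* Let $\mathcal X: y^m=f(x)$ be a Kummer curve over $\mathbb F_q$ and let $Q_1,\dots,Q_n$ be pairwise distinct totally ramified places of $\mathbb F_q(\mathcal X)/\mathbb F_q(x)$ lying over $P_1,\dots,P_n$, all as described in the context. Assume $2\le n\le q$. Let $D$ be a divisor of $\mathbb F_q(\mathcal X)$ with support contained in $\{Q_1,\dots,Q_n\}$, and write $$D=\sum_{k=1}^{n}(mj_k+\alpha_k)Q_k,\qquad j_k\in\mathbb Z,\ 0\le\alpha_k\le m-1\ (1\le k\le n).$$ Then $D$ is a non-special divisor of degree $g(\mathcal X)$ if and only if one of the following holds: (i) $\sum_{k=1}^n j_k=0$ and $n+\sum_{k=1}^{n}\left\lfloor\frac{\alpha_k-t_k(i)}{m}\right\rfloor=\beta(i)$ for every $1\le i\le m-1$; or (ii) $\sum_{k=1}^n j_k=-1$, and there is some $1\le j\le m-1$ with $n-2+\sum_{k=1}^{n}\left\lfloor\frac{\alpha_k-t_k(j)}{m}\right\rfloor=\beta(j)$ and $n-1+\sum_{k=1}^{n}\left\lfloor\frac{\alpha_k-t_k(i)}{m}\right\rfloor=\beta(i)$ for every $1\le i\le m-1$ with $i\ne j$. In particular, $D$ is an effective non-special divisor of degree $g(\mathcal X)$ if and only if (a) $D=\sum_{k=1}^n\alpha_kQ_k$ with $0\le\alpha_k\le m-1$, and (b) $n+\sum_{k=1}^{n}\left\lfloor\frac{\alpha_k-t_k(i)}{m}\right\rfloor=\beta(i)$ for every $1\le i\le m-1$.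
   Context: Let $\mathbb F_q$ be the finite field with $q$ elements, $m\ge 2$ an integer with $\operatorname{char}(\mathbb F_q)\nmid m$, and $f(x)\in\mathbb F_q[x]$ a polynomial with $\deg f\ge 2$, all of whose roots lie in $\mathbb F_q$, and which is not a $d$-th power of an element of $\mathbb F_q(x)$ for any divisor $d\ge 2$ of $m$. Let $\mathcal X$ be the curve $y^m=f(x)$, with function field $\mathbb F_q(\mathcal X)=\mathbb F_q(x,y)$, whose genus $g(\mathcal X)$ is assumed to be at least $1$. Let $P_1,\dots,P_r$ be all the places of $\mathbb F_q(x)$ that are zeros or the pole of $f(x)$, and let $\lambda_k=\nu_{P_k}(f)$ be the valuation of $f$ at $P_k$ (so $\lambda_k=-\deg f$ if $P_k$ is the pole). For some $n\le r$, the places $P_1,\dots,P_n$ (possibly including the pole of $f$) are assumed totally ramified in $\mathbb F_q(\mathcal X)/\mathbb F_q(x)$, and $Q_k$ is the unique place of $\mathbb F_q(\mathcal X)$ over $P_k$, $1\le k\le n$. For $1\le i\le m-1$ put $$t_k(i)=(i\lambda_k)\bmod m\ \ (1\le k\le n),\qquad \beta(i)=\sum_{k=1}^{r}\left\lceil\frac{i\lambda_k}{m}\right\rceil-1,$$ where $b\bmod m$ is the smallest non-negative integer congruent to $b$ modulo $m$. A divisor $G$ of a function field of genus $g$ is non-special if $\ell(G)=\deg(G)+1-g$, where $\ell(G)$ is the dimension of the Riemann-Roch space $\mathcal L(G)$. *)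

theory Defs
  imports
    "HOL-Library.FuncSet"
    "HOL-Library.Poly_Mapping"
    "HOL-Algebra.Algebraic_Closure_Type"
    "Subresultants.More_Homomorphisms"
begin

text \<open>
  A function field \<open>F/K\<close> is given by a field type \<^typ>\<open>'f\<close>, a field type \<^typ>\<open>'k\<close> of constants, and
  an embedding \<open>\<iota>\<close> of \<^typ>\<open>'k\<close> into \<^typ>\<open>'f\<close>. The rational function field \<open>K(x)\<close> is
  \<^typ>\<open>'k poly fract\<close>, and an extension \<open>F/K(x)\<close> is given by an embedding \<open>\<phi>\<close> of
  \<^typ>\<open>'k poly fract\<close> into \<^typ>\<open>'f\<close>.
\<close>

definition rat_const :: "'k::field \<Rightarrow> 'k poly fract" where
  "rat_const c = to_fract [:c:]"


subsection \<open>Places and valuations\<close>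

definition valuation_ring :: "('k::field \<Rightarrow> 'f::field) \<Rightarrow> 'f set \<Rightarrow> bool" where
  "valuation_ring \<iota> R \<longleftrightarrow>
     range \<iota> \<subset> R \<and> R \<subset> UNIV \<and>
     (\<forall>a\<in>R. \<forall>b\<in>R. a + b \<in> R \<and> a - b \<in> R \<and> a * b \<in> R) \<and>
     (\<forall>z. z \<noteq> 0 \<longrightarrow> z \<in> R \<or> inverse z \<in> R)"

text \<open>The maximal ideal of the local ring \<open>R\<close> is its set of non-units; note \<open>inverse 0 = 0\<close>.\<close>

definition is_place :: "('k::field \<Rightarrow> 'f::field) \<Rightarrow> 'f set \<Rightarrow> bool" where
  "is_place \<iota> P \<longleftrightarrow> (\<exists>R. valuation_ring \<iota> R \<and> P = {z \<in> R. z = 0 \<or> inverse z \<notin> R})"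

text \<open>The valuation ring with maximal ideal \<open>P\<close>; it is determined by \<open>P\<close>.\<close>

definition place_ring :: "'f::field set \<Rightarrow> 'f set" where
  "place_ring P = {z. z = 0 \<or> inverse z \<notin> P}"

text \<open>
  The normalised discrete valuation at \<open>P\<close>: write \<open>z = t\<^sup>n u\<close> with \<open>t\<close> a local parameter, that is
  \<open>P = t R\<close> for the valuation ring \<open>R\<close> of \<open>P\<close>, and \<open>u\<close> a unit of \<open>R\<close>. Only meaningful for
  \<open>z \<noteq> 0\<close>; the value \<open>\<infinity>\<close> at \<open>0\<close> is never used.
\<close>

definition place_val :: "'f::field set \<Rightarrow> 'f \<Rightarrow> int" where
  "place_val P z = (THE n. \<exists>t u. P = (\<lambda>w. t * w) ` place_ring P \<and>
     u \<noteq> 0 \<and> u \<in> place_ring P \<and> inverse u \<in> place_ring P \<and> z = t powi n * u)"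

text \<open>The residue classes of the elements of \<open>B\<close> form a \<open>K\<close>-basis of the residue class field.\<close>

definition residue_basis :: "('k::field \<Rightarrow> 'f::field) \<Rightarrow> 'f set \<Rightarrow> 'f set \<Rightarrow> bool" where
  "residue_basis \<iota> P B \<longleftrightarrow> finite B \<and> B \<subseteq> place_ring P \<and>
     (\<forall>z\<in>place_ring P. \<exists>!c. c \<in> B \<rightarrow>\<^sub>E (UNIV :: 'k set) \<and> z - (\<Sum>b\<in>B. \<iota> (c b) * b) \<in> P)"

definition place_degree :: "('k::field \<Rightarrow> 'f::field) \<Rightarrow> 'f set \<Rightarrow> nat" where
  "place_degree \<iota> P = (THE d. \<exists>B. residue_basis \<iota> P B \<and> card B = d)"


subsection \<open>Divisors, Riemann-Roch spaces and the genus\<close>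

text \<open>
  Divisors are elements of the free abelian group on the places. The order on \<^type>\<open>poly_mapping\<close>
  is lexicographic and unrelated to the order of divisors.
\<close>

definition is_divisor :: "('k::field \<Rightarrow> 'f::field) \<Rightarrow> ('f set \<Rightarrow>\<^sub>0 int) \<Rightarrow> bool" where
  "is_divisor \<iota> D \<longleftrightarrow> (\<forall>P\<in>Poly_Mapping.keys D. is_place \<iota> P)"

definition effective :: "('f set \<Rightarrow>\<^sub>0 int) \<Rightarrow> bool" where
  "effective D \<longleftrightarrow> (\<forall>P. 0 \<le> Poly_Mapping.lookup D P)"

definition div_degree :: "('k::field \<Rightarrow> 'f::field) \<Rightarrow> ('f set \<Rightarrow>\<^sub>0 int) \<Rightarrow> int" where
  "div_degree \<iota> D = (\<Sum>P\<in>Poly_Mapping.keys D. Poly_Mapping.lookup D P * int (place_degree \<iota> P))"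

definition rr_space :: "('k::field \<Rightarrow> 'f::field) \<Rightarrow> ('f set \<Rightarrow>\<^sub>0 int) \<Rightarrow> 'f set" where
  "rr_space \<iota> D = {z. z = 0 \<or> (\<forall>P. is_place \<iota> P \<longrightarrow> place_val P z \<ge> - Poly_Mapping.lookup D P)}"

definition rr_dim :: "('k::field \<Rightarrow> 'f::field) \<Rightarrow> ('f set \<Rightarrow>\<^sub>0 int) \<Rightarrow> int" where
  "rr_dim \<iota> D = int (vector_space.dim (\<lambda>c z. \<iota> c * z) (rr_space \<iota> D))"

definition genus :: "('k::field \<Rightarrow> 'f::field) \<Rightarrow> int" where
  "genus \<iota> = (GREATEST g. \<exists>A. is_divisor \<iota> A \<and> g = div_degree \<iota> A - rr_dim \<iota> A + 1)"

definition non_special :: "('k::field \<Rightarrow> 'f::field) \<Rightarrow> ('f set \<Rightarrow>\<^sub>0 int) \<Rightarrow> bool" where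
  "non_special \<iota> D \<longleftrightarrow> rr_dim \<iota> D = div_degree \<iota> D + 1 - genus \<iota>"


subsection \<open>Extensions of the rational function field\<close>

definition ext_degree :: "('e::field \<Rightarrow> 'f::field) \<Rightarrow> nat" where
  "ext_degree \<phi> = vector_space.dim (\<lambda>a z. \<phi> a * z) UNIV"

definition lies_over :: "('e::field \<Rightarrow> 'f::field) \<Rightarrow> 'f set \<Rightarrow> 'e set \<Rightarrow> bool" where
  "lies_over \<phi> Q P \<longleftrightarrow> \<phi> ` P \<subseteq> Q"

definition ram_index :: "('e::field \<Rightarrow> 'f::field) \<Rightarrow> 'f set \<Rightarrow> 'e set \<Rightarrow> nat" where
  "ram_index \<phi> Q P = (THE e. \<forall>z. z \<noteq> 0 \<longrightarrow> place_val Q (\<phi> z) = int e * place_val P z)"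

text \<open>The constants of \<open>F\<close> are those of \<open>K(x)\<close>, embedded by \<open>\<phi> \<circ> rat_const\<close>.\<close>

definition totally_ramified ::
  "('k::field poly fract \<Rightarrow> 'f::field) \<Rightarrow> 'k poly fract set \<Rightarrow> 'f set \<Rightarrow> bool" where
  "totally_ramified \<phi> P Q \<longleftrightarrow>
     is_place rat_const P \<and> is_place (\<phi> \<circ> rat_const) Q \<and> lies_over \<phi> Q P \<and>
     (\<forall>Q'. is_place (\<phi> \<circ> rat_const) Q' \<and> lies_over \<phi> Q' P \<longrightarrow> Q' = Q) \<and>
     ram_index \<phi> Q P = ext_degree \<phi>"

text \<open>\<open>F = K(x, y)\<close> with \<open>y\<^sup>m = f(x)\<close>: no proper subfield of \<open>F\<close> contains \<open>K(x)\<close> and \<open>y\<close>.\<close>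

definition kummer_function_field ::
  "nat \<Rightarrow> 'k::field poly \<Rightarrow> ('k poly fract \<Rightarrow> 'f::field) \<Rightarrow> 'f \<Rightarrow> bool" where
  "kummer_function_field m f \<phi> y \<longleftrightarrow>
     field_hom \<phi> \<and> y ^ m = \<phi> (to_fract f) \<and>
     (\<forall>S. range \<phi> \<subseteq> S \<and> y \<in> S \<and>
        (\<forall>a\<in>S. \<forall>b\<in>S. a + b \<in> S \<and> a - b \<in> S \<and> a * b \<in> S) \<and> (\<forall>a\<in>S. inverse a \<in> S)
        \<longrightarrow> S = UNIV)"

end

theory Submission
  imports Defs "HOL-Library.Cardinality"
begin

text \<open>
  At a totally ramified place the coefficients of a power series expansion force \<open>gcd(\<lambda>\<^sub>k, m) = 1\<close>
  (otherwise \<open>f\<close> would be a proper power), so \<open>1, y, \<dots>, y\<^sup>m\<^sup>-\<^sup>1\<close> is a basis of \<open>F/K(x)\<close> whose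
  multiples by \<open>K(x)\<close> have pairwise different valuations at each \<open>Q\<^sub>k\<close>. An element
  \<open>\<Sum>h\<^sub>i y\<^sup>i\<close> lies in \<open>\<L>(D)\<close> iff all its terms do: at the \<open>Q\<^sub>k\<close> by comparison of valuations, elsewhere
  by averaging over the conjugates of \<open>y\<close>. Each coefficient then runs through a Riemann-Roch space of
  \<open>K(x)\<close>, which gives \<open>\<ell>(D) = \<Sum>\<^sub>i max(0, b\<^sub>i)\<close> with explicit integers \<open>b\<^sub>i\<close>. Applied to large multiples of
  \<open>Q\<^sub>1\<close>, with Riemann's inequality, this determines the genus and shows \<open>\<Sum>\<^sub>i b\<^sub>i = deg D + 1 - g\<close>. Hence \<open>D\<close> is
  non-special of degree \<open>g\<close> iff one \<open>b\<^sub>i\<close> equals 1 and all others vanish; the cases (i) and (ii)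
  correspond to \<open>i = 0\<close> and \<open>i \<noteq> 0\<close>.

  Since \<open>K\<close> is finite, all dimensions are computed by counting elements.
\<close>

section \<open>Discrete valuations\<close>

text \<open>The notions \<open>place_val\<close>, \<open>place_degree\<close>,
  \<open>ram_index\<close> and \<open>genus\<close> are given by description operators, so each of
  them says something only once existence and uniqueness are proved; this is why every place is
  shown to be discrete and of finite degree. The genus is a greatest value over all divisors, hence
  Riemann's inequality is required at places of every degree and not only at the \<open>Q k\<close>.
  Its core, a bound on the zeros of a polynomial in a coordinate \<open>w\<close> of K(x), is
  obtained by counting g-adic expansions, which avoids integral closures and the fundamental
  identity of ramification theory. The function field need not contain the m-th roots of unity, so
  the conjugates of \<open>y\<close> live in its algebraic closure, where a suitable valuation ring
  comes from Zorn's lemma. \<open>P 1\<close> may be a finite place or the pole of x; as it has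
  degree one, K(x) has a coordinate \<open>w\<close> with its only pole there, and
  \<open>P 1\<close> serves as the place at infinity.\<close>

locale discrete_valuation =
  fixes v :: "'a::field \<Rightarrow> int"
  assumes val_mult: "a \<noteq> 0 \<Longrightarrow> b \<noteq> 0 \<Longrightarrow> v (a * b) = v a + v b"
    and val_add_min: "a \<noteq> 0 \<Longrightarrow> b \<noteq> 0 \<Longrightarrow> a + b \<noteq> 0 \<Longrightarrow> min (v a) (v b) \<le> v (a + b)"
    and ex_uniformizer: "\<exists>t. t \<noteq> 0 \<and> v t = 1"
begin

lemma val_1 [simp]: "v 1 = 0"
  using val_mult[of 1 1] by simp

lemma val_power: "a \<noteq> 0 \<Longrightarrow> v (a ^ n) = int n * v a"
  by (induction n) (auto simp: val_mult algebra_simps)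

lemma val_inverse: "a \<noteq> 0 \<Longrightarrow> v (inverse a) = - v a"
  using val_mult[of a "inverse a"] by simp

lemma val_divide: "a \<noteq> 0 \<Longrightarrow> b \<noteq> 0 \<Longrightarrow> v (a / b) = v a - v b"
  by (simp add: divide_inverse val_mult val_inverse)

lemma val_power_int: "a \<noteq> 0 \<Longrightarrow> v (a powi n) = n * v a"
  by (cases "n \<ge> 0") (auto simp: power_int_def val_power val_inverse)

lemma val_minus_1 [simp]: "v (- 1) = 0"
  using val_mult[of "-1" "-1"] by simp

lemma val_minus [simp]: "v (- a) = v a"
  using val_mult[of "-1" a] by (cases "a = 0") auto

lemma val_prod: "finite I \<Longrightarrow> (\<And>i. i \<in> I \<Longrightarrow> g i \<noteq> 0) \<Longrightarrow> v (\<Prod>i\<in>I. g i) = (\<Sum>i\<in>I. v (g i))"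
  by (induction I rule: finite_induct) (auto simp: val_mult)

text \<open>The value \<open>v 0\<close> is arbitrary because \<open>v\<close> takes integer values;
  here 0 counts as having value infinity, so that \<open>val_ge\<close> is closed under sums and
  differences without case distinctions.\<close>

definition val_ge :: "int \<Rightarrow> 'a \<Rightarrow> bool" where
  "val_ge s z \<longleftrightarrow> z = 0 \<or> s \<le> v z"

lemma val_ge_0 [simp]: "val_ge s 0"
  by (simp add: val_ge_def)

lemma val_ge_add: "val_ge s a \<Longrightarrow> val_ge s b \<Longrightarrow> val_ge s (a + b)"
  using val_add_min[of a b] by (cases "a + b = 0"; cases "a = 0"; cases "b = 0") (auto simp: val_ge_def)

lemma val_ge_minus: "val_ge s (- a) \<longleftrightarrow> val_ge s a"
  by (simp add: val_ge_def)

lemma val_ge_diff: "val_ge s a \<Longrightarrow> val_ge s b \<Longrightarrow> val_ge s (a - b)"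
  using val_ge_add[of s a "-b"] by (simp add: val_ge_minus)

lemma val_ge_sum: "(\<And>i. i \<in> I \<Longrightarrow> val_ge s (g i)) \<Longrightarrow> val_ge s (\<Sum>i\<in>I. g i)"
  by (induction I rule: infinite_finite_induct) (auto intro: val_ge_add)

lemma val_ge_mult: "val_ge s a \<Longrightarrow> val_ge s' b \<Longrightarrow> val_ge (s + s') (a * b)"
  by (cases "a = 0 \<or> b = 0") (auto simp: val_ge_def val_mult)

lemma val_ge_mult_0: "val_ge 0 a \<Longrightarrow> val_ge 0 b \<Longrightarrow> val_ge 0 (a * b)"
  using val_ge_mult[of 0 a 0 b] by simp

lemma val_ge_power: "val_ge s a \<Longrightarrow> val_ge (int n * s) (a ^ n)"
  by (cases "a = 0") (auto simp: val_ge_def val_power mult_left_mono power_0_left)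

lemma val_ge_mono: "val_ge s a \<Longrightarrow> s' \<le> s \<Longrightarrow> val_ge s' a"
  by (auto simp: val_ge_def)

lemma val_ge_mult_iff: "b \<noteq> 0 \<Longrightarrow> val_ge s (b * a) \<longleftrightarrow> val_ge (s - v b) a"
  by (cases "a = 0") (auto simp: val_ge_def val_mult)

lemma val_add_eq:
  assumes "a \<noteq> 0" "val_ge (v a + 1) b"
  shows "a + b \<noteq> 0" "v (a + b) = v a"
proof -
  show nz: "a + b \<noteq> 0"
    using assms by (auto simp: val_ge_def add_eq_0_iff)
  show "v (a + b) = v a"
  proof (cases "b = 0")
    case False
    have "min (v (a + b)) (v (- b)) \<le> v (a + b + (- b))"
      by (rule val_add_min) (use assms nz False in auto)
    then show ?thesis
      using val_add_min[of a b] assms nz False by (auto simp: val_ge_def)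
  qed simp
qed

text \<open>A term of least value cannot be cancelled when the values of the nonzero terms are
  pairwise different. Nonvanishing, the attained value and its minimality are carried together
  because the induction step compares the new term with the value of the partial sum.\<close>

lemma val_sum_distinct:
  assumes "finite I" "\<And>i j. i \<in> I \<Longrightarrow> j \<in> I \<Longrightarrow> g i \<noteq> 0 \<Longrightarrow> g j \<noteq> 0 \<Longrightarrow> v (g i) = v (g j) \<Longrightarrow> i = j"
  shows "(\<forall>i\<in>I. g i = 0) \<or>
    sum g I \<noteq> 0 \<and> (\<exists>i\<in>I. g i \<noteq> 0 \<and> v (sum g I) = v (g i) \<and> (\<forall>j\<in>I. g j \<noteq> 0 \<longrightarrow> v (g i) \<le> v (g j)))"
  using assms
proof (induction I rule: finite_induct)
  case (insert a I)
  have IH: "(\<forall>i\<in>I. g i = 0) \<or>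
    sum g I \<noteq> 0 \<and> (\<exists>i\<in>I. g i \<noteq> 0 \<and> v (sum g I) = v (g i) \<and> (\<forall>j\<in>I. g j \<noteq> 0 \<longrightarrow> v (g i) \<le> v (g j)))"
    using insert by auto
  show ?case
  proof (cases "g a = 0")
    case True
    then show ?thesis using IH insert by auto
  next
    case nz: False
    show ?thesis
    proof (cases "\<forall>i\<in>I. g i = 0")
      case True
      then have "sum g I = 0" by simp
      then show ?thesis using True nz insert by auto
    next
      case False
      then obtain i where i: "i \<in> I" "g i \<noteq> 0" "v (sum g I) = v (g i)"
          "\<forall>j\<in>I. g j \<noteq> 0 \<longrightarrow> v (g i) \<le> v (g j)" and sn: "sum g I \<noteq> 0"
        using IH by blast
      have ne: "v (g i) \<noteq> v (g a)"
        using insert.prems[of i a] i nz insert.hyps by auto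
      show ?thesis
      proof (cases "v (g i) < v (g a)")
        case True
        have "val_ge (v (sum g I) + 1) (g a)"
          using True i by (simp add: val_ge_def)
        from val_add_eq[OF sn this] show ?thesis
          using insert.hyps i True by (auto simp: add.commute intro!: bexI[of _ i])
      next
        case False
        have "val_ge (v (g a) + 1) (sum g I)"
          using False i ne by (simp add: val_ge_def)
        from val_add_eq[OF nz this] show ?thesis
          using insert.hyps i False nz by (auto intro!: bexI[of _ a])
      qed
    qed
  qed
qed simp

lemma val_ge_sum_distinct_iff:
  assumes "finite I" "\<And>i j. i \<in> I \<Longrightarrow> j \<in> I \<Longrightarrow> g i \<noteq> 0 \<Longrightarrow> g j \<noteq> 0 \<Longrightarrow> v (g i) = v (g j) \<Longrightarrow> i = j"
  shows "val_ge s (sum g I) \<longleftrightarrow> (\<forall>i\<in>I. val_ge s (g i))"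
proof
  assume "val_ge s (sum g I)"
  then show "\<forall>i\<in>I. val_ge s (g i)"
    using val_sum_distinct[OF assms] by (fastforce simp: val_ge_def)
qed (auto intro: val_ge_sum)

end

lemma place_ring_discrete:
  assumes "discrete_valuation v" and P: "P = {z. z = 0 \<or> v z > 0}"
  shows "place_ring P = {z. z = 0 \<or> v z \<ge> 0}"
proof -
  interpret discrete_valuation v by fact
  show ?thesis by (auto simp: place_ring_def P val_inverse)
qed

text \<open>A generator \<open>t\<close> of \<open>P\<close> divides a uniformizer and lies in
  \<open>P\<close>, so \<open>v t\<close> is at most 1 and positive. Hence the description behind
  \<open>place_val\<close> has a unique solution.\<close>

lemma place_val_discrete:
  assumes "discrete_valuation v" and P: "P = {z. z = 0 \<or> v z > 0}" and z: "z \<noteq> 0"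
  shows "place_val P z = v z"
proof -
  interpret discrete_valuation v by fact
  have R: "place_ring P = {z. z = 0 \<or> v z \<ge> 0}"
    by (rule place_ring_discrete) fact+
  have unif: "t \<noteq> 0 \<and> v t = 1" if t: "P = (\<lambda>w. t * w) ` place_ring P" for t
  proof -
    obtain s where s: "s \<noteq> 0" "v s = 1" using ex_uniformizer by blast
    then have "s \<in> P" by (auto simp: P)
    then obtain w where w: "s = t * w" "w \<in> place_ring P" using t by blast
    with s have nz: "t \<noteq> 0" "w \<noteq> 0" by auto
    then have "v t \<le> 1" using w s by (auto simp: R val_mult)
    moreover have "1 \<in> place_ring P" by (simp add: R)
    then have "t * 1 \<in> P" using t by blast
    then have "v t > 0" using nz by (auto simp: P)
    ultimately show ?thesis using nz by auto
  qed
  obtain t where t: "t \<noteq> 0" "v t = 1" using ex_uniformizer by blast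
  have Pt: "P = (\<lambda>w. t * w) ` place_ring P"
  proof (intro equalityI subsetI)
    fix u assume "u \<in> P"
    then have "u = t * (u / t)" "u / t \<in> place_ring P"
      unfolding R using t by (cases "u = 0"; auto simp: P val_divide)+
    then show "u \<in> (\<lambda>w. t * w) ` place_ring P" by blast
  next
    fix u assume "u \<in> (\<lambda>w. t * w) ` place_ring P"
    then obtain w where "u = t * w" "w = 0 \<or> v w \<ge> 0" unfolding R by blast
    then show "u \<in> P" using t by (cases "w = 0") (auto simp: P val_mult)
  qed
  show ?thesis
    unfolding place_val_def
  proof (rule the_equality)
    have "v (z / t powi v z) = 0"
      using t z by (simp add: val_divide val_power_int)
    moreover have "z / t powi v z \<noteq> 0" "z = t powi v z * (z / t powi v z)" using t z by auto
    ultimately have "P = (\<lambda>w. t * w) ` place_ring P \<and> z / t powi v z \<noteq> 0 \<and>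
        z / t powi v z \<in> place_ring P \<and> inverse (z / t powi v z) \<in> place_ring P \<and>
        z = t powi v z * (z / t powi v z)"
      using Pt val_inverse[of "z / t powi v z"] unfolding R by simp
    then show "\<exists>t' u. P = (\<lambda>w. t' * w) ` place_ring P \<and> u \<noteq> 0 \<and> u \<in> place_ring P \<and>
        inverse u \<in> place_ring P \<and> z = t' powi v z * u"
      by blast
  next
    fix n assume "\<exists>t' u. P = (\<lambda>w. t' * w) ` place_ring P \<and> u \<noteq> 0 \<and> u \<in> place_ring P \<and>
        inverse u \<in> place_ring P \<and> z = t' powi n * u"
    then obtain s u where "P = (\<lambda>w. s * w) ` place_ring P" "u \<noteq> 0" "u \<in> place_ring P"
        "inverse u \<in> place_ring P" "z = s powi n * u" by blast
    moreover have "v u = 0"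
      using \<open>u \<in> place_ring P\<close> \<open>inverse u \<in> place_ring P\<close> \<open>u \<noteq> 0\<close> val_inverse[of u] unfolding R by auto
    ultimately show "n = v z"
      using unif[of s] by (auto simp: val_mult val_power_int)
  qed
qed

text \<open>States that the description \<open>place_val\<close> succeeds at \<open>P\<close>:
  without a local parameter its values would be unspecified.\<close>

definition discrete_place :: "'a::field set \<Rightarrow> bool" where
  "discrete_place P \<longleftrightarrow> discrete_valuation (place_val P) \<and> P = {z. z = 0 \<or> place_val P z > 0}"

lemma discrete_valuation_cong:
  assumes "discrete_valuation v" "\<And>z. z \<noteq> 0 \<Longrightarrow> w z = v z"
  shows "discrete_valuation w"
proof -
  interpret discrete_valuation v by fact
  show ?thesis
    by standard (use assms(2) val_mult val_add_min ex_uniformizer in \<open>force+\<close>)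
qed

lemma discrete_placeI:
  assumes "discrete_valuation v" "P = {z. z = 0 \<or> v z > 0}"
  shows "discrete_place P"
proof -
  have eq: "z \<noteq> 0 \<Longrightarrow> place_val P z = v z" for z
    by (rule place_val_discrete[OF assms])
  have "discrete_valuation (place_val P)"
    using discrete_valuation_cong[OF assms(1)] eq by blast
  moreover have "P = {z. z = 0 \<or> place_val P z > 0}"
    using eq assms(2) by (metis (mono_tags, lifting) Collect_cong)
  ultimately show ?thesis unfolding discrete_place_def by blast
qed

lemma discrete_place_ring:
  assumes "discrete_place P"
  shows "place_ring P = {z. z = 0 \<or> place_val P z \<ge> 0}"
  using assms place_ring_discrete unfolding discrete_place_def by blast

section \<open>Valuation rings\<close>

locale valuation_subring =
  fixes R :: "'f::field set"
  assumes R_add: "a \<in> R \<Longrightarrow> b \<in> R \<Longrightarrow> a + b \<in> R"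
    and R_diff: "a \<in> R \<Longrightarrow> b \<in> R \<Longrightarrow> a - b \<in> R"
    and R_mult: "a \<in> R \<Longrightarrow> b \<in> R \<Longrightarrow> a * b \<in> R"
    and R_total: "z \<noteq> 0 \<Longrightarrow> z \<in> R \<or> inverse z \<in> R"
begin

lemma R_1: "1 \<in> R"
  using R_total[of 1] by simp

lemma R_0: "0 \<in> R"
  using R_diff[OF R_1 R_1] by simp

lemma R_uminus: "a \<in> R \<Longrightarrow> - a \<in> R"
  using R_diff[OF R_0, of a] by simp

lemma R_power: "a \<in> R \<Longrightarrow> a ^ n \<in> R"
  by (induction n) (auto simp: R_1 R_mult)

lemma R_sum: "(\<And>i. i \<in> I \<Longrightarrow> g i \<in> R) \<Longrightarrow> sum g I \<in> R"
  by (induction I rule: infinite_finite_induct) (auto simp: R_0 R_add)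

definition M :: "'f set" where
  "M = {z \<in> R. z = 0 \<or> inverse z \<notin> R}"

definition unit :: "'f \<Rightarrow> bool" where
  "unit z \<longleftrightarrow> z \<noteq> 0 \<and> z \<in> R \<and> inverse z \<in> R"

lemma M_sub: "M \<subseteq> R"
  by (auto simp: M_def)

lemma M_0: "0 \<in> M"
  by (simp add: M_def R_0)

lemma M_1: "1 \<notin> M"
  by (simp add: M_def R_1)

lemma notin_R_imp: "z \<notin> R \<Longrightarrow> inverse z \<in> M"
  using R_total[of z] R_0 by (cases "z = 0") (auto simp: M_def)

lemma unit_iff: "unit z \<longleftrightarrow> z \<in> R \<and> z \<notin> M"
  by (auto simp: unit_def M_def R_0)

lemma unit_1: "unit 1"
  by (simp add: unit_def R_1)

lemma unit_mult: "unit a \<Longrightarrow> unit b \<Longrightarrow> unit (a * b)"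
  by (auto simp: unit_def R_mult)

lemma unit_inverse: "unit a \<Longrightarrow> unit (inverse a)"
  by (auto simp: unit_def)

lemma unit_divide: "unit a \<Longrightarrow> unit b \<Longrightarrow> unit (a / b)"
  by (simp add: divide_inverse unit_mult unit_inverse)

lemma unit_power: "unit a \<Longrightarrow> unit (a ^ n)"
  by (induction n) (auto simp: unit_1 unit_mult)

lemma M_mult: "r \<in> R \<Longrightarrow> a \<in> M \<Longrightarrow> r * a \<in> M"
proof -
  assume r: "r \<in> R" and a: "a \<in> M"
  show ?thesis
  proof (rule ccontr)
    assume "r * a \<notin> M"
    then have u: "r * a \<noteq> 0" "inverse (r * a) \<in> R"
      using r a by (auto simp: M_def R_mult R_0)
    have "inverse a = r * inverse (r * a)" using u by (simp add: field_simps)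
    then have "inverse a \<in> R" using R_mult[OF r u(2)] by metis
    then show False using a u by (auto simp: M_def)
  qed
qed

lemma M_add: "a \<in> M \<Longrightarrow> b \<in> M \<Longrightarrow> a + b \<in> M"
proof -
  assume ab: "a \<in> M" "b \<in> M"
  have *: "x + z \<in> M" if "x \<in> M" "z \<in> M" "z \<noteq> 0" "x / z \<in> R" for x z
  proof -
    have "(x / z + 1) * z \<in> M" using that by (intro M_mult R_add R_1)
    moreover have "(x / z + 1) * z = x + z" using that by (simp add: field_simps)
    ultimately show ?thesis by simp
  qed
  show ?thesis
  proof (cases "a = 0 \<or> b = 0")
    case False
    then have "a / b \<in> R \<or> b / a \<in> R" using R_total[of "a / b"] by auto
    then show ?thesis using *[of a b] *[of b a] ab False by (auto simp: add.commute)
  qed (use ab in auto)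
qed

lemma M_uminus: "a \<in> M \<Longrightarrow> - a \<in> M"
  using M_mult[of "-1" a] R_uminus[OF R_1] by simp

lemma M_diff: "a \<in> M \<Longrightarrow> b \<in> M \<Longrightarrow> a - b \<in> M"
  using M_add[OF _ M_uminus, of a b] by simp

lemma M_sum: "(\<And>i. i \<in> I \<Longrightarrow> g i \<in> M) \<Longrightarrow> sum g I \<in> M"
  by (induction I rule: infinite_finite_induct) (auto simp: M_0 M_add)

lemma M_power: "a \<in> M \<Longrightarrow> 0 < n \<Longrightarrow> a ^ n \<in> M"
proof -
  assume a: "a \<in> M" "0 < n"
  then obtain k where "n = Suc k" by (cases n) auto
  with a show ?thesis using M_mult[of "a ^ k" a] M_sub by (auto simp: R_power mult.commute)
qed

text \<open>The inverse of an element outside \<open>R\<close> lies in \<open>M\<close>, so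
  \<open>z ^ n * inverse z ^ n\<close> would place 1 in \<open>M\<close>.\<close>

lemma R_root: "z ^ n \<in> R \<Longrightarrow> 0 < n \<Longrightarrow> z \<in> R"
proof (rule ccontr)
  assume zn: "z ^ n \<in> R" "0 < n" and "z \<notin> R"
  then have z: "inverse z \<in> M" "z \<noteq> 0" using notin_R_imp R_0 by auto
  then have "inverse z ^ n \<in> M" using zn by (simp add: M_power)
  then have "z ^ n * inverse z ^ n \<in> M" using zn by (simp add: M_mult)
  then show False using z M_1 by (simp flip: power_mult_distrib)
qed

text \<open>Divisibility in \<open>R\<close> is total, so one of the finitely many
  \<open>a i\<close> divides all the others. Dividing the relation by it gives -1 as the sum of the
  remaining quotients; if none of them were a unit, all would lie in \<open>M\<close>.\<close>

lemma unit_ratio_if_sum_0: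
  assumes "finite I" "I \<noteq> {}" and nz: "\<And>i. i \<in> I \<Longrightarrow> a i \<noteq> 0" and s0: "sum a I = 0"
  shows "\<exists>i\<in>I. \<exists>j\<in>I. i \<noteq> j \<and> unit (a i / a j)"
proof -
  have "\<exists>i\<in>I. \<forall>j\<in>I. a j / a i \<in> R"
    using assms(1,2) nz
  proof (induction I rule: finite_ne_induct)
    case (singleton x)
    then show ?case by (simp add: R_1)
  next
    case (insert x I)
    then obtain i where i: "i \<in> I" "\<And>j. j \<in> I \<Longrightarrow> a j / a i \<in> R" by auto
    have nz: "a x \<noteq> 0" "a i \<noteq> 0" using insert.prems i by auto
    then consider "a x / a i \<in> R" | "a i / a x \<in> R" using R_total[of "a x / a i"] by auto
    then show ?case
    proof cases
      case 1
      then show ?thesis using i by (intro bexI[of _ i]) auto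
    next
      case 2
      have "a j / a x \<in> R" if "j \<in> I" for j
        using R_mult[OF i(2)[OF that] 2] nz by simp
      then show ?thesis using nz by (intro bexI[of _ x]) (auto simp: R_1)
    qed
  qed
  then obtain i where i: "i \<in> I" "\<And>j. j \<in> I \<Longrightarrow> a j / a i \<in> R" by auto
  show ?thesis
  proof (rule ccontr)
    assume neg: "\<not> ?thesis"
    have "a j / a i \<in> M" if "j \<in> I - {i}" for j
    proof -
      have "\<not> unit (a j / a i)" using neg i that by auto
      then show ?thesis using i that by (auto simp: unit_iff)
    qed
    then have "(\<Sum>j\<in>I - {i}. a j / a i) \<in> M" by (rule M_sum)
    also have "(\<Sum>j\<in>I - {i}. a j / a i) = (sum a I - a i) / a i"
      using assms(1) i by (simp add: sum_divide_distrib sum.remove[of I i] flip: sum_divide_distrib)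
    also have "\<dots> = - 1" using s0 nz[OF i(1)] by simp
    finally show False using M_uminus[of "-1"] M_1 by simp
  qed
qed

text \<open>Up to units every N-th power is a power of \<open>g\<close>, so \<open>V\<close> is a
  homomorphism to the integers, namely the valuation scaled to take the value \<open>N\<close> at
  \<open>g\<close>. Dividing by the least positive value normalises it.\<close>

lemma discrete_of_root:
  assumes g: "g \<in> M" "g \<noteq> 0" and N: "0 < N"
    and ex: "\<And>z. z \<noteq> 0 \<Longrightarrow> \<exists>k::int. unit (z ^ N / g powi k)"
  shows "discrete_place M"
proof -
  have gM: "g powi k \<in> M" if "k > 0" for k :: int
    using that g by (auto simp: power_int_def intro!: M_power)
  have gR: "k \<ge> 0" if "g powi k \<in> R" for k :: int
  proof (rule ccontr)
    assume "\<not> k \<ge> 0"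
    then have "g powi k * g powi (-k) \<in> M" using that gM[of "-k"] by (simp add: M_mult)
    then show False using g M_1 by (simp flip: power_int_add)
  qed
  define V where "V z = (SOME k::int. unit (z ^ N / g powi k))" for z
  have V: "unit (z ^ N / g powi V z)" if "z \<noteq> 0" for z
    unfolding V_def using ex[OF that] by (rule someI_ex)
  have uniq: "k = V z" if "z \<noteq> 0" "unit (z ^ N / g powi k)" for z k
  proof -
    have "unit ((z ^ N / g powi k) / (z ^ N / g powi V z))"
      "unit ((z ^ N / g powi V z) / (z ^ N / g powi k))"
      by (rule unit_divide[OF that(2) V[OF that(1)]], rule unit_divide[OF V[OF that(1)] that(2)])
    then have "unit (g powi (V z - k))" "unit (g powi (k - V z))"
      using that g by (simp_all add: field_simps power_int_diff)
    then show ?thesis using gR[of "V z - k"] gR[of "k - V z"] by (simp add: unit_def)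
  qed
  have Vm: "V (a * b) = V a + V b" if "a \<noteq> 0" "b \<noteq> 0" for a b
  proof -
    have "unit ((a * b) ^ N / g powi (V a + V b))"
      using unit_mult[OF V[OF that(1)] V[OF that(2)]] g
      by (simp add: power_int_add power_mult_distrib)
    then show ?thesis using uniq[of "a * b"] that by auto
  qed
  have V1: "V 1 = 0" using Vm[of 1 1] by simp
  have Vi: "V (inverse a) = - V a" if "a \<noteq> 0" for a
    using Vm[of a "inverse a"] that V1 by simp
  have Vp: "V (a powi k) = k * V a" if "a \<noteq> 0" for a k
  proof -
    have "V (b ^ n) = int n * V b" if "b \<noteq> 0" for n b
      by (induction n) (auto simp: V1 Vm that algebra_simps)
    then show ?thesis using that by (cases "k \<ge> 0") (auto simp: power_int_def Vi)
  qed
  have VR1: "V z \<ge> 0" if "z \<in> R" "z \<noteq> 0" for z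
  proof -
    have "z ^ N * inverse (z ^ N / g powi V z) \<in> R"
      using V[OF that(2)] R_power[OF that(1), of N] unfolding unit_def by (intro R_mult) auto
    moreover have "z ^ N * inverse (z ^ N / g powi V z) = g powi V z" using that by simp
    ultimately show ?thesis by (intro gR) simp
  qed
  have VM1: "V z > 0" if "z \<in> M" "z \<noteq> 0" for z
  proof -
    have "V z \<noteq> 0"
    proof
      assume "V z = 0"
      then have "unit (z ^ N)" using V[of z] that by simp
      then show False using M_power[OF that(1) N] by (simp add: unit_iff)
    qed
    then show ?thesis using VR1[of z] that M_sub by force
  qed
  have VR: "z \<in> R \<longleftrightarrow> V z \<ge> 0" if "z \<noteq> 0" for z
    using VR1[of z] VM1[of "inverse z"] notin_R_imp[of z] Vi[of z] that by fastforce
  \<comment> \<open>The image of \<open>V\<close> is a subgroup of the integers, generated by its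
    least positive element \<open>e\<close>.\<close>
  define S where "S = {n::nat. 0 < n \<and> (\<exists>z. z \<noteq> 0 \<and> V z = int n)}"
  have "nat (V g) \<in> S" using VM1[of g] g by (auto simp: S_def intro!: exI[of _ g])
  then have LS: "(LEAST n. n \<in> S) \<in> S" by (rule LeastI)
  define e where "e = (LEAST n. n \<in> S)"
  from LS obtain t where t: "t \<noteq> 0" "V t = int e" "0 < e" by (auto simp: S_def e_def)
  have dvd: "int e dvd V z" if "z \<noteq> 0" for z
  proof (rule ccontr)
    assume nd: "\<not> int e dvd V z"
    define r where "r = V z mod int e"
    have r: "0 < r" "r < int e"
    proof -
      have "r \<noteq> 0" using nd by (simp add: r_def dvd_eq_mod_eq_0)
      moreover have "0 \<le> r" "r < int e" using t by (simp_all add: r_def)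
      ultimately show "0 < r" "r < int e" by linarith+
    qed
    have "V (z * t powi (- (V z div int e))) = V z - V z div int e * int e"
      using that t by (subst Vm) (auto simp: Vp)
    also have "\<dots> = r" unfolding r_def by (simp add: minus_div_mult_eq_mod)
    finally have "nat r \<in> S" using r that t
      by (auto simp: S_def intro!: exI[of _ "z * t powi (- (V z div int e))"])
    then have "e \<le> nat r" unfolding e_def by (rule Least_le)
    with r show False by simp
  qed
  define v where "v z = V z div int e" for z
  have Ve: "V z = int e * v z" if "z \<noteq> 0" for z using dvd[OF that] by (simp add: v_def)
  have "discrete_valuation v"
  proof
    fix a b :: 'f assume ab: "a \<noteq> 0" "b \<noteq> 0"
    have "int e * v (a * b) = int e * (v a + v b)"
      using Ve[of "a * b"] Vm[OF ab] ab by (simp add: Ve algebra_simps)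
    then show "v (a * b) = v a + v b" using t by simp
    assume ne: "a + b \<noteq> 0"
    have *: "V y \<le> V (x + y)" if "x \<noteq> 0" "y \<noteq> 0" "x + y \<noteq> 0" "V y \<le> V x" for x y
    proof -
      have "V (x / y) \<ge> 0" using that by (simp add: divide_inverse Vm Vi)
      then have "x / y + 1 \<in> R" using that by (intro R_add R_1) (simp add: VR)
      moreover have "x / y + 1 = (x + y) * inverse y" using that by (simp add: field_simps)
      ultimately have "V ((x + y) * inverse y) \<ge> 0" using that VR[of "(x + y) * inverse y"] by simp
      then show ?thesis using that by (simp add: Vm Vi)
    qed
    have "min (V a) (V b) \<le> V (a + b)"
      using *[of a b] *[of b a] ab ne by (simp add: add.commute min_def)
    then have "int e * min (v a) (v b) \<le> int e * v (a + b)"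
      using Ve ab ne t by (simp add: min_def split: if_splits)
    then show "min (v a) (v b) \<le> v (a + b)" using t by simp
  next
    show "\<exists>t. t \<noteq> 0 \<and> v t = 1" using t by (auto simp: v_def)
  qed
  moreover have "M = {z. z = 0 \<or> v z > 0}"
  proof -
    have "z \<in> M \<longleftrightarrow> v z > 0" if "z \<noteq> 0" for z
    proof -
      have "z \<in> M \<longleftrightarrow> V z > 0"
        using that VR[of z] VR[of "inverse z"] Vi[of z] by (auto simp: M_def)
      then show ?thesis using Ve[OF that] t by (simp add: zero_less_mult_iff)
    qed
    then have "z \<in> M \<longleftrightarrow> z = 0 \<or> v z > 0" for z using M_0 by (cases "z = 0") auto
    then show ?thesis by blast
  qed
  ultimately show ?thesis by (rule discrete_placeI)
qed

end

lemma valuation_ringD: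
  assumes "valuation_ring \<iota> R"
  shows "valuation_subring R" "range \<iota> \<subset> R" "R \<subset> UNIV"
proof -
  show "valuation_subring R"
    using assms unfolding valuation_ring_def by unfold_locales blast+
  show "range \<iota> \<subset> R" "R \<subset> UNIV"
    using assms unfolding valuation_ring_def by simp_all
qed

lemma is_placeE:
  assumes "is_place \<iota> Q"
  obtains "valuation_subring (place_ring Q)" "range \<iota> \<subset> place_ring Q" "place_ring Q \<noteq> UNIV"
    "Q = valuation_subring.M (place_ring Q)"
proof -
  obtain R where R: "valuation_ring \<iota> R" "Q = {z \<in> R. z = 0 \<or> inverse z \<notin> R}"
    using assms unfolding is_place_def by blast
  interpret valuation_subring R using valuation_ringD[OF R(1)] by blast
  have "z \<in> place_ring Q \<longleftrightarrow> z \<in> R" for z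
    using R_0 R_total[of z] by (cases "z = 0") (auto simp: place_ring_def R(2))
  then have "place_ring Q = R" by blast
  then show thesis using that valuation_ringD[OF R(1)] R(2) M_def by auto
qed

lemma is_placeI:
  assumes "valuation_subring R" "range \<iota> \<subset> R" "R \<noteq> UNIV"
  shows "is_place \<iota> (valuation_subring.M R)"
proof -
  interpret valuation_subring R by fact
  have "valuation_ring \<iota> R"
    unfolding valuation_ring_def using assms R_add R_diff R_mult R_total by (simp add: psubset_eq)
  then show ?thesis unfolding is_place_def M_def by blast
qed

lemma place_ring_M:
  assumes "valuation_subring R"
  shows "place_ring (valuation_subring.M R) = R"
proof -
  interpret valuation_subring R by fact
  have "z \<in> place_ring M \<longleftrightarrow> z \<in> R" for z
    using R_0 R_total[of z] by (cases "z = 0") (auto simp: place_ring_def M_def)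
  then show ?thesis by blast
qed

section \<open>Generators of the rational function field\<close>

interpretation rat_const: field_hom "rat_const :: 'k::field \<Rightarrow> 'k poly fract"
  by unfold_locales (auto simp: rat_const_def one_poly_def simp flip: to_fract_add to_fract_mult)

interpretation map_rat_const: map_poly_inj_idom_hom "rat_const :: 'k::field \<Rightarrow> 'k poly fract" ..

text \<open>The value p(w) in K(x). Writing elements through an arbitrary generator \<open>w\<close>
  instead of x treats finite places and the place at infinity alike.\<close>

definition ev :: "'k::field poly fract \<Rightarrow> 'k poly \<Rightarrow> 'k poly fract" where
  "ev w p = poly (map_poly rat_const p) w"

lemma ev_0 [simp]: "ev w 0 = 0"
  and ev_1 [simp]: "ev w 1 = 1"
  and ev_add: "ev w (p + q) = ev w p + ev w q"
  and ev_diff: "ev w (p - q) = ev w p - ev w q"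
  and ev_mult: "ev w (p * q) = ev w p * ev w q"
  and ev_pCons: "ev w (pCons c p) = rat_const c + w * ev w p"
  and ev_power: "ev w (p ^ n) = ev w p ^ n"
  by (simp_all add: ev_def hom_distribs)

lemma ev_const [simp]: "ev w [:c:] = rat_const c"
  by (simp add: ev_pCons)

lemma ev_smult: "ev w (smult c p) = rat_const c * ev w p"
  by (simp add: ev_def hom_distribs)

lemma ev_X [simp]: "ev w (pCons 0 1) = w"
  by (simp add: ev_pCons)

text \<open>\<open>gen w\<close> means that \<open>w\<close> is transcendental over \<open>K\<close> and \<open>K(w) = K(x)\<close>.\<close>

definition gen :: "'k::field poly fract \<Rightarrow> bool" where
  "gen w \<longleftrightarrow> (\<forall>p. ev w p = 0 \<longrightarrow> p = 0) \<and> (\<forall>h. \<exists>a b. b \<noteq> 0 \<and> h = ev w a / ev w b)"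

lemma gen_eq_0_iff [simp]: "gen w \<Longrightarrow> ev w p = 0 \<longleftrightarrow> p = 0"
  by (auto simp: gen_def)

lemma gen_eq_iff: "gen w \<Longrightarrow> ev w p = ev w q \<longleftrightarrow> p = q"
  using gen_eq_0_iff[of w "p - q"] by (simp add: ev_diff)

lemma gen_nonzero: "gen w \<Longrightarrow> w \<noteq> 0"
  using gen_eq_0_iff[of w "pCons 0 1"] by auto

lemma genE:
  assumes "gen w"
  obtains a b where "b \<noteq> 0" "h = ev w a / ev w b"
  using assms unfolding gen_def by blast

text \<open>A fraction with denominator of minimal degree is reduced.\<close>

lemma gen_reducedE:
  assumes "gen w"
  obtains a b where "b \<noteq> 0" "h = ev w a / ev w b" "\<And>p. p dvd a \<Longrightarrow> p dvd b \<Longrightarrow> degree p = 0"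
proof -
  define S where "S = {b. b \<noteq> 0 \<and> (\<exists>a. h = ev w a / ev w b)}"
  have "\<exists>b. b \<in> S" using assms unfolding gen_def S_def by blast
  then obtain b where b: "b \<in> S" "\<And>c. c \<in> S \<Longrightarrow> degree b \<le> degree c"
    using ex_has_least_nat[of "\<lambda>b. b \<in> S" _ degree] by blast
  then obtain a where a: "b \<noteq> 0" "h = ev w a / ev w b" by (auto simp: S_def)
  have "degree p = 0" if p: "p dvd a" "p dvd b" for p
  proof -
    obtain a' where a': "a = p * a'" using p(1) by (rule dvdE)
    obtain b' where "b = p * b'" using p(2) by (rule dvdE)
    note ab = a' this
    with a have "p \<noteq> 0" "b' \<noteq> 0" by auto
    then have "b' \<in> S" using a ab assms by (auto simp: S_def ev_mult intro!: exI[of _ a'])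
    with b(2) have "degree b \<le> degree b'" by blast
    then show ?thesis using ab \<open>p \<noteq> 0\<close> \<open>b' \<noteq> 0\<close> by (simp add: degree_mult_eq)
  qed
  with a that show thesis by blast
qed

lemma ev_x: "ev (to_fract [:0, 1:]) p = to_fract p"
proof (induction p)
  case (pCons c p)
  have "pCons c p = [:c:] + [:0, 1:] * p" by simp
  then have "to_fract (pCons c p) = to_fract ([:c:] + [:0, 1:] * p)" by (rule arg_cong)
  then show ?case using pCons by (simp add: ev_pCons rat_const_def del: mult_pCons_left add_pCons)
qed simp

lemma gen_x: "gen (to_fract [:0, 1:])"
  unfolding gen_def
proof (intro conjI allI)
  fix h :: "'a poly fract"
  obtain a b where "h = Fract a b" "b \<noteq> 0" by (cases h) auto
  then show "\<exists>a b. b \<noteq> 0 \<and> h = ev (to_fract [:0, 1:]) a / ev (to_fract [:0, 1:]) b"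
    unfolding ev_x Fract_conv_to_fract by blast
qed (simp only: ev_x to_fract_eq_0_iff, simp)

text \<open>The quotients of polynomials in \<open>w\<close> are closed under sums, products and
  inverses. They contain \<open>u\<close>, hence every quotient of polynomials in \<open>u\<close>,
  which is every element.\<close>

lemma gen_trans:
  assumes u: "gen u" and inj: "\<And>p. ev w p = 0 \<Longrightarrow> p = 0"
    and uw: "d \<noteq> 0" "u = ev w c / ev w d"
  shows "gen w"
proof -
  define S where "S = {h. \<exists>a b. b \<noteq> 0 \<and> h = ev w a / ev w b}"
  have nz: "ev w p \<noteq> 0" if "p \<noteq> 0" for p using inj that by blast
  have S_ev: "ev w p \<in> S" for p unfolding S_def by (intro CollectI exI[of _ p] exI[of _ 1]) simp
  have S_mult: "h * h' \<in> S" if "h \<in> S" "h' \<in> S" for h h'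
  proof -
    from that obtain a b a' b' where "b \<noteq> 0" "h = ev w a / ev w b" "b' \<noteq> 0" "h' = ev w a' / ev w b'"
      by (auto simp: S_def)
    then have "b * b' \<noteq> 0 \<and> h * h' = ev w (a * a') / ev w (b * b')" by (simp add: ev_mult)
    then show ?thesis unfolding S_def by blast
  qed
  have S_add: "h + h' \<in> S" if "h \<in> S" "h' \<in> S" for h h'
  proof -
    from that obtain a b a' b' where *: "b \<noteq> 0" "h = ev w a / ev w b" "b' \<noteq> 0" "h' = ev w a' / ev w b'"
      by (auto simp: S_def)
    then have "h + h' = ev w (a * b' + a' * b) / ev w (b * b')"
      using nz[of b] nz[of b'] by (simp add: ev_mult ev_add add_frac_eq * )
    moreover have "b * b' \<noteq> 0" using * by simp
    ultimately show ?thesis unfolding S_def by blast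
  qed
  have S_inv: "inverse h \<in> S" if "h \<in> S" for h
  proof -
    from that obtain a b where *: "b \<noteq> 0" "h = ev w a / ev w b" by (auto simp: S_def)
    show ?thesis
    proof (cases "a = 0")
      case True
      then show ?thesis using * S_ev[of 0] by simp
    next
      case False
      moreover have "inverse h = ev w b / ev w a" using * by simp
      ultimately show ?thesis unfolding S_def by blast
    qed
  qed
  have uS: "u \<in> S" using uw by (auto simp: S_def)
  have evu: "ev u p \<in> S" for p
  proof (induction p)
    case (pCons c p)
    have "rat_const c \<in> S" using S_ev[of "[:c:]"] by simp
    then show ?case using pCons uS by (simp add: ev_pCons S_add S_mult)
  qed (use S_ev[of 0] in simp)
  have "h \<in> S" for h
  proof -
    obtain a b where "h = ev u a / ev u b" using genE[OF u] by metis
    then show ?thesis by (simp add: divide_inverse S_mult S_inv evu)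
  qed
  then show ?thesis unfolding gen_def using inj by (auto simp: S_def)
qed

lemma ev_inverse: "w \<noteq> 0 \<Longrightarrow> ev w (reflect_poly p) = w ^ degree p * ev (inverse w) p"
proof -
  assume "w \<noteq> 0"
  have "map_poly rat_const (reflect_poly p) = reflect_poly (map_poly rat_const p)"
    by (rule poly_eqI) (simp add: coeff_reflect_poly)
  then show ?thesis using \<open>w \<noteq> 0\<close> by (simp add: ev_def poly_reflect_poly_nz)
qed

lemma ev_shift: "ev (w + rat_const c) p = ev w (pcompose p [:c, 1:])"
  by (induction p) (simp_all add: ev_pCons pcompose_pCons ev_add ev_mult ev_smult algebra_simps)

lemma pcompose_shift_inverse: "pcompose (pcompose p [:c, 1:]) [:- c, 1:] = (p :: 'a::comm_ring_1 poly)"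
proof -
  have "pcompose [:c, 1:] [:- c, 1:] = pCons 0 1" by (simp add: pcompose_pCons)
  then show ?thesis using pcompose_idR[of p] by (simp flip: pcompose_assoc)
qed

lemma gen_inverse:
  assumes "gen w"
  shows "gen (inverse w)"
proof (rule gen_trans[OF assms])
  fix p assume "ev (inverse w) p = 0"
  then have "ev w (reflect_poly p) = 0" using assms by (simp add: ev_inverse gen_nonzero)
  then show "p = 0" using assms by simp
next
  show "w = ev (inverse w) 1 / ev (inverse w) (pCons 0 1)" by (simp add: divide_inverse)
qed simp

lemma gen_shift:
  assumes "gen w"
  shows "gen (w + rat_const c)"
proof (rule gen_trans[OF assms])
  fix p assume "ev (w + rat_const c) p = 0"
  then have "pcompose p [:c, 1:] = 0" using assms by (simp add: ev_shift)
  then show "p = 0" using pcompose_shift_inverse[of p c] by simp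
next
  show "w = ev (w + rat_const c) [:- c, 1:] / ev (w + rat_const c) 1"
    by (simp add: ev_pCons rat_const.hom_uminus)
qed simp

lemma poly_power_split:
  fixes c :: "'k::field poly"
  assumes "c \<noteq> 0" "\<not> is_unit p"
  obtains k c' where "c = p ^ k * c'" "\<not> p dvd c'"
proof -
  have "\<exists>k c'. c = p ^ k * c' \<and> \<not> p dvd c'"
    using assms(1)
  proof (induction "degree c" arbitrary: c rule: less_induct)
    case less
    show ?case
    proof (cases "p dvd c")
      case True
      then obtain d where d: "c = p * d" by (auto simp: dvd_def)
      with less.prems assms have nz: "d \<noteq> 0" "p \<noteq> 0" by auto
      then have "degree p > 0" using assms(2) by (simp add: is_unit_iff_degree)
      then have "degree d < degree c" using d nz by (simp add: degree_mult_eq)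
      then obtain k c' where "d = p ^ k * c'" "\<not> p dvd c'" using less.hyps nz by blast
      then show ?thesis using d by (intro exI[of _ "Suc k"] exI[of _ c']) (simp add: mult.assoc)
    next
      case False
      then show ?thesis by (intro exI[of _ 0] exI[of _ c]) simp
    qed
  qed
  then show thesis using that by blast
qed

section \<open>Places of algebraic extensions of the rational function field\<close>

text \<open>The bound \<open>N\<close> is uniform in \<open>z\<close>; this lets
  \<open>fact N\<close> serve as one exponent for all elements in
  \<open>place_discrete\<close>.\<close>

locale alg_extension = field_hom \<phi> for \<phi> :: "'k::field poly fract \<Rightarrow> 'f::field" +
  fixes N :: nat
  assumes algebraic: "\<exists>p. p \<noteq> 0 \<and> degree p \<le> N \<and> poly (map_poly \<phi> p) z = 0"
begin

lemma alg_relation: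
  obtains p where "p \<noteq> 0" "degree p \<le> N" "(\<Sum>i\<le>degree p. \<phi> (coeff p i) * z ^ i) = 0"
proof -
  obtain p where p: "p \<noteq> 0" "degree p \<le> N" "poly (map_poly \<phi> p) z = 0"
    using algebraic by blast
  then show thesis by (intro that[of p]) (simp_all add: poly_altdef)
qed

text \<open>In an algebraic relation of \<open>z\<close> two nonzero terms must agree up to a unit;
  their quotient compares a power of \<open>z\<close> with an element of K(x).\<close>

lemma power_ratio_unit:
  assumes "valuation_subring R" "z \<noteq> 0"
  obtains d h where "0 < d" "d \<le> N" "h \<noteq> 0" "valuation_subring.unit R (z ^ d / \<phi> h)"
proof -
  interpret V: valuation_subring R by fact
  obtain q where q: "q \<noteq> 0" "degree q \<le> N" "(\<Sum>i\<le>degree q. \<phi> (coeff q i) * z ^ i) = 0"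
    by (rule alg_relation)
  define a where "a i = \<phi> (coeff q i) * z ^ i" for i
  define I where "I = {i. i \<le> degree q \<and> coeff q i \<noteq> 0}"
  have "sum a I = (\<Sum>i\<le>degree q. a i)"
    by (rule sum.mono_neutral_left) (auto simp: I_def a_def)
  then have "sum a I = 0" using q by (simp add: a_def)
  moreover have "finite I" "I \<noteq> {}" using q by (auto simp: I_def)
  moreover have "a i \<noteq> 0" if "i \<in> I" for i using that assms(2) by (simp add: a_def I_def)
  ultimately have "\<exists>i\<in>I. \<exists>j\<in>I. i \<noteq> j \<and> V.unit (a i / a j)"
    by (intro V.unit_ratio_if_sum_0) auto
  then obtain i j where ij: "i \<in> I" "j \<in> I" "i \<noteq> j" "V.unit (a i / a j)" by blast
  show thesis
  proof (cases "i < j")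
    case True
    have "V.unit (inverse (a i / a j))" using ij by (intro V.unit_inverse)
    also have "inverse (a i / a j) = z ^ (j - i) / \<phi> (coeff q i / coeff q j)"
      using True assms(2) ij by (simp add: a_def I_def power_diff hom_distribs field_simps)
    finally show ?thesis using True ij q
      by (intro that[of "j - i" "coeff q i / coeff q j"]) (auto simp: I_def)
  next
    case False
    have "a i / a j = z ^ (i - j) / \<phi> (coeff q j / coeff q i)"
      using False assms(2) ij by (simp add: a_def I_def power_diff hom_distribs field_simps)
    then have "V.unit (z ^ (i - j) / \<phi> (coeff q j / coeff q i))" using ij by simp
    then show ?thesis using False ij q
      by (intro that[of "i - j" "coeff q j / coeff q i"]) (auto simp: I_def)
  qed
qed

text \<open>Some power of \<open>z\<close> is a unit times an element of K(x), so it lies in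
  \<open>R\<close>, and then so does \<open>z\<close>. Thus a place of the extension cannot become
  trivial on K(x).\<close>

lemma eq_UNIV_if_range_subset:
  assumes "valuation_subring R" "range \<phi> \<subseteq> R"
  shows "R = UNIV"
proof -
  interpret V: valuation_subring R by fact
  have "z \<in> R" for z
  proof (cases "z = 0")
    case False
    obtain d h where d: "0 < d" "h \<noteq> 0" "V.unit (z ^ d / \<phi> h)"
      by (rule power_ratio_unit[OF assms(1) False])
    have "\<phi> h \<in> R" using assms(2) by blast
    then have "z ^ d / \<phi> h * \<phi> h \<in> R" using d by (intro V.R_mult) (auto simp: V.unit_def)
    then show ?thesis using d by (auto intro: V.R_root)
  qed (simp add: V.R_0)
  then show ?thesis by blast
qed

lemma ev_in_ring:
  assumes "valuation_subring R" "range (\<phi> \<circ> rat_const) \<subseteq> R" "\<phi> w \<in> R"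
  shows "\<phi> (ev w c) \<in> R"
proof -
  interpret V: valuation_subring R by fact
  show ?thesis
  proof (induction c)
    case (pCons a c)
    then show ?case using assms by (auto simp: ev_pCons hom_distribs intro!: V.R_add V.R_mult)
  qed (simp add: V.R_0)
qed

text \<open>The polynomials whose value at \<open>w\<close> lies in the maximal ideal form an ideal,
  and \<open>p\<close> is a nonzero member of least degree. One exists because otherwise all of K(x)
  would lie in \<open>R\<close>.\<close>

lemma place_min_poly:
  assumes R: "valuation_subring R" "range (\<phi> \<circ> rat_const) \<subseteq> R" "R \<noteq> UNIV"
    and w: "gen w" "\<phi> w \<in> R"
  obtains p where "p \<noteq> 0" "\<And>c. \<phi> (ev w c) \<in> valuation_subring.M R \<longleftrightarrow> p dvd c"
proof -
  interpret V: valuation_subring R by fact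
  note evR = ev_in_ring[OF R(1,2) w(2)]
  have "\<exists>p. p \<noteq> 0 \<and> \<phi> (ev w p) \<in> V.M"
  proof (rule ccontr)
    assume neg: "\<not> ?thesis"
    have "\<phi> h \<in> R" for h
    proof -
      obtain a b where ab: "b \<noteq> 0" "h = ev w a / ev w b" by (rule genE[OF w(1)])
      then have "V.unit (\<phi> (ev w b))" using neg evR by (auto simp: V.unit_iff)
      then show ?thesis using ab evR[of a] by (simp add: divide_inverse hom_distribs V.unit_def V.R_mult)
    qed
    then have "range \<phi> \<subseteq> R" by blast
    then show False using eq_UNIV_if_range_subset[OF R(1)] R(3) by simp
  qed
  then obtain p where "p \<noteq> 0 \<and> \<phi> (ev w p) \<in> V.M"
      and "\<forall>q. q \<noteq> 0 \<and> \<phi> (ev w q) \<in> V.M \<longrightarrow> degree p \<le> degree q"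
    using ex_has_least_nat[of "\<lambda>p. p \<noteq> 0 \<and> \<phi> (ev w p) \<in> V.M" _ degree] by metis
  then have p: "p \<noteq> 0" "\<phi> (ev w p) \<in> V.M"
      and least: "\<And>q. q \<noteq> 0 \<Longrightarrow> \<phi> (ev w q) \<in> V.M \<Longrightarrow> degree p \<le> degree q"
    by blast+
  have "\<phi> (ev w c) \<in> V.M \<longleftrightarrow> p dvd c" for c
  proof
    assume "p dvd c"
    then obtain d where "c = d * p" by (auto simp: dvd_def mult.commute)
    then show "\<phi> (ev w c) \<in> V.M" using p evR[of d] by (simp add: ev_mult hom_distribs V.M_mult)
  next
    assume c: "\<phi> (ev w c) \<in> V.M"
    have "c mod p = c - c div p * p" by (simp add: minus_div_mult_eq_mod)
    then have "\<phi> (ev w (c mod p)) = \<phi> (ev w c) - \<phi> (ev w (c div p)) * \<phi> (ev w p)"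
      by (simp only: ev_diff ev_mult hom_distribs)
    also have "\<dots> \<in> V.M" using c p evR by (intro V.M_diff V.M_mult)
    finally have "c mod p = 0 \<or> degree p \<le> degree (c mod p)" using least by blast
    then show "p dvd c" using degree_mod_less[of p c] p by (auto simp: dvd_eq_mod_eq_0)
  qed
  with p that show thesis by blast
qed

text \<open>A polynomial not divisible by \<open>p\<close> takes a unit of \<open>R\<close> as its
  value, so on K(x) the place measures only powers of \<open>p\<close>.\<close>

lemma unit_ev_power:
  assumes R: "valuation_subring R" "range (\<phi> \<circ> rat_const) \<subseteq> R" "R \<noteq> UNIV"
    and w: "gen w" "\<phi> w \<in> R"
    and p: "p \<noteq> 0" "\<And>c. \<phi> (ev w c) \<in> valuation_subring.M R \<longleftrightarrow> p dvd c"
    and h: "h \<noteq> 0"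
  shows "\<exists>k::int. valuation_subring.unit R (\<phi> h / \<phi> (ev w p) powi k)"
proof -
  interpret V: valuation_subring R by fact
  note evR = ev_in_ring[OF R(1,2) w(2)]
  have np: "\<not> is_unit p" using p(2)[of 1] V.M_1 by auto
  have nz: "\<phi> (ev w p) \<noteq> 0" using p w by simp
  have *: "\<exists>k::int. V.unit (\<phi> (ev w c) / \<phi> (ev w p) powi k)" if c: "c \<noteq> 0" for c
  proof -
    obtain k c' where kc: "c = p ^ k * c'" "\<not> p dvd c'" by (rule poly_power_split[OF c np])
    have "V.unit (\<phi> (ev w c'))" using kc p evR by (auto simp: V.unit_iff)
    then show ?thesis using kc nz
      by (intro exI[of _ "int k"]) (simp add: ev_mult ev_power hom_distribs)
  qed
  obtain a b where ab: "b \<noteq> 0" "h = ev w a / ev w b" by (rule genE[OF w(1)])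
  with h have "a \<noteq> 0" by auto
  obtain k l :: int where "V.unit (\<phi> (ev w a) / \<phi> (ev w p) powi k)" "V.unit (\<phi> (ev w b) / \<phi> (ev w p) powi l)"
    using *[OF \<open>a \<noteq> 0\<close>] *[OF \<open>b \<noteq> 0\<close>] by blast
  from V.unit_divide[OF this] have "V.unit (\<phi> h / \<phi> (ev w p) powi (k - l))"
    using nz ab by (simp add: hom_distribs power_int_diff field_simps)
  then show ?thesis by blast
qed

lemma gen_in_ring:
  assumes "valuation_subring R"
  obtains w where "gen w" "\<phi> w \<in> R"
proof -
  interpret V: valuation_subring R by fact
  let ?x = "to_fract [:0, 1:] :: 'k poly fract"
  have "\<phi> ?x \<noteq> 0" using gen_nonzero[OF gen_x] by simp
  then show thesis
    using V.R_total[of "\<phi> ?x"] that[of ?x] that[of "inverse ?x"] gen_x gen_inverse[OF gen_x]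
    by (auto simp: hom_inverse)
qed

theorem place_discrete:
  assumes "is_place (\<phi> \<circ> rat_const) Q"
  shows "discrete_place Q"
proof -
  obtain R where R: "valuation_subring R" "range (\<phi> \<circ> rat_const) \<subset> R" "R \<noteq> UNIV"
      "Q = valuation_subring.M R"
    by (rule is_placeE[OF assms]) blast
  interpret V: valuation_subring R by fact
  have R2: "range (\<phi> \<circ> rat_const) \<subseteq> R" using R(2) by blast
  obtain w where w: "gen w" "\<phi> w \<in> R" by (rule gen_in_ring[OF R(1)])
  obtain p where p: "p \<noteq> 0" "\<And>c. \<phi> (ev w c) \<in> V.M \<longleftrightarrow> p dvd c"
    by (rule place_min_poly[OF R(1) R2 R(3) w]) blast
  define g where "g = \<phi> (ev w p)"
  have g: "g \<in> V.M" "g \<noteq> 0" using p w by (auto simp: g_def)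
  have "discrete_place V.M"
  proof (rule V.discrete_of_root[OF g])
    \<comment> \<open>A common multiple of all the exponents \<open>d\<close> up to \<open>N\<close>
      that \<open>power_ratio_unit\<close> can return.\<close>
    show "0 < (fact N :: nat)" by simp
    fix z :: 'f assume z: "z \<noteq> 0"
    obtain d h where d: "0 < d" "d \<le> N" "h \<noteq> 0" "V.unit (z ^ d / \<phi> h)"
      by (rule power_ratio_unit[OF R(1) z])
    obtain k :: int where k: "V.unit (\<phi> h / g powi k)"
      using unit_ev_power[OF R(1) R2 R(3) w p d(3)] unfolding g_def by blast
    have "d dvd fact N" using d by (simp add: dvd_fact)
    then obtain c where c: "fact N = d * c" by (auto simp: dvd_def)
    have "V.unit ((z ^ d / \<phi> h * (\<phi> h / g powi k)) ^ c)"
      using d k by (intro V.unit_power V.unit_mult)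
    also have "(z ^ d / \<phi> h * (\<phi> h / g powi k)) ^ c = z ^ fact N / g powi (k * int c)"
      using d by (simp add: c power_mult power_divide power_int_mult)
    finally show "\<exists>k::int. V.unit (z ^ fact N / g powi k)" by blast
  qed
  then show ?thesis by (simp add: R)
qed

end

lemma discrete_placeD:
  assumes "discrete_place P"
  shows "discrete_valuation (place_val P)"
    and "z \<in> P \<longleftrightarrow> z = 0 \<or> 0 < place_val P z"
    and "z \<in> place_ring P \<longleftrightarrow> z = 0 \<or> 0 \<le> place_val P z"
  using assms discrete_place_ring[OF assms] unfolding discrete_place_def by blast+

lemma place_val_const:
  assumes "field_hom \<iota>" "is_place \<iota> Q" "discrete_place Q" "c \<noteq> 0"
  shows "place_val Q (\<iota> c) = 0"
proof -
  interpret field_hom \<iota> by fact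
  interpret discrete_valuation "place_val Q" using discrete_placeD[OF assms(3)] by blast
  have "range \<iota> \<subset> place_ring Q" by (rule is_placeE[OF assms(2)]) blast
  then have "\<iota> c \<in> place_ring Q" "\<iota> (inverse c) \<in> place_ring Q" by blast+
  then show ?thesis
    using assms(4) val_inverse[of "\<iota> c"] by (auto simp: discrete_placeD[OF assms(3)] hom_inverse)
qed

section \<open>Places of the rational function field\<close>

text \<open>K(x) is regarded as an extension of itself, which makes \<open>place_discrete\<close>
  available for rational places.\<close>

lemma rat_ext: "alg_extension (\<lambda>h. h :: 'k::field poly fract) 1"
proof
  fix z :: "'k poly fract"
  show "\<exists>p. p \<noteq> 0 \<and> degree p \<le> 1 \<and> poly (map_poly (\<lambda>h. h) p) z = 0"
    by (intro exI[of _ "[:- z, 1:]"]) (simp add: map_poly_id')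
qed simp_all

lemma rat_place_discrete: "is_place rat_const R \<Longrightarrow> discrete_place R"
  by (rule alg_extension.place_discrete[OF rat_ext]) (simp add: comp_def)

context
  fixes R :: "'k::field poly fract set"
  assumes R: "is_place rat_const R"
begin

interpretation discrete_valuation "place_val R"
  using discrete_placeD[OF rat_place_discrete[OF R]] by blast

private lemmas inR = discrete_placeD(2,3)[OF rat_place_discrete[OF R]]

lemma rat_place_val_const: "c \<noteq> 0 \<Longrightarrow> place_val R (rat_const c) = 0"
  by (rule place_val_const[OF _ R rat_place_discrete[OF R]]) unfold_locales

lemma rat_place_const_ge_0: "val_ge 0 (rat_const c)"
  using rat_place_val_const[of c] by (cases "c = 0") (auto simp: val_ge_def)

lemma ev_val_ge_0: "w \<in> place_ring R \<Longrightarrow> val_ge 0 (ev w p)"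
proof (induction p)
  case (pCons c p)
  then have "val_ge 0 w" by (simp add: inR val_ge_def)
  then show ?case using pCons by (auto simp: ev_pCons intro!: val_ge_add val_ge_mult_0 rat_place_const_ge_0)
qed simp

lemma ev_unit_coeff_0:
  assumes "u \<in> R" "coeff p 0 \<noteq> 0"
  shows "ev u p \<noteq> 0" "place_val R (ev u p) = 0"
proof -
  obtain c q where p: "p = pCons c q" by (cases p)
  have u: "val_ge 1 u" using assms by (auto simp: inR val_ge_def)
  then have "val_ge (1 + 0) (u * ev u q)"
    by (intro val_ge_mult ev_val_ge_0) (use assms in \<open>auto simp: inR\<close>)
  then have "val_ge (place_val R (rat_const c) + 1) (u * ev u q)"
    using assms by (simp add: p rat_place_val_const)
  from val_add_eq[OF _ this] show "ev u p \<noteq> 0" "place_val R (ev u p) = 0"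
    using assms by (auto simp: p ev_pCons rat_place_val_const)
qed

lemma ev_in_place_coeff_0:
  assumes "u \<in> R" "coeff p 0 = 0"
  shows "val_ge 1 (ev u p)"
proof -
  obtain c q where p: "p = pCons c q" by (cases p)
  have "val_ge (1 + 0) (u * ev u q)"
    by (intro val_ge_mult ev_val_ge_0) (use assms in \<open>auto simp: inR val_ge_def\<close>)
  then show ?thesis using assms by (simp add: p ev_pCons)
qed

text \<open>In a reduced fraction at most one of the two constant terms vanishes; if it were that of
  \<open>b\<close>, then \<open>z\<close> would have a pole at \<open>u = 0\<close>.\<close>

lemma rational_place_fraction:
  assumes u: "gen u" "u \<in> R" and z: "z \<in> place_ring R"
  obtains a b where "coeff b 0 \<noteq> 0" "z = ev u a / ev u b"
proof -
  obtain a b where ab: "b \<noteq> 0" "z = ev u a / ev u b"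
      and red: "\<And>p. p dvd a \<Longrightarrow> p dvd b \<Longrightarrow> degree p = 0"
    by (rule gen_reducedE[OF u(1)]) blast
  have nz: "ev u b \<noteq> 0" using ab u by simp
  have "coeff b 0 \<noteq> 0"
  proof
    assume b0: "coeff b 0 = 0"
    have X: "pCons 0 1 dvd p" if "coeff p 0 = 0" for p :: "'k poly"
    proof -
      obtain c q where "p = pCons c q" by (cases p)
      with that have "p = pCons 0 1 * q" by simp
      then show ?thesis by (rule dvdI)
    qed
    have a0: "coeff a 0 \<noteq> 0"
      using red[OF X X] b0 by auto
    have "place_val R z = - place_val R (ev u b)"
      using ev_unit_coeff_0[OF u(2) a0] nz ab by (simp add: val_divide)
    moreover have "z \<noteq> 0" using ev_unit_coeff_0[OF u(2) a0] nz ab by simp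
    ultimately show False
      using ev_in_place_coeff_0[OF u(2) b0] nz z by (auto simp: inR val_ge_def)
  qed
  with ab(2) that show thesis by blast
qed

lemma rational_place_residue:
  assumes u: "gen u" "u \<in> R" and z: "z \<in> place_ring R"
  shows "\<exists>c. z - rat_const c \<in> R"
proof -
  obtain a b where b0: "coeff b 0 \<noteq> 0" and ab: "z = ev u a / ev u b"
    by (rule rational_place_fraction[OF u z])
  have nz: "ev u b \<noteq> 0" using b0 u by auto
  define c where "c = coeff a 0 / coeff b 0"
  have "val_ge 1 (ev u (a - smult c b))"
    using b0 by (intro ev_in_place_coeff_0 u) (simp add: c_def)
  also have "ev u (a - smult c b) = ev u b * (z - rat_const c)"
    using ab nz by (simp add: ev_diff ev_smult field_simps)
  finally have "val_ge 1 (z - rat_const c)"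
    using nz ev_unit_coeff_0[OF u(2) b0] by (simp add: val_ge_mult_iff)
  then show ?thesis by (intro exI[of _ c]) (auto simp: inR val_ge_def)
qed

text \<open>Splitting powers of \<open>u\<close> off polynomials leaves units, so all values are
  multiples of \<open>place_val R u\<close>. As the value 1 occurs, this positive number is
  1.\<close>

lemma rational_place_val:
  assumes u: "gen u" "u \<in> R"
  shows "place_val R u = 1"
proof -
  have unz: "u \<noteq> 0" using u by (simp add: gen_nonzero)
  have *: "\<exists>k. place_val R (ev u c) = int k * place_val R u" if c: "c \<noteq> 0" for c
  proof -
    have "\<not> is_unit (pCons 0 1 :: 'k poly)" by (simp add: is_unit_iff_degree)
    then obtain k c' where kc: "c = pCons 0 1 ^ k * c'" "\<not> pCons 0 1 dvd c'"
      by (rule poly_power_split[OF c])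
    have "coeff c' 0 \<noteq> 0"
    proof
      assume "coeff c' 0 = 0"
      then obtain q where "c' = pCons 0 q" by (cases c') auto
      then have "c' = pCons 0 1 * q" by simp
      with kc(2) show False by (metis dvd_triv_left)
    qed
    from ev_unit_coeff_0[OF u(2) this] show ?thesis using unz
      by (intro exI[of _ k]) (simp add: kc ev_mult ev_power val_mult val_power)
  qed
  obtain t where t: "t \<noteq> 0" "place_val R t = 1" using ex_uniformizer by blast
  obtain a b where ab: "b \<noteq> 0" "t = ev u a / ev u b" by (rule genE[OF u(1)])
  with t have "a \<noteq> 0" by auto
  obtain k l where "place_val R (ev u a) = int k * place_val R u"
      "place_val R (ev u b) = int l * place_val R u"
    using *[OF \<open>a \<noteq> 0\<close>] *[OF \<open>b \<noteq> 0\<close>] by blast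
  then have "1 = (int k - int l) * place_val R u"
    using t ab u \<open>a \<noteq> 0\<close> by (simp add: val_divide algebra_simps)
  then have "place_val R u dvd 1" by (metis dvd_triv_right)
  then show ?thesis using u unz by (auto simp: inR)
qed

lemma place_val_ev_inverse:
  assumes u: "gen u" "u \<in> R" and p: "p \<noteq> 0"
  shows "place_val R (ev (inverse u) p) = - int (degree p)"
proof -
  have unz: "u \<noteq> 0" using u by (simp add: gen_nonzero)
  have "place_val R (ev u (reflect_poly p)) = 0"
    using p by (intro ev_unit_coeff_0 u) simp
  then show ?thesis
    using unz p gen_inverse[OF u(1)]
    by (simp add: ev_inverse val_mult val_power rational_place_val[OF u])
qed

end

text \<open>If x is regular at \<open>R\<close> and no \<open>x - a\<close> vanishes there, then all
  linear factors of \<open>f\<close> are units at \<open>R\<close>, and so is \<open>f\<close>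
  because it splits over K. Thus every zero or pole of \<open>f\<close> has a local coordinate that
  generates K(x), which means degree one.\<close>

lemma split_place_gen:
  fixes f :: "'k::field poly"
  assumes f: "f \<noteq> 0"
    and split: "\<forall>z :: 'k alg_closure. poly (map_poly to_ac f) z = 0 \<longrightarrow> z \<in> range to_ac"
    and R: "is_place rat_const R" "place_val R (to_fract f) \<noteq> 0"
  obtains u where "gen u" "u \<in> R"
proof -
  interpret discrete_valuation "place_val R"
    using discrete_placeD[OF rat_place_discrete[OF R(1)]] by blast
  note inR = discrete_placeD(2,3)[OF rat_place_discrete[OF R(1)]]
  interpret ac: field_hom "to_ac :: 'k \<Rightarrow> 'k alg_closure"
    by unfold_locales simp_all
  interpret mac: map_poly_inj_idom_hom "to_ac :: 'k \<Rightarrow> 'k alg_closure" ..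
  let ?x = "to_fract [:0, 1:] :: 'k poly fract"
  show thesis
  proof (cases "?x \<in> place_ring R")
    case False
    then have "inverse ?x \<in> R"
      using val_inverse[of ?x] by (auto simp: inR)
    then show ?thesis using that gen_inverse[OF gen_x] by blast
  next
    case x: True
    have "\<exists>a. ?x - rat_const a \<in> R"
    proof (rule ccontr)
      assume neg: "\<not> ?thesis"
      have "place_val R (to_fract f) = 0"
        using f split
      proof (induction "degree f" arbitrary: f rule: less_induct)
        case less
        show ?case
        proof (cases "degree f = 0")
          case True
          then obtain c where "f = [:c:]" by (rule degree_eq_zeroE)
          then show ?thesis using less.prems rat_place_val_const[OF R(1), of c] by (simp add: rat_const_def)
        next
          case False
          then have "\<exists>z. poly (map_poly to_ac f :: 'k alg_closure poly) z = 0"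
            by (intro alg_closed_imp_poly_has_root) simp
          then obtain z where z: "poly (map_poly to_ac f :: 'k alg_closure poly) z = 0" by blast
          then obtain a where "z = to_ac a" using less.prems by blast
          with z have "poly f a = 0" by (simp add: mac.poly_map_poly)
          then obtain g where g: "f = [:- a, 1:] * g" by (auto simp: poly_eq_0_iff_dvd elim: dvdE)
          with less.prems have "g \<noteq> 0" by auto
          then have "degree g < degree f" unfolding g by (subst degree_mult_eq) auto
          moreover have "\<forall>z :: 'k alg_closure. poly (map_poly to_ac g) z = 0 \<longrightarrow> z \<in> range to_ac"
            using less.prems by (simp add: g hom_distribs)
          ultimately have vg: "place_val R (to_fract g) = 0"
            using less.hyps \<open>g \<noteq> 0\<close> by blast
          have eq: "to_fract [:- a, 1:] = ?x - rat_const a"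
            by (simp add: rat_const_def flip: to_fract_diff)
          then have nz: "?x - rat_const a \<noteq> 0" by (metis pCons_eq_0_iff to_fract_eq_0_iff zero_neq_one)
          have "val_ge 0 (?x - rat_const a)"
            using x rat_place_const_ge_0[OF R(1)] by (intro val_ge_diff) (auto simp: inR val_ge_def)
          then have "place_val R (?x - rat_const a) = 0"
            using neg[unfolded not_ex, rule_format, of a] nz by (simp add: inR val_ge_def)
          then show ?thesis
            using vg nz \<open>g \<noteq> 0\<close> eq by (simp add: g val_mult del: mult_pCons_left)
        qed
      qed
      then show False using R by simp
    qed
    then obtain a where "?x - rat_const a \<in> R" by blast
    then show ?thesis using that[of "?x - rat_const a"] gen_shift[OF gen_x, of "- a"]
      by (simp add: rat_const.hom_uminus)
  qed
qed

text \<open>The local ring of the polynomials in \<open>w\<close> at the prime \<open>p\<close>. In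
  a reduced fraction \<open>p\<close> fails to divide the numerator or the denominator, which gives
  totality. It supplies the places at which denominators vanish.\<close>

lemma localization_place:
  assumes w: "gen w" and p: "prime_elem p"
  defines "L \<equiv> {h. \<exists>a b. \<not> p dvd b \<and> h = ev w a / ev w b}"
  shows "is_place rat_const (valuation_subring.M L)" "valuation_subring L" "w \<in> L"
    and "\<And>a b. \<lbrakk>b \<noteq> 0; p dvd b; \<not> p dvd a\<rbrakk> \<Longrightarrow> ev w a / ev w b \<notin> L"
proof -
  have LI: "ev w a / ev w b \<in> L" if "\<not> p dvd b" for a b using that by (auto simp: L_def)
  have nz: "ev w b \<noteq> 0" if "\<not> p dvd b" for b using that w by auto
  have pm: "\<not> p dvd b * b'" if "\<not> p dvd b" "\<not> p dvd b'" for b b'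
    using that p by (simp add: prime_elem_dvd_mult_iff)
  show V: "valuation_subring L"
  proof
    fix h h' assume hL: "h \<in> L" "h' \<in> L"
    obtain a b where 1: "\<not> p dvd b" "h = ev w a / ev w b"
      using hL unfolding L_def by auto
    obtain a' b' where 2: "\<not> p dvd b'" "h' = ev w a' / ev w b'"
      using hL unfolding L_def by auto
    note * = 1 2
    have "h + h' = ev w (a * b' + a' * b) / ev w (b * b')"
      "h - h' = ev w (a * b' - a' * b) / ev w (b * b')"
      "h * h' = ev w (a * a') / ev w (b * b')"
      using * nz by (simp_all add: ev_mult ev_add ev_diff add_frac_eq diff_frac_eq)
    then show "h + h' \<in> L" "h - h' \<in> L" "h * h' \<in> L" using LI pm * by simp_all
  next
    fix h :: "'a poly fract" assume h: "h \<noteq> 0"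
    obtain a b where ab: "b \<noteq> 0" "h = ev w a / ev w b"
        and red: "\<And>p. p dvd a \<Longrightarrow> p dvd b \<Longrightarrow> degree p = 0"
      by (rule gen_reducedE[OF w]) blast
    have "degree p \<noteq> 0" using p by (auto simp: prime_elem_def is_unit_iff_degree)
    then have "\<not> p dvd a \<or> \<not> p dvd b" using red[of p] by auto
    moreover have "inverse h = ev w b / ev w a" using ab by simp
    ultimately show "h \<in> L \<or> inverse h \<in> L" using ab LI by metis
  qed
  show notin: "ev w a / ev w b \<notin> L" if "b \<noteq> 0" "p dvd b" "\<not> p dvd a" for a b
  proof
    assume "ev w a / ev w b \<in> L"
    then obtain a' b' where *: "\<not> p dvd b'" "ev w a / ev w b = ev w a' / ev w b'"
      unfolding L_def by auto
    then have "ev w (a * b') = ev w (a' * b)"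
      using nz that(1) w by (simp add: ev_mult frac_eq_eq)
    then have "a * b' = a' * b" using w by (simp add: gen_eq_iff)
    then have "p dvd a * b'" using that(2) by simp
    then show False using pm[OF that(3) *(1)] by blast
  qed
  have p1: "\<not> p dvd 1" using p unfolding prime_elem_def by blast
  have pnz: "p \<noteq> 0" using p unfolding prime_elem_def by blast
  have evL: "ev w c \<in> L" for c using LI[OF p1, of c] by simp
  from evL[of "pCons 0 1"] show wL: "w \<in> L" by simp
  have "1 / ev w p \<notin> L" using notin[of p 1] p1 pnz by simp
  then have "L \<noteq> UNIV" by blast
  moreover have "range rat_const \<subset> L"
  proof -
    have "rat_const c \<in> L" for c using evL[of "[:c:]"] by simp
    moreover have "w \<notin> range rat_const"
    proof
      assume "w \<in> range rat_const"
      then obtain c where "ev w (pCons 0 1) = ev w [:c:]" by auto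
      then have "pCons 0 1 = [:c:]" using w by (simp only: gen_eq_iff)
      then show False by simp
    qed
    ultimately show ?thesis using wL by blast
  qed
  ultimately show "is_place rat_const (valuation_subring.M L)" by (intro is_placeI V)
qed

lemma prime_elem_dvd_exists:
  fixes b :: "'k::field poly"
  assumes "degree b > 0"
  obtains p where "prime_elem p" "p dvd b"
proof -
  have "\<exists>p. degree p > 0 \<and> p dvd b" using assms by (intro exI[of _ b]) simp
  then obtain p where p0: "degree p > 0 \<and> p dvd b"
      and "\<forall>q. degree q > 0 \<and> q dvd b \<longrightarrow> degree p \<le> degree q"
    using ex_has_least_nat[of "\<lambda>p. degree p > 0 \<and> p dvd b" _ degree] by metis
  then have least: "degree p \<le> degree q" if "degree q > 0" "q dvd b" for q using that by blast
  have "irreducible p"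
  proof (rule irreducibleI)
    show "p \<noteq> 0" "\<not> is_unit p" using p0 by (auto simp: is_unit_iff_degree)
    fix c d assume cd: "p = c * d"
    with p0 have nz: "c \<noteq> 0" "d \<noteq> 0" by auto
    show "is_unit c \<or> is_unit d"
    proof (rule ccontr)
      assume "\<not> ?thesis"
      then have dg: "degree c > 0" "degree d > 0" using nz by (auto simp: is_unit_iff_degree)
      have "c dvd b" using p0 cd dvd_trans by fastforce
      then have "degree p \<le> degree c" using least dg by blast
      then show False using cd nz dg by (simp add: degree_mult_eq)
    qed
  qed
  then show thesis using that p0 field_poly_irreducible_imp_prime by blast
qed

text \<open>A prime factor of a reduced nonconstant denominator defines a place where
  \<open>h\<close> has a pole although \<open>w\<close> is regular.\<close>

lemma regular_imp_polynomial:
  assumes w: "gen w"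
    and reg: "\<And>R. is_place rat_const R \<Longrightarrow> w \<in> place_ring R \<Longrightarrow> h \<in> place_ring R"
  obtains p where "h = ev w p"
proof -
  obtain a b where ab: "b \<noteq> 0" "h = ev w a / ev w b"
      and red: "\<And>p. p dvd a \<Longrightarrow> p dvd b \<Longrightarrow> degree p = 0"
    by (rule gen_reducedE[OF w]) blast
  show thesis
  proof (cases "degree b = 0")
    case True
    then obtain c where "b = [:c:]" by (rule degree_eq_zeroE)
    then have "h = ev w (smult (inverse c) a)" using ab
      by (simp add: ev_smult rat_const.hom_inverse divide_inverse mult.commute)
    then show ?thesis by (rule that)
  next
    case False
    then obtain p where p: "prime_elem p" "p dvd b" using prime_elem_dvd_exists by blast
    have "degree p \<noteq> 0" using p by (auto simp: prime_elem_def is_unit_iff_degree)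
    then have "\<not> p dvd a" using red[of p] p by auto
    define L where "L = {h. \<exists>a b. \<not> p dvd b \<and> h = ev w a / ev w b}"
    note L = localization_place[OF w p(1), folded L_def]
    have "h \<notin> L" using L(4) ab p \<open>\<not> p dvd a\<close> by blast
    then show ?thesis using reg[OF L(1)] L(3) place_ring_M[OF L(2)] by simp
  qed
qed

section \<open>Ramification\<close>

text \<open>\<open>ram_index\<close> is a description, so the value at \<open>Q\<close> must be
  shown to be a fixed multiple of the value at \<open>P\<close>. The point is that a unit
  \<open>u\<close> at \<open>P\<close> remains a unit at \<open>Q\<close>: all
  \<open>t * u powi k\<close> lie in \<open>P\<close>, so their values at \<open>Q\<close> are
  positive for every integer \<open>k\<close>.\<close>

lemma ram_index_eq:
  assumes \<phi>: "field_hom \<phi>" and P: "discrete_place P" and Q: "discrete_place Q"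
    and over: "lies_over \<phi> Q P" and z: "z \<noteq> 0"
  shows "place_val Q (\<phi> z) = int (ram_index \<phi> Q P) * place_val P z"
proof -
  interpret field_hom \<phi> by fact
  interpret P: discrete_valuation "place_val P" using discrete_placeD[OF P] by blast
  interpret Q: discrete_valuation "place_val Q" using discrete_placeD[OF Q] by blast
  note inP = discrete_placeD(2)[OF P] and inQ = discrete_placeD(2)[OF Q]
  have pos: "0 < place_val Q (\<phi> z)" if "z \<noteq> 0" "0 < place_val P z" for z
  proof -
    have "z \<in> P" using that by (simp add: inP)
    then have "\<phi> z \<in> Q" using over by (auto simp: lies_over_def)
    then show ?thesis using that by (simp add: inQ)
  qed
  obtain t where t: "t \<noteq> 0" "place_val P t = 1" using P.ex_uniformizer by blast
  have unit: "place_val Q (\<phi> u) = 0" if u: "u \<noteq> 0" "place_val P u = 0" for u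
  proof -
    let ?a = "place_val Q (\<phi> t)" and ?b = "place_val Q (\<phi> u)"
    have *: "0 < ?a + k * ?b" for k
    proof -
      have "0 < place_val Q (\<phi> (t * u powi k))"
        using t u by (intro pos) (simp_all add: P.val_mult P.val_power_int)
      also have "\<phi> (t * u powi k) = \<phi> t * \<phi> u powi k"
        by (cases "0 \<le> k") (simp_all add: power_int_def hom_distribs)
      finally show ?thesis using t u by (simp add: Q.val_mult Q.val_power_int)
    qed
    have a: "0 < ?a" using *[of 0] by simp
    show ?thesis
    proof (rule ccontr)
      assume "?b \<noteq> 0"
      then have "?a \<le> ?a * \<bar>?b\<bar>" using a by simp
      moreover have "?a * \<bar>?b\<bar> = ?a * sgn ?b * ?b" by (simp add: abs_sgn mult.commute mult.left_commute)
      \<comment> \<open>This exponent turns \<open>?a + k * ?b\<close> into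
        \<open>?a - ?a * \<bar>?b\<bar>\<close>, which is not positive.\<close>
      ultimately show False using *[of "- (?a * sgn ?b)"] by simp
    qed
  qed
  have main: "place_val Q (\<phi> z) = place_val Q (\<phi> t) * place_val P z" if z: "z \<noteq> 0" for z
  proof -
    define k where "k = place_val P z"
    define u where "u = z / t powi k"
    have u: "u \<noteq> 0" "place_val P u = 0" "z = t powi k * u"
      using z t by (simp_all add: u_def k_def P.val_divide P.val_power_int)
    have "\<phi> z = \<phi> t powi k * \<phi> u"
      unfolding u(3) by (cases "0 \<le> k") (simp_all add: power_int_def hom_distribs)
    then show ?thesis
      using t u(1) unit[OF u(1,2)] by (simp add: Q.val_mult Q.val_power_int k_def mult.commute)
  qed
  have "0 < place_val Q (\<phi> t)" using pos t by simp
  then have ex: "\<forall>z. z \<noteq> 0 \<longrightarrow> place_val Q (\<phi> z) = int (nat (place_val Q (\<phi> t))) * place_val P z"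
    using main by simp
  have "\<forall>z. z \<noteq> 0 \<longrightarrow> place_val Q (\<phi> z) = int (ram_index \<phi> Q P) * place_val P z"
    unfolding ram_index_def
  proof (rule theI[of _ "nat (place_val Q (\<phi> t))"])
    show "\<forall>z. z \<noteq> 0 \<longrightarrow> place_val Q (\<phi> z) = int (nat (place_val Q (\<phi> t))) * place_val P z"
      by (rule ex)
    fix e assume "\<forall>z. z \<noteq> 0 \<longrightarrow> place_val Q (\<phi> z) = int e * place_val P z"
    then show "e = nat (place_val Q (\<phi> t))" using t by simp
  qed
  with z show ?thesis by blast
qed

locale field_extension = field_hom \<phi> for \<phi> :: "'e::field \<Rightarrow> 'f::field"
begin

sublocale V: vector_space "\<lambda>a z. \<phi> a * z"
  by unfold_locales (simp_all add: algebra_simps hom_distribs)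

lemma poly_map_altdef:
  assumes "degree p \<le> n"
  shows "poly (map_poly \<phi> p) z = (\<Sum>i\<le>n. \<phi> (coeff p i) * z ^ i)"
proof -
  have "poly (map_poly \<phi> p) z = (\<Sum>i\<le>degree p. \<phi> (coeff p i) * z ^ i)"
    by (simp add: poly_altdef)
  also have "\<dots> = (\<Sum>i\<le>n. \<phi> (coeff p i) * z ^ i)"
    using assms by (intro sum.mono_neutral_left) (auto simp: coeff_eq_0)
  finally show ?thesis .
qed

text \<open>The m + 1 powers up to exponent \<open>m\<close> lie in a span of at most
  \<open>m\<close> vectors. Coinciding powers are treated apart, since as a set they would be too
  few for the dimension bound.\<close>

lemma relation_if_powers_in_span:
  assumes "finite Y" "card Y \<le> m" "\<And>i. z ^ i \<in> V.span Y"
  shows "\<exists>p. p \<noteq> 0 \<and> degree p \<le> m \<and> poly (map_poly \<phi> p) z = 0"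
proof (cases "inj_on (\<lambda>i. z ^ i) {..m}")
  case False
  then obtain i j where ij: "i \<le> m" "j \<le> m" "i \<noteq> j" "z ^ i = z ^ j"
    by (auto simp: inj_on_def)
  let ?p = "monom 1 i - monom 1 j :: 'e poly"
  have "coeff ?p i \<noteq> 0" using ij by simp
  then have "?p \<noteq> 0" by (metis coeff_0)
  moreover have "degree ?p \<le> m"
    using ij by (intro degree_diff_le) (auto intro: order_trans[OF degree_monom_le])
  moreover have "map_poly \<phi> ?p = monom 1 i - monom 1 j"
    by (rule poly_eqI) (simp add: hom_distribs)
  ultimately show ?thesis using ij by (intro exI[of _ ?p]) (simp add: poly_monom)
next
  case True
  let ?Z = "(\<lambda>i. z ^ i) ` {..m}"
  have c: "card ?Z = Suc m" using card_image[OF True] by simp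
  have "V.dependent ?Z"
  proof (rule ccontr)
    assume "V.independent ?Z"
    moreover have "?Z \<subseteq> V.span Y" using assms(3) by auto
    ultimately have "card ?Z \<le> card Y"
      using V.independent_span_bound[OF assms(1)] by blast
    then show False using c assms(2) by simp
  qed
  then obtain u where u: "\<exists>v\<in>?Z. u v \<noteq> 0" "(\<Sum>v\<in>?Z. \<phi> (u v) * v) = 0"
    using V.dependent_finite[of ?Z] by auto
  define p where "p = (\<Sum>i\<le>m. monom (u (z ^ i)) i)"
  have cp: "coeff p i = (if i \<le> m then u (z ^ i) else 0)" for i
    by (simp add: p_def coeff_sum when_def if_distrib sum.If_cases)
  have "p \<noteq> 0" using u(1) cp by (metis (no_types, lifting) atMost_iff coeff_0 imageE)
  moreover have "degree p \<le> m" by (rule degree_le) (simp add: cp)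
  moreover have "poly (map_poly \<phi> p) z = (\<Sum>i\<le>m. \<phi> (u (z ^ i)) * z ^ i)"
    using poly_map_altdef[OF \<open>degree p \<le> m\<close>] by (simp add: cp)
  moreover have "(\<Sum>i\<le>m. \<phi> (u (z ^ i)) * z ^ i) = (\<Sum>v\<in>?Z. \<phi> (u v) * v)"
    using True by (simp add: sum.reindex)
  ultimately show ?thesis using u(2) by auto
qed

text \<open>An element outside the span would extend the family to an independent set larger than a
  basis. The finite spanning set \<open>Y\<close> forces a basis to be finite, so that
  \<open>ext_degree\<close> is a true dimension and not the default cardinality of an infinite
  set.\<close>

lemma spanning_if_independent:
  assumes "finite Y" "V.span Y = UNIV"
    and indep: "\<And>a. (\<Sum>i<ext_degree \<phi>. \<phi> (a i) * g i) = 0 \<Longrightarrow> \<forall>i<ext_degree \<phi>. a i = 0"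
  shows "\<exists>a. z = (\<Sum>i<ext_degree \<phi>. \<phi> (a i) * g i)"
proof -
  let ?N = "ext_degree \<phi>"
  have inj: "inj_on g {..<?N}"
  proof (rule inj_onI)
    fix i j assume ij0: "i \<in> {..<?N}" "j \<in> {..<?N}" "g i = g j"
    show "i = j"
    proof (rule ccontr)
      assume "i \<noteq> j"
      note ij = ij0 this
      define a where "a k = (if k = i then 1 else if k = j then - 1 else 0 :: 'e)" for k
      have "(\<Sum>k<?N. \<phi> (a k) * g k) = (\<Sum>k\<in>{i, j}. \<phi> (a k) * g k)"
        by (rule sum.mono_neutral_right) (use ij in \<open>auto simp: a_def\<close>)
      also have "\<dots> = 0" using ij by (simp add: a_def hom_distribs)
      finally have "a i = 0" using indep ij by blast
      then show False by (simp add: a_def)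
    qed
  qed
  let ?B = "g ` {..<?N}"
  have cB: "card ?B = ?N" using card_image[OF inj] by simp
  have indB: "V.independent ?B"
  proof
    assume "V.dependent ?B"
    then obtain u where u: "\<exists>v\<in>?B. u v \<noteq> 0" "(\<Sum>v\<in>?B. \<phi> (u v) * v) = 0"
      using V.dependent_finite[of ?B] by auto
    have "(\<Sum>i<?N. \<phi> (u (g i)) * g i) = 0" using u(2) inj by (simp add: sum.reindex)
    from indep[OF this] show False using u(1) by auto
  qed
  have "z \<in> V.span ?B"
  proof (rule ccontr)
    assume z: "z \<notin> V.span ?B"
    then have ind: "V.independent (insert z ?B)" using indB by (simp add: V.independent_insertI)
    obtain C where C: "C \<subseteq> UNIV" "V.independent C" "UNIV \<subseteq> V.span C" "card C = V.dim UNIV"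
      by (rule V.basis_exists)
    have finC: "finite C" using V.independent_span_bound[OF assms(1) C(2)] assms(2) by simp
    have "card (insert z ?B) \<le> card C"
      using V.independent_span_bound[OF finC ind] C(3) by (meson subset_UNIV subset_trans)
    moreover have "z \<notin> ?B" using z V.span_base[of z ?B] by metis
    ultimately show False using C(4) cB by (simp add: ext_degree_def)
  qed
  moreover have "V.span ?B = range (\<lambda>u. \<Sum>v\<in>?B. \<phi> (u v) * v)"
    by (rule V.span_finite) simp
  ultimately have "z \<in> range (\<lambda>u. \<Sum>v\<in>?B. \<phi> (u v) * v)" by (simp only:)
  then obtain u where "z = (\<Sum>v\<in>?B. \<phi> (u v) * v)" by (rule rangeE)
  then have "z = (\<Sum>i<?N. \<phi> (u (g i)) * g i)" using inj by (simp add: sum.reindex)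
  then show ?thesis by (intro exI[of _ "\<lambda>i. u (g i)"])
qed

end

section \<open>Kummer extensions\<close>

locale kummer_extension =
  fixes m :: nat and f :: "'k::field poly" and \<phi> :: "'k poly fract \<Rightarrow> 'f::field" and y :: 'f
  assumes kummer: "kummer_function_field m f \<phi> y" and m_pos: "0 < m" and f_nz: "f \<noteq> 0"
begin

sublocale field_extension \<phi>
  using kummer unfolding kummer_function_field_def field_extension_def by blast

abbreviation F where "F \<equiv> to_fract f"

lemma y_pow_m: "y ^ m = \<phi> F"
  using kummer by (simp add: kummer_function_field_def)

lemma y_nz: "y \<noteq> 0"
  using y_pow_m m_pos f_nz by (auto simp: power_0_left)

lemma y_pow: "y ^ n = \<phi> (F ^ (n div m)) * y ^ (n mod m)"
proof -
  have "y ^ n = y ^ (m * (n div m) + n mod m)" by simp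
  then show ?thesis by (simp only: power_add power_mult y_pow_m hom_distribs)
qed

definition Y where "Y = (\<lambda>i. y ^ i) ` {..<m}"

lemma finite_Y: "finite Y" and card_Y: "card Y \<le> m"
  using card_image_le[of "{..<m}" "\<lambda>i. y ^ i"] by (simp_all add: Y_def)

definition T where "T = {z. \<exists>p. z = poly (map_poly \<phi> p) y}"

lemma T_span: "z \<in> T \<Longrightarrow> z \<in> V.span Y"
proof -
  have *: "\<phi> (F ^ (n div m)) * y ^ (n mod m) \<in> V.span Y" for n
    using m_pos by (intro V.span_scale V.span_base) (auto simp: Y_def)
  assume "z \<in> T"
  then obtain p where z: "z = poly (map_poly \<phi> p) y" by (auto simp: T_def)
  have "z = (\<Sum>i\<le>degree p. \<phi> (coeff p i) * y ^ i)"
    unfolding z by (rule poly_map_altdef) simp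
  also have "\<dots> \<in> V.span Y"
    using * by (intro V.span_sum V.span_scale) (metis y_pow)
  finally show ?thesis .
qed

lemma poly_map_in_T:
  assumes "z \<in> T" shows "poly (map_poly \<phi> q) z \<in> T"
proof -
  interpret mp: map_poly_inj_idom_hom \<phi> ..
  obtain p where "z = poly (map_poly \<phi> p) y" using assms by (auto simp: T_def)
  then have "poly (map_poly \<phi> q) z = poly (map_poly \<phi> (pcompose q p)) y"
    by (simp add: hom_distribs poly_pcompose)
  then show ?thesis unfolding T_def by blast
qed

text \<open>\<open>T\<close> is K(x)[y]. The powers of an element of \<open>T\<close> stay in a
  finite-dimensional span, so it satisfies a relation; once powers of the variable are removed, the
  constant term is nonzero and the relation can be solved for the inverse. Hence \<open>T\<close> is
  a field, and the minimality in \<open>kummer_function_field\<close> applies.\<close>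

lemma T_UNIV: "T = UNIV"
proof -
  interpret mp: map_poly_inj_idom_hom \<phi> ..
  have c: "\<phi> h \<in> T" for h unfolding T_def by (intro CollectI exI[of _ "[:h:]"]) (simp add: hom_distribs)
  have yT: "y \<in> T" unfolding T_def by (intro CollectI exI[of _ "[:0, 1:]"]) (simp add: hom_distribs)
  have ring: "a + b \<in> T \<and> a - b \<in> T \<and> a * b \<in> T" if "a \<in> T" "b \<in> T" for a b
  proof -
    from that obtain p q where pq: "a = poly (map_poly \<phi> p) y" "b = poly (map_poly \<phi> q) y"
      by (auto simp: T_def)
    have "a + b = poly (map_poly \<phi> (p + q)) y" "a - b = poly (map_poly \<phi> (p - q)) y"
      "a * b = poly (map_poly \<phi> (p * q)) y"
      unfolding pq by (simp_all add: hom_distribs)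
    then show ?thesis unfolding T_def by blast
  qed
  have inv: "inverse z \<in> T" if z: "z \<in> T" for z
  proof (cases "z = 0")
    case True
    then show ?thesis using z by simp
  next
    case False
    have "z ^ i \<in> V.span Y" for i
    proof (rule T_span)
      have "z ^ i = poly (map_poly \<phi> (monom 1 i)) z" by (simp add: poly_monom hom_distribs)
      then show "z ^ i \<in> T" using poly_map_in_T[OF z] by metis
    qed
    then obtain p where p: "p \<noteq> 0" "poly (map_poly \<phi> p) z = 0"
      using relation_if_powers_in_span[OF finite_Y card_Y] by blast
    have "\<not> is_unit (pCons 0 1 :: 'k poly fract poly)" by (simp add: is_unit_iff_degree)
    then obtain k p' where kp: "p = pCons 0 1 ^ k * p'" "\<not> pCons 0 1 dvd p'"
      by (rule poly_power_split[OF p(1)])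
    obtain c q where cq: "p' = pCons c q" by (cases p')
    have "c \<noteq> 0"
    proof
      assume "c = 0"
      then have "p' = pCons 0 1 * q" by (simp add: cq)
      with kp(2) show False by (metis dvd_triv_left)
    qed
    have "poly (map_poly \<phi> p') z = 0"
      using p(2) False by (simp add: kp hom_distribs)
    then have "\<phi> c + z * poly (map_poly \<phi> q) z = 0" by (simp add: cq hom_distribs)
    then have "inverse z = \<phi> (- inverse c) * poly (map_poly \<phi> q) z"
      using False \<open>c \<noteq> 0\<close> by (simp add: hom_distribs field_simps add_eq_0_iff)
    then show ?thesis using ring c poly_map_in_T[OF z] by metis
  qed
  have "range \<phi> \<subseteq> T" using c by blast
  moreover have "range \<phi> \<subseteq> T \<and> y \<in> T \<and>
      (\<forall>a\<in>T. \<forall>b\<in>T. a + b \<in> T \<and> a - b \<in> T \<and> a * b \<in> T) \<and> (\<forall>a\<in>T. inverse a \<in> T) \<longrightarrow> T = UNIV"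
    using kummer unfolding kummer_function_field_def by (elim conjE) (erule spec)
  ultimately show ?thesis using yT ring inv by simp
qed

lemma span_Y: "V.span Y = UNIV"
  using T_span T_UNIV by blast

lemma ext_degree_le: "ext_degree \<phi> \<le> m"
  unfolding ext_degree_def using V.dim_le_card[of UNIV Y] span_Y finite_Y card_Y by simp

sublocale alg_extension \<phi> m
  by unfold_locales
    (rule relation_if_powers_in_span[OF finite_Y card_Y], simp add: span_Y)

lemma expansion: "\<exists>h. z = (\<Sum>i<m. \<phi> (h i) * y ^ i)"
proof -
  have "z \<in> V.span Y" by (simp add: span_Y)
  moreover have "V.span Y \<subseteq> {z. \<exists>h. z = (\<Sum>i<m. \<phi> (h i) * y ^ i)}"
  proof (rule V.span_minimal)
    show "Y \<subseteq> {z. \<exists>h. z = (\<Sum>i<m. \<phi> (h i) * y ^ i)}"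
    proof
      fix z assume "z \<in> Y"
      then obtain j where j: "j < m" "z = y ^ j" by (auto simp: Y_def)
      have "(\<Sum>i<m. \<phi> (if i = j then 1 else 0) * y ^ i) = (\<Sum>i<m. if i = j then y ^ i else 0)"
        by (rule sum.cong) simp_all
      also have "\<dots> = z" using j by simp
      finally have "z = (\<Sum>i<m. \<phi> (if i = j then 1 else 0) * y ^ i)" by (rule sym)
      then show "z \<in> {z. \<exists>h. z = (\<Sum>i<m. \<phi> (h i) * y ^ i)}" by (intro CollectI exI)
    qed
    show "V.subspace {z. \<exists>h. z = (\<Sum>i<m. \<phi> (h i) * y ^ i)}"
    proof (rule V.subspaceI; clarify)
      show "\<exists>h. 0 = (\<Sum>i<m. \<phi> (h i) * y ^ i)" by (intro exI[of _ "\<lambda>_. 0"]) simp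
      fix h h' :: "nat \<Rightarrow> 'k poly fract" and c
      show "\<exists>h''. (\<Sum>i<m. \<phi> (h i) * y ^ i) + (\<Sum>i<m. \<phi> (h' i) * y ^ i) = (\<Sum>i<m. \<phi> (h'' i) * y ^ i)"
        by (intro exI[of _ "\<lambda>i. h i + h' i"]) (simp add: hom_distribs algebra_simps sum.distrib)
      show "\<exists>h'. \<phi> c * (\<Sum>i<m. \<phi> (h i) * y ^ i) = (\<Sum>i<m. \<phi> (h' i) * y ^ i)"
        by (intro exI[of _ "\<lambda>i. c * h i"]) (simp add: hom_distribs algebra_simps sum_distrib_left)
    qed
  qed
  ultimately show ?thesis by blast
qed

end

section \<open>Totally ramified places\<close>

locale totally_ramified_place = kummer_extension +
  fixes P Q
  assumes tot_ram: "totally_ramified \<phi> P Q"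
begin

abbreviation N where "N \<equiv> ext_degree \<phi>"

lemma places: "is_place rat_const P" "is_place (\<phi> \<circ> rat_const) Q"
  using tot_ram by (auto simp: totally_ramified_def)

lemmas P_discrete = rat_place_discrete[OF places(1)] and Q_discrete = place_discrete[OF places(2)]

sublocale vP: discrete_valuation "place_val P"
  using discrete_placeD[OF P_discrete] by blast

sublocale vQ: discrete_valuation "place_val Q"
  using discrete_placeD[OF Q_discrete] by blast

lemmas in_P = discrete_placeD(2,3)[OF P_discrete] and in_Q = discrete_placeD(2,3)[OF Q_discrete]

lemma over: "lies_over \<phi> Q P"
  using tot_ram by (simp add: totally_ramified_def)

lemma val_Q: "z \<noteq> 0 \<Longrightarrow> place_val Q (\<phi> z) = int N * place_val P z"
  using ram_index_eq[OF field_hom_axioms P_discrete Q_discrete over] tot_ram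
  by (simp add: totally_ramified_def)

text \<open>If \<open>N\<close> were 0, \<open>val_Q\<close> would give the image of a local
  parameter of \<open>P\<close> the value 0, although it lies in \<open>Q\<close>.\<close>

lemma N_pos: "0 < N"
proof (rule ccontr)
  assume N: "\<not> 0 < N"
  obtain t where t: "t \<noteq> 0" "place_val P t = 1" using vP.ex_uniformizer by blast
  then have "t \<in> P" by (simp add: in_P)
  then have "\<phi> t \<in> Q" using over by (auto simp: lies_over_def)
  then show False using t N val_Q[of t] by (simp add: in_Q)
qed

lemma residue_not_multiple: "int i \<noteq> 0 \<Longrightarrow> i < n \<Longrightarrow> \<not> int n dvd int n * a + int i"
  by (metis dvd_add_right_iff dvd_triv_left linorder_not_less nat_dvd_not_less of_nat_0_less_iff
      of_nat_dvd_iff zero_less_iff_neq_zero of_nat_0)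

lemma residue_unique:
  assumes "i < n" "j < n" "int n * a + int i = int n * b + int j"
  shows "i = j"
proof -
  have "int i mod int n = int j mod int n" using assms(3) by (metis mod_mult_self4)
  then show ?thesis using assms(1,2) by simp
qed

context
  fixes t assumes t: "t \<noteq> 0" "place_val Q t = 1"
begin

lemma term_val: "a \<noteq> 0 \<Longrightarrow> place_val Q (\<phi> a * t ^ i) = int N * place_val P a + int i"
  using t by (simp add: vQ.val_mult vQ.val_power val_Q)

text \<open>The value of the term with index \<open>i\<close> is congruent to \<open>i\<close>
  modulo \<open>N\<close>.\<close>

lemma terms_distinct:
  assumes "i < N" "j < N" "\<phi> (a i) * t ^ i \<noteq> 0" "\<phi> (a j) * t ^ j \<noteq> 0"
    "place_val Q (\<phi> (a i) * t ^ i) = place_val Q (\<phi> (a j) * t ^ j)"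
  shows "i = j"
  using assms residue_unique[of i N j "place_val P (a i)" "place_val P (a j)"]
  by (auto simp: term_val)

text \<open>The powers of \<open>t\<close> below \<open>N\<close> are independent over K(x) because
  the values of their multiples lie in different classes modulo \<open>N\<close>; total ramification
  makes the number of these classes equal to the degree of the extension.\<close>

lemma uniformizer_expansion: "\<exists>a. z = (\<Sum>i<N. \<phi> (a i) * t ^ i)"
proof (rule spanning_if_independent[OF finite_Y span_Y])
  fix a assume s0: "(\<Sum>i<N. \<phi> (a i) * t ^ i) = 0"
  have "(\<forall>i\<in>{..<N}. \<phi> (a i) * t ^ i = 0)"
    using vQ.val_sum_distinct[of "{..<N}" "\<lambda>i. \<phi> (a i) * t ^ i"] terms_distinct s0 by blast
  then show "\<forall>i<N. a i = 0" using t by simp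
qed

lemma expansion_val_ge:
  "vQ.val_ge s (\<Sum>i<N. \<phi> (a i) * t ^ i) \<longleftrightarrow> (\<forall>i<N. vQ.val_ge s (\<phi> (a i) * t ^ i))"
proof (subst vQ.val_ge_sum_distinct_iff)
  show "\<And>i j. i \<in> {..<N} \<Longrightarrow> j \<in> {..<N} \<Longrightarrow> \<phi> (a i) * t ^ i \<noteq> 0 \<Longrightarrow> \<phi> (a j) * t ^ j \<noteq> 0 \<Longrightarrow>
    place_val Q (\<phi> (a i) * t ^ i) = place_val Q (\<phi> (a j) * t ^ j) \<Longrightarrow> i = j"
    by (rule terms_distinct) simp_all
qed auto

text \<open>The value is congruent to \<open>i\<close> modulo \<open>N\<close>, so it cannot be
  0.\<close>

lemma expansion_tail_positive:
  assumes "vQ.val_ge 0 (\<Sum>i<N. \<phi> (a i) * t ^ i)" "0 < i" "i < N"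
  shows "vQ.val_ge 1 (\<phi> (a i) * t ^ i)"
proof (cases "a i = 0")
  case False
  have "vQ.val_ge 0 (\<phi> (a i) * t ^ i)" using assms expansion_val_ge by blast
  then have "0 \<le> int N * place_val P (a i) + int i"
    using False t by (simp add: vQ.val_ge_def term_val)
  moreover have "int N * place_val P (a i) + int i \<noteq> 0"
  proof
    assume "int N * place_val P (a i) + int i = 0"
    then have "int N dvd int N * place_val P (a i) + int i" by (simp only: dvd_0_right)
    then show False using residue_not_multiple[of i N "place_val P (a i)"] assms(2,3) by simp
  qed
  ultimately show ?thesis using False by (simp add: vQ.val_ge_def term_val)
qed simp

end

lemma split_first: "(\<Sum>i<N. g i) = g 0 + (\<Sum>i\<in>{0<..<N}. g i)" for g :: "nat \<Rightarrow> 'b"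
proof -
  have "{..<N} = insert 0 {0<..<N}" using N_pos by auto
  then show ?thesis by simp
qed

text \<open>Modulo \<open>Q\<close> only the term \<open>\<phi> (a 0)\<close> of the expansion
  survives, so the residue field at \<open>Q\<close> is no larger than the one at
  \<open>P\<close>.\<close>

lemma residue_const:
  assumes rat: "\<And>h. h \<in> place_ring P \<Longrightarrow> \<exists>c. h - rat_const c \<in> P"
    and z: "z \<in> place_ring Q"
  shows "\<exists>c. z - \<phi> (rat_const c) \<in> Q"
proof -
  obtain t where t: "t \<noteq> 0" "place_val Q t = 1" using vQ.ex_uniformizer by blast
  obtain a where a: "z = (\<Sum>i<N. \<phi> (a i) * t ^ i)" using uniformizer_expansion[OF t] by blast
  have z0: "vQ.val_ge 0 z" using z by (simp add: in_Q vQ.val_ge_def)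
  have "vQ.val_ge 0 (\<phi> (a 0) * t ^ 0)" using z0 expansion_val_ge[OF t] N_pos unfolding a by blast
  then have "a 0 \<in> place_ring P"
    using N_pos by (cases "a 0 = 0") (auto simp: vQ.val_ge_def in_P val_Q zero_le_mult_iff)
  then obtain c where "a 0 - rat_const c \<in> P" using rat by blast
  then have "\<phi> (a 0 - rat_const c) \<in> Q" using over by (auto simp: lies_over_def)
  then have "vQ.val_ge 1 (\<phi> (a 0) - \<phi> (rat_const c))" by (auto simp: in_Q vQ.val_ge_def hom_distribs)
  moreover have "vQ.val_ge 1 (\<Sum>i\<in>{0<..<N}. \<phi> (a i) * t ^ i)"
    using expansion_tail_positive[OF t] z0 unfolding a by (intro vQ.val_ge_sum) auto
  ultimately have "vQ.val_ge 1 (\<phi> (a 0) - \<phi> (rat_const c) + (\<Sum>i\<in>{0<..<N}. \<phi> (a i) * t ^ i))"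
    by (rule vQ.val_ge_add)
  also have "\<phi> (a 0) - \<phi> (rat_const c) + (\<Sum>i\<in>{0<..<N}. \<phi> (a i) * t ^ i) = z - \<phi> (rat_const c)"
    by (simp add: a split_first)
  finally show ?thesis by (intro exI[of _ c]) (auto simp: in_Q vQ.val_ge_def)
qed

text \<open>
  If \<open>d\<close> divides \<open>m\<close> and the valuation of \<open>f\<close>, then \<open>y\<^sup>m\<^sup>/\<^sup>d\<close>, divided by a power of a
  uniformizer of \<open>P\<close>, generates an extension that is unramified at \<open>P\<close>, so it lies in \<open>K(x)\<close>.
\<close>

lemma root_if_dvd_val:
  assumes d: "0 < d" "d dvd m" "int d dvd place_val P F" and char: "\<not> CHAR('a) dvd m"
  shows "\<exists>h. h ^ d = F"
proof -
  obtain p where p: "p \<noteq> 0" "place_val P p = 1" using vP.ex_uniformizer by blast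
  obtain l where l: "place_val P F = int d * l" using d(3) by (auto simp: dvd_def)
  obtain m' where m': "m = d * m'" using d(2) by (auto simp: dvd_def)
  have Fnz: "F \<noteq> 0" using f_nz by simp
  \<comment> \<open>Dividing \<open>F\<close> by a d-th power makes it a unit at \<open>P\<close>;
    \<open>W\<close> below is a d-th root of the result in the extension.\<close>
  define u where "u = F / (p powi l) ^ d"
  have u: "u \<noteq> 0" "place_val P u = 0"
    using p Fnz l by (simp_all add: u_def vP.val_divide vP.val_power vP.val_power_int)
  define W where "W = y ^ m' / \<phi> (p powi l)"
  have pl: "p powi l \<noteq> 0" using p by simp
  have Wnz: "W \<noteq> 0" using y_nz pl by (simp add: W_def)
  have Wd: "W ^ d = \<phi> u"
    by (simp add: W_def u_def power_divide hom_distribs m' y_pow_m[symmetric] power_mult[symmetric] mult.commute)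
  have "int d * place_val Q W = 0"
    using vQ.val_power[OF Wnz, of d] val_Q[OF u(1)] u(2) by (simp add: Wd)
  then have W0: "place_val Q W = 0" using d by simp
  obtain t where t: "t \<noteq> 0" "place_val Q t = 1" using vQ.ex_uniformizer by blast
  obtain a where a: "W = (\<Sum>i<N. \<phi> (a i) * t ^ i)" using uniformizer_expansion[OF t] by blast
  define r where "r = (\<Sum>i\<in>{0<..<N}. \<phi> (a i) * t ^ i)"
  have Wr: "W = \<phi> (a 0) + r" unfolding a r_def by (simp add: split_first)
  have Wge: "vQ.val_ge 0 W" using W0 by (simp add: vQ.val_ge_def)
  have r1: "vQ.val_ge 1 r"
    unfolding r_def using expansion_tail_positive[OF t] Wge unfolding a by (intro vQ.val_ge_sum) auto
  \<comment> \<open>\<open>W ^ d - b ^ d\<close> comes from K(x) and equals \<open>r * E\<close>,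
    where \<open>E\<close> is congruent to \<open>d * W ^ (d - 1)\<close>, a unit since the
    characteristic does not divide \<open>d\<close>. So the value of \<open>r\<close> would be a
    multiple of \<open>N\<close>, whereas the values of the tail terms are not.\<close>
  have "r = 0"
  proof (rule ccontr)
    assume rnz: "r \<noteq> 0"
    have dist: "i = j" if "i \<in> {0<..<N}" "j \<in> {0<..<N}" "\<phi> (a i) * t ^ i \<noteq> 0" "\<phi> (a j) * t ^ j \<noteq> 0"
      "place_val Q (\<phi> (a i) * t ^ i) = place_val Q (\<phi> (a j) * t ^ j)" for i j
      using terms_distinct[OF t] that by auto
    have "\<not> (\<forall>i\<in>{0<..<N}. \<phi> (a i) * t ^ i = 0)"
      using rnz unfolding r_def by (metis (no_types, lifting) sum.neutral)
    then obtain i where i: "i \<in> {0<..<N}" "\<phi> (a i) * t ^ i \<noteq> 0" "place_val Q r = place_val Q (\<phi> (a i) * t ^ i)"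
      using vQ.val_sum_distinct[of "{0<..<N}" "\<lambda>i. \<phi> (a i) * t ^ i"] dist unfolding r_def by blast
    then have nd: "\<not> int N dvd place_val Q r"
      using residue_not_multiple[of i N] by (simp add: term_val[OF t])
    define b where "b = \<phi> (a 0)"
    have bW: "b = W - r" by (simp add: b_def Wr)
    have b0: "vQ.val_ge 0 b"
      unfolding bW using Wge r1 by (intro vQ.val_ge_diff) (auto intro: vQ.val_ge_mono)
    have pow: "vQ.val_ge 1 (b ^ k - W ^ k)" for k
    proof (induction k)
      case (Suc k)
      have "vQ.val_ge (0 + 1) (b * (b ^ k - W ^ k))" by (intro vQ.val_ge_mult b0 Suc.IH)
      moreover have "vQ.val_ge (1 + 0) (r * W ^ k)"
        using vQ.val_ge_power[OF Wge, of k] by (intro vQ.val_ge_mult r1) simp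
      ultimately have "vQ.val_ge 1 (b * (b ^ k - W ^ k) - r * W ^ k)" by (intro vQ.val_ge_diff) simp_all
      then show ?case by (simp add: bW algebra_simps)
    qed simp
    obtain e where e: "d = Suc e" using d(1) by (cases d) auto
    define E where "E = (\<Sum>k<d. W ^ k * b ^ (e - k))"
    have "vQ.val_ge 1 (\<Sum>k<d. W ^ k * (b ^ (e - k) - W ^ (e - k)))"
    proof (rule vQ.val_ge_sum)
      fix k
      have "vQ.val_ge (0 + 1) (W ^ k * (b ^ (e - k) - W ^ (e - k)))"
        using vQ.val_ge_power[OF Wge, of k] by (intro vQ.val_ge_mult pow) simp
      then show "vQ.val_ge 1 (W ^ k * (b ^ (e - k) - W ^ (e - k)))" by simp
    qed
    also have "(\<Sum>k<d. W ^ k * (b ^ (e - k) - W ^ (e - k))) = E - (\<Sum>k<d. W ^ e)"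
      unfolding E_def sum_subtractf[symmetric]
      by (rule sum.cong) (auto simp: e right_diff_distrib power_add[symmetric])
    finally have E1: "vQ.val_ge 1 (E - of_nat d * W ^ e)" by simp
    have "\<not> CHAR('a) dvd d" using char d(2) dvd_trans by blast
    then have dnz: "(of_nat d :: 'a) \<noteq> 0" by (simp add: of_nat_eq_0_iff_char_dvd)
    have "(of_nat d :: 'b) = (\<phi> \<circ> rat_const) (of_nat d)" by (simp add: hom_distribs rat_const.hom_of_nat)
    moreover have "field_hom (\<phi> \<circ> rat_const)"
      by unfold_locales (simp_all add: hom_distribs rat_const.hom_add rat_const.hom_mult)
    ultimately have dv: "place_val Q (of_nat d) = 0" "(of_nat d :: 'b) \<noteq> 0"
      using place_val_const[OF _ places(2) Q_discrete dnz] dnz by auto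
    have dW: "of_nat d * W ^ e \<noteq> 0" "place_val Q (of_nat d * W ^ e) = 0"
      using dv Wnz W0 by (simp_all add: vQ.val_mult vQ.val_power)
    have EnZ: "E \<noteq> 0" "place_val Q E = 0"
      using vQ.val_add_eq[OF dW(1), of "E - of_nat d * W ^ e"] E1 dW by auto
    have "W ^ d - b ^ d = r * E"
      unfolding e E_def diff_power_eq_sum by (simp add: bW)
    then have "\<phi> (u - a 0 ^ d) = r * E" by (simp add: Wd b_def hom_distribs)
    moreover from this have "u - a 0 ^ d \<noteq> 0" using rnz EnZ by auto
    ultimately have "int N * place_val P (u - a 0 ^ d) = place_val Q r"
      using val_Q[of "u - a 0 ^ d"] rnz EnZ by (simp add: vQ.val_mult)
    then show False using nd by (metis dvd_triv_left)
  qed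
  then have "\<phi> (a 0 ^ d) = \<phi> u" using Wr Wd by (simp add: hom_distribs)
  then have "a 0 ^ d = u" by simp
  then have "(p powi l * a 0) ^ d = F" using pl by (simp add: power_mult_distrib u_def)
  then show ?thesis by blast
qed

lemma coprime_val:
  assumes char: "\<not> CHAR('a) dvd m"
    and nopow: "\<forall>d\<ge>2. d dvd m \<longrightarrow> (\<nexists>h. h ^ d = F)"
  shows "coprime (place_val P F) (int m)"
proof -
  define d where "d = nat (gcd (place_val P F) (int m))"
  have d: "int d = gcd (place_val P F) (int m)" by (simp add: d_def)
  have dv: "int d dvd place_val P F" "int d dvd int m" unfolding d by simp_all
  have d0: "0 < d" using m_pos d by (metis gcd_eq_0_iff gr0I of_nat_0 of_nat_eq_0_iff less_numeral_extra(3))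
  have dm: "d dvd m" using dv by simp
  have "\<exists>h. h ^ d = F" by (rule root_if_dvd_val[OF d0 dm dv(1) char])
  then have "\<not> 2 \<le> d" using nopow dm by blast
  then have "d = 1" using d0 by simp
  then show ?thesis using d by (simp add: coprime_iff_gcd_eq_1)
qed

text \<open>Comparing values in \<open>y ^ m = \<phi> F\<close> shows that \<open>m\<close> divides
  \<open>N\<close>, while \<open>N\<close> is at most \<open>m\<close>.\<close>

lemma val_y_ext_degree:
  assumes cop: "coprime (place_val P F) (int m)"
  shows "N = m" "place_val Q y = place_val P F"
proof -
  have eq: "int m * place_val Q y = int N * place_val P F"
    using vQ.val_power[OF y_nz, of m] val_Q[of F] f_nz by (simp add: y_pow_m)
  then have "int m dvd int N * place_val P F" by (metis dvd_triv_left)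
  then have "int m dvd int N" using cop by (simp add: coprime_dvd_mult_left_iff coprime_commute)
  then have "m \<le> N" using N_pos by (auto dest: dvd_imp_le)
  then show "N = m" using ext_degree_le by simp
  then show "place_val Q y = place_val P F" using eq m_pos by simp
qed

end

section \<open>Extension of places\<close>

text \<open>A subring maximal among those that contain \<open>inverse z\<close> and avoid
  \<open>z\<close>: the object from which Chevalley's extension theorem obtains a valuation
  ring.\<close>

locale maximal_avoiding =
  fixes B :: "'a::field set" and z :: 'a
  assumes B_add: "a \<in> B \<Longrightarrow> b \<in> B \<Longrightarrow> a + b \<in> B"
    and B_diff: "a \<in> B \<Longrightarrow> b \<in> B \<Longrightarrow> a - b \<in> B"
    and B_mult: "a \<in> B \<Longrightarrow> b \<in> B \<Longrightarrow> a * b \<in> B"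
    and B_1: "1 \<in> B" and B_inv: "inverse z \<in> B" and B_avoid: "z \<notin> B"
    and B_max: "\<And>C. \<lbrakk>B \<subseteq> C; \<And>a b. a \<in> C \<Longrightarrow> b \<in> C \<Longrightarrow> a + b \<in> C \<and> a - b \<in> C \<and> a * b \<in> C; z \<notin> C\<rbrakk>
      \<Longrightarrow> C = B"
begin

lemma B_0: "0 \<in> B"
  using B_diff[OF B_1 B_1] by simp

lemma B_uminus: "a \<in> B \<Longrightarrow> - a \<in> B"
  using B_diff[OF B_0, of a] by simp

lemma B_power: "a \<in> B \<Longrightarrow> a ^ n \<in> B"
  by (induction n) (auto simp: B_1 B_mult)

lemma B_sum: "(\<And>i. i \<in> I \<Longrightarrow> g i \<in> B) \<Longrightarrow> sum g I \<in> B"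
  by (induction I rule: infinite_finite_induct) (auto simp: B_0 B_add)

lemma z_nz: "z \<noteq> 0"
  using B_avoid B_0 by auto

text \<open>The set \<open>C\<close> in the proof is \<open>B\<close> with the inverse of
  \<open>c = 1 + inverse z * b\<close> adjoined. It avoids \<open>z\<close> because
  \<open>z * c ^ n\<close> equals \<open>z * c ^ (n + 1) - c ^ n * b\<close>, so that factors
  \<open>c\<close> can be stripped off one at a time. By maximality it is \<open>B\<close>.\<close>

lemma one_plus_invertible:
  assumes b: "b \<in> B"
  shows "1 + inverse z * b \<noteq> 0" "inverse (1 + inverse z * b) \<in> B"
proof -
  define c where "c = 1 + inverse z * b"
  have cB: "c \<in> B" unfolding c_def using b by (intro B_add B_1 B_mult B_inv)
  show nz: "1 + inverse z * b \<noteq> 0"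
  proof
    assume "1 + inverse z * b = 0"
    then have "z * (1 + inverse z * b) = 0" by simp
    moreover have "z * (1 + inverse z * b) = z + b" using z_nz by (simp add: distrib_left flip: mult.assoc)
    ultimately have "z = - b" by (simp add: add_eq_0_iff2)
    then show False using B_avoid B_uminus[OF b] by simp
  qed
  then have cnz: "c \<noteq> 0" by (simp add: c_def)
  define C where "C = {x. \<exists>n. x * c ^ n \<in> B}"
  have "C = B"
  proof (rule B_max)
    show "B \<subseteq> C" unfolding C_def by (auto intro: exI[of _ 0])
    have step: "x * c ^ (n + k) \<in> B" if "x * c ^ n \<in> B" for x n k
      using B_mult[OF that B_power[OF cB, of k]] by (simp add: power_add mult.assoc)
    fix x x' assume "x \<in> C" "x' \<in> C"
    then obtain n n' where n: "x * c ^ n \<in> B" "x' * c ^ n' \<in> B" by (auto simp: C_def)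
    have 1: "x * c ^ (n + n') \<in> B" using step[OF n(1)] .
    have 2: "x' * c ^ (n + n') \<in> B" using step[OF n(2), of n] by (simp add: add.commute)
    have "(x + x') * c ^ (n + n') \<in> B" "(x - x') * c ^ (n + n') \<in> B"
      using B_add[OF 1 2] B_diff[OF 1 2] by (simp_all add: algebra_simps)
    moreover have "(x * x') * c ^ (n + n') \<in> B"
      using B_mult[OF n] by (simp add: power_add mult_ac)
    ultimately show "x + x' \<in> C \<and> x - x' \<in> C \<and> x * x' \<in> C" unfolding C_def by blast
  next
    have "z * c ^ n \<in> B \<Longrightarrow> z \<in> B" for n
    proof (induction n)
      case (Suc n)
      have "z * c ^ n = z * c ^ Suc n - c ^ n * b"
        using z_nz by (simp add: c_def algebra_simps)
      also have "\<dots> \<in> B" by (rule B_diff[OF Suc.prems B_mult[OF B_power[OF cB] b]])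
      finally show ?case by (rule Suc.IH)
    qed simp
    then show "z \<notin> C" using B_avoid by (auto simp: C_def)
  qed
  moreover have "inverse c \<in> C" unfolding C_def using cnz by (auto intro!: exI[of _ 1] simp: B_1)
  ultimately show "inverse (1 + inverse z * b) \<in> B" by (simp add: c_def)
qed

definition BP where "BP = {p. \<forall>i. coeff p i \<in> B}"

lemma BP_add: "p \<in> BP \<Longrightarrow> q \<in> BP \<Longrightarrow> p + q \<in> BP"
  and BP_diff: "p \<in> BP \<Longrightarrow> q \<in> BP \<Longrightarrow> p - q \<in> BP"
  by (simp_all add: BP_def B_add B_diff)

lemma BP_mult: "p \<in> BP \<Longrightarrow> q \<in> BP \<Longrightarrow> p * q \<in> BP"
  by (simp add: BP_def coeff_mult B_sum B_mult)

lemma BP_monom: "b \<in> B \<Longrightarrow> monom b n \<in> BP"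
  by (simp add: BP_def B_0)

lemma BP_sum: "(\<And>i. i \<in> I \<Longrightarrow> g i \<in> BP) \<Longrightarrow> sum g I \<in> BP"
  by (simp add: BP_def coeff_sum B_sum)

text \<open>Adjoining \<open>u\<close> enlarges \<open>B\<close>, so by maximality the ring of
  polynomial values at \<open>u\<close> contains \<open>z\<close>.\<close>

lemma adjoin_contains:
  assumes "u \<notin> B"
  shows "\<exists>p\<in>BP. inverse z * poly p u = 1"
proof (rule ccontr)
  assume neg: "\<not> ?thesis"
  define C where "C = {poly p u | p. p \<in> BP}"
  have "C = B"
  proof (rule B_max)
    show "B \<subseteq> C"
    proof
      fix b assume "b \<in> B"
      then have "monom b 0 \<in> BP" by (rule BP_monom)
      moreover have "b = poly (monom b 0) u" by (simp add: poly_monom)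
      ultimately show "b \<in> C" unfolding C_def by blast
    qed
    fix a b assume "a \<in> C" "b \<in> C"
    then obtain p q where "p \<in> BP" "q \<in> BP" "a = poly p u" "b = poly q u" by (auto simp: C_def)
    then show "a + b \<in> C \<and> a - b \<in> C \<and> a * b \<in> C"
      unfolding C_def by (auto intro: BP_add BP_diff BP_mult simp flip: poly_add poly_diff poly_mult)
  next
    show "z \<notin> C"
    proof
      assume "z \<in> C"
      then obtain p where "p \<in> BP" "z = poly p u" by (auto simp: C_def)
      then show False using neg z_nz by (metis left_inverse)
    qed
  qed
  moreover have "u \<in> C"
  proof -
    have "monom 1 1 \<in> BP" by (rule BP_monom[OF B_1])
    moreover have "u = poly (monom 1 1) u" by (simp add: poly_monom)
    ultimately show ?thesis unfolding C_def by blast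
  qed
  ultimately show False using assms by simp
qed

text \<open>The relation for \<open>inverse u\<close> expresses 1 by negative powers of
  \<open>u\<close>, up to the invertible factor \<open>1 - inverse z * coeff q 0\<close>. Multiplied
  by the leading term of \<open>p\<close>, it replaces that term by lower ones.\<close>

lemma reduce_degree:
  assumes u: "u \<noteq> 0" and p: "p \<in> BP" "inverse z * poly p u = 1"
    and q: "q \<in> BP" "inverse z * poly q (inverse u) = 1" and le: "degree q \<le> degree p"
  shows "\<exists>p'\<in>BP. inverse z * poly p' u = 1 \<and> degree p' < degree p"
proof -
  define n where "n = degree p"
  define k where "k = degree q"
  \<comment> \<open>A constant \<open>p\<close> would make \<open>z\<close> itself an element of
    \<open>B\<close>.\<close>
  have np: "0 < n"
  proof (rule ccontr)
    assume "\<not> 0 < n"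
    then obtain c where "p = [:c:]" unfolding n_def by (auto elim: degree_eq_zeroE)
    moreover from this have "c \<in> B" using p(1) by (auto simp: BP_def coeff_pCons split: nat.splits)
    ultimately show False using p(2) z_nz B_avoid by (auto simp: field_simps)
  qed
  define e where "e = inverse (1 + inverse z * (- coeff q 0))"
  have qB: "coeff q i \<in> B" and pB: "coeff p i \<in> B" for i using p q by (auto simp: BP_def)
  have e: "e \<in> B" "1 - inverse z * coeff q 0 \<noteq> 0" "e * (1 - inverse z * coeff q 0) = 1"
    using one_plus_invertible[OF B_uminus[OF qB[of 0]]] by (simp_all add: e_def)
  have "poly q (inverse u) = (\<Sum>i\<le>k. coeff q i * inverse u ^ i)"
    by (simp add: poly_altdef k_def)
  also have "\<dots> = coeff q 0 + (\<Sum>i\<in>{1..k}. coeff q i * inverse u ^ i)"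
    by (simp add: sum.atMost_shift sum.atLeast1_atMost_eq lessThan_Suc_atMost atLeast0LessThan)
  finally have "1 - inverse z * coeff q 0 = inverse z * (\<Sum>i\<in>{1..k}. coeff q i * inverse u ^ i)"
    using q(2) by (simp add: algebra_simps)
  then have one: "e * inverse z * (\<Sum>i\<in>{1..k}. coeff q i * inverse u ^ i) = 1"
    using e(3) by (simp add: mult.assoc)
  \<comment> \<open>The leading term \<open>coeff p n * u ^ n\<close> rewritten by means of
    \<open>one\<close>; \<open>degree q \<le> degree p\<close> keeps the exponents
    \<open>n - i\<close> untruncated.\<close>
  define r where "r = (\<Sum>i\<in>{1..k}. monom (coeff p n * (e * inverse z * coeff q i)) (n - i))"
  define p' where "p' = p - monom (coeff p n) n + r"
  have "r \<in> BP"
    unfolding r_def by (intro BP_sum BP_monom B_mult e qB pB B_inv)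
  then have "p' \<in> BP" unfolding p'_def by (intro BP_add BP_diff BP_monom p pB)
  moreover have "poly r u = coeff p n * u ^ n"
  proof -
    have "poly r u = (\<Sum>i\<in>{1..k}. coeff p n * (e * inverse z * coeff q i) * u ^ (n - i))"
      by (simp add: r_def poly_sum poly_monom)
    also have "\<dots> = (\<Sum>i\<in>{1..k}. coeff p n * u ^ n * (e * inverse z * (coeff q i * inverse u ^ i)))"
    proof (rule sum.cong)
      fix i assume "i \<in> {1..k}"
      then have "u ^ (n - i) = u ^ n * inverse u ^ i"
        using le u by (simp add: k_def n_def power_diff power_inverse divide_inverse)
      then show "coeff p n * (e * inverse z * coeff q i) * u ^ (n - i) =
          coeff p n * u ^ n * (e * inverse z * (coeff q i * inverse u ^ i))"
        by (simp only: mult_ac)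
    qed simp
    also have "\<dots> = coeff p n * u ^ n * (e * inverse z * (\<Sum>i\<in>{1..k}. coeff q i * inverse u ^ i))"
      by (simp add: sum_distrib_left)
    finally show ?thesis by (simp only: one mult_1_right)
  qed
  then have "poly p' u = poly p u" by (simp add: p'_def poly_monom)
  moreover have "degree p' < n"
  proof -
    have "coeff p' i = 0" if "n \<le> i" for i
    proof -
      have "coeff r i = 0"
        unfolding r_def coeff_sum using that np by (intro sum.neutral) auto
      then show ?thesis using that by (cases "i = n") (auto simp: p'_def n_def coeff_eq_0)
    qed
    then show ?thesis using np by (metis degree_lessI)
  qed
  ultimately show ?thesis using p(2) n_def by (intro bexI[of _ p']) auto
qed

text \<open>If neither \<open>u\<close> nor \<open>inverse u\<close> lay in \<open>B\<close>, both
  would have relations as in \<open>adjoin_contains\<close>; of two such relations of least degree,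
  the one whose degree is not smaller could be shortened by the other.\<close>

lemma valuation_subring_B: "valuation_subring B"
proof
  fix u :: 'a assume u: "u \<noteq> 0"
  show "u \<in> B \<or> inverse u \<in> B"
  proof (rule ccontr)
    assume neg: "\<not> ?thesis"
    define A where "A u p \<longleftrightarrow> p \<in> BP \<and> inverse z * poly p u = 1" for u p
    have ex: "\<exists>p. A u p \<and> (\<forall>q. A u q \<longrightarrow> degree p \<le> degree q)" if "u \<notin> B" for u
    proof -
      have "\<exists>p. A u p" using adjoin_contains[OF that] by (auto simp: A_def)
      then show ?thesis using ex_has_least_nat[of "A u" _ degree] by metis
    qed
    obtain p where p: "A u p" "\<forall>q. A u q \<longrightarrow> degree p \<le> degree q" using ex[of u] neg by blast
    obtain q where q: "A (inverse u) q" "\<forall>r. A (inverse u) r \<longrightarrow> degree q \<le> degree r"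
      using ex[of "inverse u"] neg by blast
    show False
    proof (cases "degree q \<le> degree p")
      case True
      from reduce_degree[OF u _ _ _ _ this] p q show False unfolding A_def by (meson linorder_not_less)
    next
      case False
      then have le: "degree p \<le> degree q" by simp
      have "inverse u \<noteq> 0" using u by simp
      from reduce_degree[OF this _ _ _ _ le] p q show False
        unfolding A_def inverse_inverse_eq by (meson linorder_not_less)
    qed
  qed
qed (auto intro: B_add B_diff B_mult)

end

lemma valuation_subring_avoiding:
  fixes A :: "'a::field set"
  assumes ring: "\<And>a b. a \<in> A \<Longrightarrow> b \<in> A \<Longrightarrow> a + b \<in> A \<and> a - b \<in> A \<and> a * b \<in> A"
    and z: "1 \<in> A" "inverse z \<in> A" "z \<notin> A"
  obtains B where "valuation_subring B" "A \<subseteq> B" "z \<notin> B"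
proof -
  define S where "S = {B. A \<subseteq> B \<and> z \<notin> B \<and> (\<forall>a\<in>B. \<forall>b\<in>B. a + b \<in> B \<and> a - b \<in> B \<and> a * b \<in> B)}"
  have "\<exists>B\<in>S. \<forall>C\<in>S. B \<subseteq> C \<longrightarrow> C = B"
  proof (rule subset_Zorn_nonempty)
    have "A \<in> S" using assms by (auto simp: S_def)
    then show "S \<noteq> {}" by blast
    fix \<C> assume C: "\<C> \<noteq> {}" "subset.chain S \<C>"
    then have CS: "\<C> \<subseteq> S" and tot: "\<And>U V. U \<in> \<C> \<Longrightarrow> V \<in> \<C> \<Longrightarrow> U \<subseteq> V \<or> V \<subseteq> U"
      unfolding subset_chain_def by blast+
    show "\<Union>\<C> \<in> S"
      unfolding S_def
    proof (intro CollectI conjI ballI)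
      show "A \<subseteq> \<Union>\<C>" using C(1) CS unfolding S_def by blast
      show "z \<notin> \<Union>\<C>" using CS by (auto simp: S_def)
      fix a b assume "a \<in> \<Union>\<C>" "b \<in> \<Union>\<C>"
      then obtain U where U: "U \<in> \<C>" "a \<in> U" "b \<in> U" using tot by (meson UnionE subset_iff)
      then have "a + b \<in> U \<and> a - b \<in> U \<and> a * b \<in> U" using CS by (auto simp: S_def)
      then show "a + b \<in> \<Union>\<C>" "a - b \<in> \<Union>\<C>" "a * b \<in> \<Union>\<C>" using U(1) by blast+
    qed
  qed
  then obtain B where B: "B \<in> S" "\<And>C. C \<in> S \<Longrightarrow> B \<subseteq> C \<Longrightarrow> C = B" by blast
  interpret maximal_avoiding B z
  proof
    show "\<And>a b. a \<in> B \<Longrightarrow> b \<in> B \<Longrightarrow> a + b \<in> B" "\<And>a b. a \<in> B \<Longrightarrow> b \<in> B \<Longrightarrow> a - b \<in> B"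
      "\<And>a b. a \<in> B \<Longrightarrow> b \<in> B \<Longrightarrow> a * b \<in> B" "1 \<in> B" "inverse z \<in> B" "z \<notin> B"
      using B(1) z by (auto simp: S_def)
    fix C assume "B \<subseteq> C" "\<And>a b. a \<in> C \<Longrightarrow> b \<in> C \<Longrightarrow> a + b \<in> C \<and> a - b \<in> C \<and> a * b \<in> C" "z \<notin> C"
    then show "C = B" using B(1) by (intro B(2)) (auto simp: S_def)
  qed
  show thesis using that[OF valuation_subring_B] B(1) by (auto simp: S_def)
qed

section \<open>The m-th roots of unity when m is invertible\<close>

lemma degree_monom_minus_1: "0 < m \<Longrightarrow> degree (monom 1 m - 1 :: 'a::comm_ring_1 poly) = m"
  using degree_add_eq_left[of "- 1" "monom (1::'a) m"] by (simp add: degree_monom_eq)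

text \<open>The derivative of X^m - 1 vanishes at most at 0, so all roots are simple, and over an
  algebraically closed field the linear factors account for the full degree.\<close>

lemma card_roots_of_unity:
  assumes "0 < m" "(of_nat m :: 'a::alg_closed_field) \<noteq> 0"
  shows "finite {z::'a. z ^ m = 1}" "card {z::'a. z ^ m = 1} = m"
proof -
  define p :: "'a poly" where "p = monom 1 m - 1"
  have pz: "poly p z = z ^ m - 1" for z by (simp add: p_def poly_monom)
  have dp: "degree p = m"
    unfolding p_def by (rule degree_monom_minus_1) (use assms in auto)
  have pnz: "p \<noteq> 0" using dp assms(1) by auto
  have ord: "order a p \<le> 1" for a
  proof (rule ccontr)
    assume "\<not> order a p \<le> 1"
    then have "[:- a, 1:] ^ 2 dvd p" unfolding order_divides by simp
    then obtain q where q: "p = [:- a, 1:] * ([:- a, 1:] * q)"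
      unfolding power2_eq_square mult.assoc[symmetric] by (auto elim: dvdE)
    have "poly p a = 0" by (simp add: q)
    then have am: "a ^ m = 1" by (simp add: pz)
    then have "a \<noteq> 0" using assms(1) by (auto simp: power_0_left)
    moreover have "poly (pderiv p) a = 0" unfolding q pderiv_mult by simp
    then have "of_nat m * a ^ (m - 1) = 0" by (simp add: p_def pderiv_diff pderiv_monom poly_monom)
    ultimately show False using assms by simp
  qed
  obtain A where A: "size A = degree p" "p = smult (lead_coeff p) (\<Prod>x\<in>#A. [:-x, 1:])"
    using alg_closed_imp_factorization[OF pnz] by blast
  have pr: "proots (\<Prod>x\<in>#B. [:-x, 1:]) = B" for B :: "'a multiset"
  proof (induction B)
    case (add b B)
    have "(\<Prod>x\<in>#B. [:-x, 1:]) \<noteq> 0" by (auto simp: prod_mset_zero_iff)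
    then show ?case using add proots_linear_factor[of "- b"]
      by (simp add: proots_mult del: mult_pCons_left proots_linear_factor)
  qed simp
  have "proots p = proots (\<Prod>x\<in>#A. [:-x, 1:])"
    by (subst A(2), rule proots_smult) (use pnz in simp)
  also have "\<dots> = A" by (rule pr)
  finally have pA: "proots p = A" .
  then have "count A a \<le> 1" for a using ord pnz by (metis count_proots)
  then have "\<forall>a\<in>#A. count A a = 1" by (metis count_greater_zero_iff le_antisym less_eq_Suc_le One_nat_def)
  then have "size A = card (set_mset A)" unfolding size_multiset_overloaded_eq by simp
  moreover have "set_mset A = {z. z ^ m = 1}"
    using set_count_proots[OF pnz] by (simp add: pz pA)
  ultimately show "finite {z::'a. z ^ m = 1}" "card {z::'a. z ^ m = 1} = m"
    using A(1) dp by (metis finite_set_mset, simp)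
qed

text \<open>Some root of unity \<open>c\<close> has \<open>c ^ i \<noteq> 1\<close>, since X^i - 1
  has at most \<open>i < m\<close> roots; multiplication by \<open>c\<close> permutes the roots and
  scales the sum by \<open>c ^ i\<close>.\<close>

lemma sum_roots_of_unity:
  assumes "0 < m" "(of_nat m :: 'a::alg_closed_field) \<noteq> 0" "0 < i" "i < m"
  shows "(\<Sum>z\<in>{z::'a. z ^ m = 1}. z ^ i) = 0"
proof -
  let ?U = "{z::'a. z ^ m = 1}"
  note U = card_roots_of_unity[OF assms(1,2)]
  have "\<exists>c\<in>?U. c ^ i \<noteq> 1"
  proof (rule ccontr)
    assume neg: "\<not> ?thesis"
    define p :: "'a poly" where "p = monom 1 i - 1"
    have dp: "degree p = i"
      unfolding p_def by (rule degree_monom_minus_1) (use assms in auto)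
    then have pnz: "p \<noteq> 0" using assms by auto
    have "?U \<subseteq> {z. poly p z = 0}" using neg by (auto simp: p_def poly_monom)
    then have "card ?U \<le> card {z. poly p z = 0}" by (rule card_mono[OF poly_roots_finite[OF pnz]])
    also have "\<dots> \<le> i" using card_poly_roots_bound[OF pnz] dp by simp
    finally show False using U assms by simp
  qed
  then obtain c :: 'a where c: "c ^ m = 1" "c ^ i \<noteq> 1" by auto
  then have "c \<noteq> 0" using assms by (auto simp: power_0_left)
  have "(\<Sum>z\<in>?U. z ^ i) = (\<Sum>z\<in>?U. (c * z) ^ i)"
  proof (rule sum.reindex_bij_witness[of _ "\<lambda>z. c * z" "\<lambda>z. z / c"])
    fix z assume "z \<in> ?U"
    then show "c * (z / c) = z" "z / c \<in> ?U" "(c * (z / c)) ^ i = z ^ i" "c * z / c = z" "c * z \<in> ?U"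
      using c(1) \<open>c \<noteq> 0\<close> by (simp_all add: power_divide power_mult_distrib)
  qed
  also have "\<dots> = c ^ i * (\<Sum>z\<in>?U. z ^ i)" by (simp add: power_mult_distrib sum_distrib_left)
  finally have "(1 - c ^ i) * (\<Sum>z\<in>?U. z ^ i) = 0" by (simp add: algebra_simps)
  then show ?thesis using c(2) by simp
qed

section \<open>Conjugates\<close>

text \<open>Discrete valuation rings are maximal proper subrings: units for \<open>R\<close> are
  units for \<open>P\<close>, so the value at \<open>P\<close> is the value at \<open>R\<close>
  times a constant, which is nonnegative and nonzero.\<close>

lemma place_eq_if_ring_subset:
  assumes P: "discrete_place P" and R: "discrete_place R" and sub: "place_ring R \<subseteq> place_ring P"
  shows "R = P"
proof -
  interpret P: discrete_valuation "place_val P" using discrete_placeD[OF P] by blast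
  interpret R: discrete_valuation "place_val R" using discrete_placeD[OF R] by blast
  note inP = discrete_placeD(2,3)[OF P] and inR = discrete_placeD(2,3)[OF R]
  have ge: "0 \<le> place_val P z" if "z \<noteq> 0" "0 \<le> place_val R z" for z
  proof -
    have "z \<in> place_ring R" using that by (simp add: inR)
    then show ?thesis using sub that inP by auto
  qed
  have unit: "place_val P z = 0" if "z \<noteq> 0" "place_val R z = 0" for z
    using ge[of z] ge[of "inverse z"] that by (simp add: P.val_inverse R.val_inverse)
  obtain t where t: "t \<noteq> 0" "place_val R t = 1" using R.ex_uniformizer by blast
  have eq: "place_val P z = place_val R z * place_val P t" if z: "z \<noteq> 0" for z
  proof -
    let ?u = "z / t powi place_val R z"
    have "place_val P ?u = 0"
      using z t by (intro unit) (simp_all add: R.val_divide R.val_power_int)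
    then show ?thesis using z t by (simp add: P.val_divide P.val_power_int)
  qed
  obtain s where s: "s \<noteq> 0" "place_val P s = 1" using P.ex_uniformizer by blast
  have "place_val P t \<noteq> 0" using eq[OF s(1)] s by auto
  then have "0 < place_val P t" using ge[of t] t by simp
  then have "z \<in> R \<longleftrightarrow> z \<in> P" for z
    using eq[of z] by (cases "z = 0") (auto simp: inP inR zero_less_mult_iff)
  then show ?thesis by blast
qed

context alg_extension
begin

text \<open>The valuation ring of \<open>Q\<close> contracts to a proper subring of K(x), because by
  algebraicity a valuation ring containing all of K(x) is everything.\<close>

lemma place_below:
  assumes Q: "is_place (\<phi> \<circ> rat_const) Q"
  defines "R \<equiv> {h. \<phi> h \<in> Q}"
  shows "is_place rat_const R" "lies_over \<phi> Q R" "h \<in> place_ring R \<longleftrightarrow> \<phi> h \<in> place_ring Q"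
proof -
  obtain V: "valuation_subring (place_ring Q)" and c: "range (\<phi> \<circ> rat_const) \<subset> place_ring Q"
    and nU: "place_ring Q \<noteq> UNIV" and QM: "Q = valuation_subring.M (place_ring Q)"
    by (rule is_placeE[OF Q])
  interpret V: valuation_subring "place_ring Q" by fact
  define A where "A = {h. \<phi> h \<in> place_ring Q}"
  interpret A: valuation_subring A
  proof
    show "\<And>a b. a \<in> A \<Longrightarrow> b \<in> A \<Longrightarrow> a + b \<in> A" "\<And>a b. a \<in> A \<Longrightarrow> b \<in> A \<Longrightarrow> a - b \<in> A"
      "\<And>a b. a \<in> A \<Longrightarrow> b \<in> A \<Longrightarrow> a * b \<in> A"
      by (simp_all add: A_def hom_distribs V.R_add V.R_diff V.R_mult)
    fix h :: "'k poly fract" assume "h \<noteq> 0"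
    then show "h \<in> A \<or> inverse h \<in> A"
      using V.R_total[of "\<phi> h"] by (simp add: A_def hom_inverse)
  qed
  have RM: "R = A.M"
    unfolding R_def A.M_def by (subst QM) (auto simp: A_def V.M_def hom_inverse)
  have "A \<noteq> UNIV"
  proof
    assume "A = UNIV"
    then have "range \<phi> \<subseteq> place_ring Q" by (auto simp: A_def)
    then show False using eq_UNIV_if_range_subset[OF V] nU by simp
  qed
  moreover have "range rat_const \<subset> A"
  proof -
    have "range rat_const \<subseteq> A" using c by (auto simp: A_def)
    moreover obtain w where w: "gen w" "\<phi> w \<in> place_ring Q" by (rule gen_in_ring[OF V])
    have "w \<notin> range rat_const"
    proof
      assume "w \<in> range rat_const"
      then obtain c where "ev w (pCons 0 1) = ev w [:c:]" by auto
      then have "pCons 0 1 = [:c:]" using w by (simp only: gen_eq_iff)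
      then show False by simp
    qed
    ultimately show ?thesis using w by (auto simp: A_def)
  qed
  ultimately have "is_place rat_const A.M" by (intro is_placeI A.valuation_subring_axioms)
  then show "is_place rat_const R" by (simp add: RM)
  show "lies_over \<phi> Q R" by (auto simp: lies_over_def R_def)
  show "h \<in> place_ring R \<longleftrightarrow> \<phi> h \<in> place_ring Q"
    unfolding RM place_ring_M[OF A.valuation_subring_axioms] by (simp add: A_def)
qed

end

text \<open>On the curve this independence comes from the pairwise different values of the terms at
  \<open>Q 1\<close>.\<close>

locale kummer_basis = kummer_extension +
  assumes indep: "\<And>h. (\<Sum>i<m. \<phi> (h i) * y ^ i) = 0 \<Longrightarrow> \<forall>i<m. h i = 0"
begin

text \<open>Division by X^m - F leaves a remainder of degree below \<open>m\<close>, which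
  independence forces to be 0.\<close>

lemma poly_root_imp_dvd:
  assumes "poly (map_poly \<phi> p) y = 0"
  shows "monom 1 m - [:F:] dvd p"
proof -
  interpret mp: map_poly_inj_idom_hom \<phi> ..
  let ?q = "monom 1 m - [:F:] :: 'a poly fract poly"
  have qy: "poly (map_poly \<phi> ?q) y = 0"
    by (simp add: hom_distribs poly_monom y_pow_m)
  have cq: "coeff ?q m = 1" using m_pos by (simp add: coeff_pCons split: nat.splits)
  then have qnz: "?q \<noteq> 0" by (metis coeff_0 zero_neq_one)
  have dq: "degree ?q \<le> m" by (intro degree_diff_le degree_monom_le) simp
  define s where "s = p mod ?q"
  have "p = p div ?q * ?q + s" unfolding s_def by (rule div_mult_mod_eq[symmetric])
  then have "poly (map_poly \<phi> p) y = poly (map_poly \<phi> (p div ?q * ?q + s)) y" by simp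
  then have sy: "poly (map_poly \<phi> s) y = 0" using assms qy by (simp add: hom_distribs)
  have ds: "s = 0 \<or> degree s < m" using degree_mod_less[OF qnz, of p] dq by (auto simp: s_def)
  then have "degree s \<le> m - 1" using m_pos by auto
  from poly_map_altdef[OF this, of y] sy have "(\<Sum>i\<le>m - 1. \<phi> (coeff s i) * y ^ i) = 0" by simp
  moreover have "{..m - 1} = {..<m}" using m_pos by auto
  ultimately have "\<forall>i<m. coeff s i = 0" using indep[of "coeff s"] by simp
  then have "s = 0" using ds by (metis leading_coeff_0_iff)
  then show ?thesis by (simp add: s_def dvd_eq_mod_eq_0)
qed

definition emb :: "'a poly fract \<Rightarrow> 'b alg_closure" where
  "emb h = to_ac (\<phi> h)"

lemma emb_hom: "field_hom emb"
  by unfold_locales (simp_all add: emb_def hom_distribs)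

text \<open>The embedding of the function field into its algebraic closure that fixes K(x) and sends
  \<open>y\<close> to \<open>\<zeta> * y\<close>. The choice of a polynomial representing
  \<open>z\<close> is immaterial when \<open>\<zeta> ^ m = 1\<close>, by
  \<open>conj_eq\<close>.\<close>

definition conj :: "'b alg_closure \<Rightarrow> 'b \<Rightarrow> 'b alg_closure" where
  "conj \<zeta> z = poly (map_poly emb (SOME p. z = poly (map_poly \<phi> p) y)) (\<zeta> * to_ac y)"

context
  fixes \<zeta> :: "'b alg_closure" assumes \<zeta>: "\<zeta> ^ m = 1"
begin

text \<open>Two polynomials representing \<open>z\<close> differ by a multiple of X^m - F, and
  \<open>\<zeta> * to_ac y\<close> is again a root of X^m - F.\<close>

lemma conj_eq:
  assumes "z = poly (map_poly \<phi> p) y"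
  shows "conj \<zeta> z = poly (map_poly emb p) (\<zeta> * to_ac y)"
proof -
  interpret emb: field_hom emb by (rule emb_hom)
  interpret mp: map_poly_inj_idom_hom \<phi> ..
  interpret me: map_poly_inj_idom_hom emb ..
  define q where "q = (SOME p. z = poly (map_poly \<phi> p) y)"
  have "z = poly (map_poly \<phi> q) y" unfolding q_def using assms by (rule someI)
  then have "poly (map_poly \<phi> (q - p)) y = 0" using assms by (simp add: hom_distribs)
  then obtain s where s: "q - p = (monom 1 m - [:F:]) * s"
    using poly_root_imp_dvd by (blast elim: dvdE)
  have "(\<zeta> * to_ac y) ^ m = emb F"
    using \<zeta> by (simp add: power_mult_distrib emb_def flip: y_pow_m)
  then have "poly (map_poly emb (q - p)) (\<zeta> * to_ac y) = 0"
    unfolding s by (simp add: hom_distribs poly_monom)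
  then show ?thesis by (simp add: conj_def hom_distribs flip: q_def)
qed

lemma conj_sum: "conj \<zeta> (\<Sum>i<m. \<phi> (h i) * y ^ i) = (\<Sum>i<m. emb (h i) * (\<zeta> * to_ac y) ^ i)"
proof -
  interpret emb: field_hom emb by (rule emb_hom)
  interpret mp: map_poly_inj_idom_hom \<phi> ..
  interpret me: map_poly_inj_idom_hom emb ..
  have "(\<Sum>i<m. \<phi> (h i) * y ^ i) = poly (map_poly \<phi> (\<Sum>i<m. monom (h i) i)) y"
    by (simp add: hom_distribs poly_sum poly_monom)
  from conj_eq[OF this] show ?thesis by (simp add: hom_distribs poly_sum poly_monom)
qed

lemma conj_\<phi>: "conj \<zeta> (\<phi> h) = emb h"
proof -
  interpret emb: field_hom emb by (rule emb_hom)
  have "\<phi> h = poly (map_poly \<phi> [:h:]) y" by (simp add: hom_distribs)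
  from conj_eq[OF this] show ?thesis by (simp add: hom_distribs)
qed

lemma conj_hom: "field_hom (conj \<zeta>)"
proof -
  interpret emb: field_hom emb by (rule emb_hom)
  interpret mp: map_poly_inj_idom_hom \<phi> ..
  interpret me: map_poly_inj_idom_hom emb ..
  have ex: "\<exists>p. z = poly (map_poly \<phi> p) y" for z using T_UNIV unfolding T_def by blast
  show ?thesis
  proof
    show "conj \<zeta> 0 = 0" "conj \<zeta> 1 = 1" using conj_\<phi>[of 0] conj_\<phi>[of 1] by simp_all
    fix a b
    obtain p q where pq: "a = poly (map_poly \<phi> p) y" "b = poly (map_poly \<phi> q) y" using ex by blast
    then have "a + b = poly (map_poly \<phi> (p + q)) y" "a * b = poly (map_poly \<phi> (p * q)) y"
      by (simp_all add: hom_distribs)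
    note this[THEN conj_eq]
    then show "conj \<zeta> (a + b) = conj \<zeta> a + conj \<zeta> b" "conj \<zeta> (a * b) = conj \<zeta> a * conj \<zeta> b"
      using pq[THEN conj_eq] by (simp_all add: hom_distribs)
  qed
qed

end

text \<open>
  If the term \<open>h\<^sub>l y\<^sup>l\<close> of \<open>z\<close> has a pole over \<open>R\<close>, then so has some conjugate of \<open>z\<close>, because
  \<open>m h\<^sub>l y\<^sup>l\<close> is a sum of conjugates weighted by roots of unity; pulling back the place along the
  conjugation gives a place over \<open>R\<close> at which \<open>z\<close> itself has a pole.
\<close>

lemma place_at_term_pole:
  assumes char: "\<not> CHAR('a) dvd m" and R: "is_place rat_const R" and l: "l < m"
    and pole: "h l ^ m * F ^ l \<notin> place_ring R"
    and z: "z = (\<Sum>i<m. \<phi> (h i) * y ^ i)"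
  obtains Q where "is_place (\<phi> \<circ> rat_const) Q" "\<phi> ` place_ring R \<subseteq> place_ring Q" "z \<notin> place_ring Q"
proof -
  interpret emb: field_hom emb by (rule emb_hom)
  obtain VR: "valuation_subring (place_ring R)" and cR: "range rat_const \<subset> place_ring R"
    by (rule is_placeE[OF R])
  interpret VR: valuation_subring "place_ring R" by fact
  define g where "g = h l ^ m * F ^ l"
  have g: "g \<notin> place_ring R" "inverse g \<in> place_ring R"
    using pole VR.notin_R_imp[of g] VR.M_sub by (auto simp only: g_def)
  \<comment> \<open>\<open>emb g\<close> is the m-th power of the term \<open>t l\<close> below, so
    a valuation ring over that of \<open>R\<close> which excludes \<open>emb g\<close> also excludes
    the term.\<close>
  obtain B where B: "valuation_subring B" "emb ` place_ring R \<subseteq> B" "emb g \<notin> B"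
  proof (rule valuation_subring_avoiding[of "emb ` place_ring R" "emb g"])
    fix a b assume "a \<in> emb ` place_ring R" "b \<in> emb ` place_ring R"
    then obtain a' b' where "a = emb a'" "b = emb b'" "a' \<in> place_ring R" "b' \<in> place_ring R" by blast
    then show "a + b \<in> emb ` place_ring R \<and> a - b \<in> emb ` place_ring R \<and> a * b \<in> emb ` place_ring R"
      using VR.R_add VR.R_diff VR.R_mult by (auto simp flip: emb.hom_add emb.hom_minus emb.hom_mult)
  next
    show "1 \<in> emb ` place_ring R" using VR.R_1 by (metis emb.hom_one image_eqI)
    show "inverse (emb g) \<in> emb ` place_ring R" using g by (simp flip: emb.hom_inverse)
    show "emb g \<notin> emb ` place_ring R" using g by auto
  qed
  interpret B: valuation_subring B by fact
  define U where "U = {\<zeta> :: 'b alg_closure. \<zeta> ^ m = 1}"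
  have "(of_nat m :: 'a) \<noteq> 0" using char by (simp add: of_nat_eq_0_iff_char_dvd)
  moreover have mE: "of_nat m = emb (rat_const (of_nat m))" by (simp add: hom_distribs rat_const.hom_of_nat emb.hom_of_nat)
  ultimately have mnz: "(of_nat m :: 'b alg_closure) \<noteq> 0" by simp
  note U = card_roots_of_unity[OF m_pos mnz, folded U_def]
  define t where "t i = emb (h i) * to_ac y ^ i" for i
  have "t l ^ m = emb g"
    using y_pow_m by (simp add: t_def g_def emb_def power_mult_distrib hom_distribs flip: power_mult to_ac_power)
      (metis mult.commute power_mult to_ac_power)
  then have tl: "t l \<notin> B" using B.R_power B(3) by metis
  have "\<exists>\<zeta>\<in>U. conj \<zeta> z \<notin> B"
  proof (rule ccontr)
    assume neg: "\<not> ?thesis"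
    \<comment> \<open>The weight \<open>\<zeta> ^ (m - l)\<close> stands for the inverse of
      \<open>\<zeta> ^ l\<close>: summed over all roots of unity, it isolates the term with index
      \<open>l\<close>.\<close>
    have "(\<Sum>\<zeta>\<in>U. \<zeta> ^ (m - l) * conj \<zeta> z) = (\<Sum>\<zeta>\<in>U. \<Sum>i<m. t i * \<zeta> ^ (m - l + i))"
    proof (rule sum.cong)
      fix \<zeta> assume "\<zeta> \<in> U"
      then have "conj \<zeta> z = (\<Sum>i<m. emb (h i) * (\<zeta> * to_ac y) ^ i)" unfolding z by (intro conj_sum) (simp add: U_def)
      then show "\<zeta> ^ (m - l) * conj \<zeta> z = (\<Sum>i<m. t i * \<zeta> ^ (m - l + i))"
        by (simp add: sum_distrib_left t_def power_mult_distrib power_add mult_ac)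
    qed simp
    also have "\<dots> = (\<Sum>i<m. t i * (\<Sum>\<zeta>\<in>U. \<zeta> ^ (m - l + i)))"
      by (subst sum.swap) (simp add: sum_distrib_left)
    also have "\<dots> = (\<Sum>i<m. if i = l then t l * of_nat m else 0)"
    proof (rule sum.cong)
      fix i assume i: "i \<in> {..<m}"
      have red: "(\<Sum>\<zeta>\<in>U. \<zeta> ^ (k + m)) = (\<Sum>\<zeta>\<in>U. \<zeta> ^ k)" for k
        by (rule sum.cong) (auto simp: U_def power_add)
      consider "i = l" | "i < l" | "l < i" by linarith
      then show "t i * (\<Sum>\<zeta>\<in>U. \<zeta> ^ (m - l + i)) = (if i = l then t l * of_nat m else 0)"
      proof cases
        case 1
        then show ?thesis using red[of 0] l U by simp
      next
        case 2
        then have "(\<Sum>\<zeta>\<in>U. \<zeta> ^ (m - l + i)) = 0"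
          unfolding U_def using l by (intro sum_roots_of_unity m_pos mnz) simp_all
        then show ?thesis using 2 by simp
      next
        case 3
        have "m - l + i = (i - l) + m" using 3 l by simp
        moreover have "(\<Sum>\<zeta>\<in>U. \<zeta> ^ (i - l)) = 0"
          unfolding U_def using 3 l i by (intro sum_roots_of_unity m_pos mnz) simp_all
        ultimately show ?thesis using 3 red[of "i - l"] by simp
      qed
    qed simp
    also have "\<dots> = t l * of_nat m" using l by simp
    finally have eq: "(\<Sum>\<zeta>\<in>U. \<zeta> ^ (m - l) * conj \<zeta> z) = t l * of_nat m" .
    have "(\<Sum>\<zeta>\<in>U. \<zeta> ^ (m - l) * conj \<zeta> z) \<in> B"
    proof (rule B.R_sum)
      fix \<zeta> assume \<zeta>: "\<zeta> \<in> U"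
      then have "\<zeta> \<in> B" using B.R_root[of \<zeta> m] B.R_1 m_pos by (simp add: U_def)
      then show "\<zeta> ^ (m - l) * conj \<zeta> z \<in> B" using neg \<zeta> by (intro B.R_mult B.R_power) auto
    qed
    moreover have "emb (rat_const (inverse (of_nat m))) \<in> B" using B(2) cR by blast
    ultimately have "t l * of_nat m * emb (rat_const (inverse (of_nat m))) \<in> B"
      unfolding eq by (rule B.R_mult)
    also have "t l * of_nat m * emb (rat_const (inverse (of_nat m))) = t l"
      using mnz mE by (simp add: rat_const.hom_inverse emb.hom_inverse)
    finally show False using tl by simp
  qed
  then obtain \<zeta> where \<zeta>: "\<zeta> ^ m = 1" "conj \<zeta> z \<notin> B" unfolding U_def by blast
  interpret conj: field_hom "conj \<zeta>" by (rule conj_hom[OF \<zeta>(1)])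
  \<comment> \<open>Pulling \<open>B\<close> back along the conjugation gives a valuation ring of
    the function field itself; it still lies over \<open>R\<close> because
    \<open>conj \<zeta>\<close> agrees with \<open>emb\<close> on K(x).\<close>
  define A where "A = {x. conj \<zeta> x \<in> B}"
  interpret A: valuation_subring A
  proof
    show "\<And>a b. a \<in> A \<Longrightarrow> b \<in> A \<Longrightarrow> a + b \<in> A" "\<And>a b. a \<in> A \<Longrightarrow> b \<in> A \<Longrightarrow> a - b \<in> A"
      "\<And>a b. a \<in> A \<Longrightarrow> b \<in> A \<Longrightarrow> a * b \<in> A"
      by (simp_all add: A_def conj.hom_add conj.hom_minus conj.hom_mult B.R_add B.R_diff B.R_mult)
    fix x :: 'b assume "x \<noteq> 0"
    then show "x \<in> A \<or> inverse x \<in> A"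
      using B.R_total[of "conj \<zeta> x"] by (simp add: A_def conj.hom_inverse)
  qed
  have RA: "\<phi> ` place_ring R \<subseteq> A" using B(2) by (auto simp: A_def conj_\<phi>[OF \<zeta>(1)])
  have zA: "z \<notin> A" using \<zeta> by (simp add: A_def)
  have "range (\<phi> \<circ> rat_const) \<subset> A"
  proof -
    have "\<phi> ` range rat_const \<subset> \<phi> ` place_ring R"
      using cR inj_image_subset_iff[OF inj_onI[of UNIV \<phi>]] by (metis (no_types, lifting) eq_iff image_is_empty inj_image_eq_iff inj_def psubset_eq)
    then show ?thesis using RA by (auto simp: image_comp)
  qed
  then have "is_place (\<phi> \<circ> rat_const) A.M" using zA by (intro is_placeI A.valuation_subring_axioms) auto
  moreover have "place_ring A.M = A" by (rule place_ring_M[OF A.valuation_subring_axioms])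
  ultimately show thesis using that[of A.M] RA zA by simp
qed

end

section \<open>Riemann-Roch spaces over a finite field\<close>

lemma card_finite_subspace:
  fixes \<iota> :: "'k::{field,finite} \<Rightarrow> 'f::field"
  assumes \<iota>: "field_hom \<iota>" and fin: "finite V"
    and V: "0 \<in> V" "\<And>a b. a \<in> V \<Longrightarrow> b \<in> V \<Longrightarrow> a + b \<in> V" "\<And>c a. a \<in> V \<Longrightarrow> \<iota> c * a \<in> V"
  shows "card V = CARD('k) ^ vector_space.dim (\<lambda>c z. \<iota> c * z) V"
proof -
  interpret field_hom \<iota> by fact
  interpret VS: vector_space "\<lambda>c z. \<iota> c * z"
    by unfold_locales (simp_all add: algebra_simps hom_distribs)
  obtain B where B: "B \<subseteq> V" "VS.independent B" "V \<subseteq> VS.span B" "card B = VS.dim V"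
    by (rule VS.basis_exists)
  have finB: "finite B" using B(1) fin finite_subset by blast
  have "VS.subspace V" using V by (intro VS.subspaceI) auto
  then have spB: "VS.span B = V" using B(1,3) VS.span_minimal by blast
  define S where "S u = (\<Sum>v\<in>B. \<iota> (u v) * v)" for u
  have "S ` (B \<rightarrow>\<^sub>E UNIV) = V"
  proof -
    have "V = range S" using VS.span_finite[OF finB] spB by (simp add: S_def)
    moreover have "S u = S (restrict u B)" for u unfolding S_def by (rule sum.cong) simp_all
    ultimately show ?thesis by (auto simp: image_iff) (metis PiE_restrict restrict_PiE_iff UNIV_I)
  qed
  moreover have "inj_on S (B \<rightarrow>\<^sub>E UNIV)"
  proof (rule inj_onI)
    fix u u' assume u: "u \<in> B \<rightarrow>\<^sub>E UNIV" "u' \<in> B \<rightarrow>\<^sub>E UNIV" "S u = S u'"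
    have s0: "(\<Sum>v\<in>B. \<iota> (u v - u' v) * v) = 0"
      using u(3) by (simp add: S_def hom_distribs left_diff_distrib sum_subtractf)
    have "\<forall>v\<in>B. u v - u' v = 0"
    proof (rule ccontr)
      assume "\<not> ?thesis"
      then have "VS.dependent B"
        unfolding VS.dependent_finite[OF finB] using s0 by (intro exI[of _ "\<lambda>v. u v - u' v"]) simp
      then show False using B(2) by simp
    qed
    then show "u = u'" using u by (intro PiE_ext[OF u(1,2)]) simp
  qed
  ultimately have "card V = card (B \<rightarrow>\<^sub>E (UNIV :: 'k set))" by (metis card_image)
  then show ?thesis using B(4) finB by (simp add: card_PiE)
qed

text \<open>The zero polynomial has degree 0 and is listed apart, so that for negative
  \<open>s\<close> the set is {0}, in agreement with \<open>nat (s + 1) = 0\<close>.\<close>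

lemma card_polys_degree_le:
  fixes s :: int
  defines "S \<equiv> {p :: 'k::{field,finite} poly. p = 0 \<or> int (degree p) \<le> s}"
  shows "finite S" "card S = CARD('k) ^ nat (s + 1)"
proof -
  let ?I = "{..<nat (s + 1)}"
  let ?g = "\<lambda>p :: 'k poly. restrict (coeff p) ?I"
  have z: "coeff p i = 0" if "p \<in> S" "i \<notin> ?I" for p i
    using that by (cases "p = 0") (auto simp: S_def intro: coeff_eq_0)
  have "bij_betw ?g S (?I \<rightarrow>\<^sub>E UNIV)"
  proof (rule bij_betwI[of _ _ _ "\<lambda>c. \<Sum>i\<in>?I. monom (c i) i"])
    show "?g \<in> S \<rightarrow> (?I \<rightarrow>\<^sub>E UNIV)" by auto
    have cf: "coeff (\<Sum>i\<in>?I. monom (c i) i) j = (if j \<in> ?I then c j else 0)" for c :: "nat \<Rightarrow> 'k" and j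
      by (simp add: coeff_sum)
    show "(\<lambda>c. \<Sum>i\<in>?I. monom (c i) i) \<in> (?I \<rightarrow>\<^sub>E UNIV) \<rightarrow> S"
    proof
      fix c :: "nat \<Rightarrow> 'k"
      let ?p = "\<Sum>i\<in>?I. monom (c i) i"
      have "degree ?p \<in> ?I" if "?p \<noteq> 0"
        using that cf[of c "degree ?p"] leading_coeff_neq_0[OF that] by metis
      then show "?p \<in> S" by (cases "?p = 0") (auto simp: S_def)
    qed
    show "(\<Sum>i\<in>?I. monom (?g p i) i) = p" if "p \<in> S" for p
      using z[OF that] by (intro poly_eqI) (simp add: cf)
    show "?g (\<Sum>i\<in>?I. monom (c i) i) = c" if "c \<in> ?I \<rightarrow>\<^sub>E UNIV" for c
      using that by (intro ext) (auto simp: cf PiE_def extensional_def)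
  qed
  then show "finite S" "card S = CARD('k) ^ nat (s + 1)"
    using bij_betw_finite[of ?g S] bij_betw_same_card[of ?g S] by (simp_all add: card_PiE finite_PiE)
qed

text \<open>\<open>rational_place_fraction\<close> describes the ring of \<open>R\<close> by
  fractions whose denominator does not vanish at \<open>u = 0\<close>; these are regular at
  \<open>R'\<close> too, and an inclusion of discrete valuation rings is an equality.\<close>

lemma rat_place_eq:
  assumes "gen u" "is_place rat_const R" "u \<in> R" "is_place rat_const R'" "u \<in> R'"
  shows "R = R'"
proof (rule place_eq_if_ring_subset[OF rat_place_discrete[OF assms(4)] rat_place_discrete[OF assms(2)]])
  interpret R': discrete_valuation "place_val R'"
    using discrete_placeD[OF rat_place_discrete[OF assms(4)]] by blast
  note inR' = discrete_placeD(2,3)[OF rat_place_discrete[OF assms(4)]]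
  show "place_ring R \<subseteq> place_ring R'"
  proof
    fix z assume "z \<in> place_ring R"
    then obtain a b where ab: "coeff b 0 \<noteq> 0" "z = ev u a / ev u b"
      by (rule rational_place_fraction[OF assms(2,1,3)])
    note b = ev_unit_coeff_0[OF assms(4,5) ab(1)]
    have "u \<in> place_ring R'" using assms(5) by (auto simp: inR')
    then have "R'.val_ge 0 (ev u a)" by (rule ev_val_ge_0[OF assms(4)])
    then show "z \<in> place_ring R'"
      using b ab(2) by (cases "ev u a = 0") (auto simp: inR' R'.val_ge_def R'.val_divide)
  qed
qed

section \<open>The curve with its totally ramified places, and Riemann-Roch spaces described term by
  term\<close>

locale kummer_curve = kummer_extension m f \<phi> y
  for m :: nat and f :: "'k::{field,finite} poly" and \<phi> :: "'k poly fract \<Rightarrow> 'f::field" and y :: 'f +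
  fixes n r :: nat and P :: "nat \<Rightarrow> 'k poly fract set" and Q :: "nat \<Rightarrow> 'f set" and lam :: "nat \<Rightarrow> int"
  assumes char: "\<not> CHAR('k) dvd m"
    and split: "\<forall>z :: 'k alg_closure. poly (map_poly to_ac f) z = 0 \<longrightarrow> z \<in> range to_ac"
    and nopow: "\<forall>d\<ge>2. d dvd m \<longrightarrow> (\<nexists>h. h ^ d = to_fract f)"
    and P_bij: "bij_betw P {1..r} {R. is_place rat_const R \<and> place_val R (to_fract f) \<noteq> 0}"
    and lam_eq: "lam k = place_val (P k) (to_fract f)"
    and n_bounds: "1 \<le> n" "n \<le> r"
    and tot: "k \<in> {1..n} \<Longrightarrow> totally_ramified \<phi> (P k) (Q k)"
    and Q_inj: "inj_on Q {1..n}"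
begin

abbreviation \<iota> where "\<iota> \<equiv> \<phi> \<circ> rat_const"

abbreviation d where "d D k \<equiv> Poly_Mapping.lookup D (Q k)"

lemma \<iota>_hom: "field_hom \<iota>"
  by unfold_locales (simp_all add: hom_distribs rat_const.hom_add rat_const.hom_mult)

lemma F_nz: "F \<noteq> 0"
  using f_nz by simp

lemma P_place: "k \<in> {1..r} \<Longrightarrow> is_place rat_const (P k)"
  and lam_nz: "k \<in> {1..r} \<Longrightarrow> lam k \<noteq> 0"
  using bij_betwE[OF P_bij] by (auto simp: lam_eq)

lemma P_inj: "inj_on P {1..r}"
  using P_bij by (simp add: bij_betw_def)

lemma val_F_other: "is_place rat_const R \<Longrightarrow> R \<notin> P ` {1..r} \<Longrightarrow> place_val R F = 0"
  using P_bij by (auto simp: bij_betw_def)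

lemma P_gen:
  assumes "k \<in> {1..r}"
  obtains u where "gen u" "u \<in> P k"
  using split_place_gen[OF f_nz split P_place[OF assms]] lam_nz[OF assms] by (metis lam_eq)

lemma le_r: "k \<in> {1..n} \<Longrightarrow> k \<in> {1..r}"
  using n_bounds by auto

lemma tr: "k \<in> {1..n} \<Longrightarrow> totally_ramified_place m f \<phi> y (P k) (Q k)"
  by unfold_locales (rule tot)

lemma lam_coprime: "k \<in> {1..n} \<Longrightarrow> coprime (lam k) (int m)"
  using totally_ramified_place.coprime_val[OF tr char nopow] by (simp add: lam_eq)

lemma ext_degree_eq: "ext_degree \<phi> = m"
  using totally_ramified_place.val_y_ext_degree(1)[OF tr] lam_coprime n_bounds by (metis atLeastAtMost_iff lam_eq order_refl)

lemma Q_place: "k \<in> {1..n} \<Longrightarrow> is_place \<iota> (Q k)"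
  and Q_unique: "k \<in> {1..n} \<Longrightarrow> is_place \<iota> Q' \<Longrightarrow> lies_over \<phi> Q' (P k) \<Longrightarrow> Q' = Q k"
  using tot unfolding totally_ramified_def by auto

lemma Q_val: "k \<in> {1..n} \<Longrightarrow> h \<noteq> 0 \<Longrightarrow> place_val (Q k) (\<phi> h) = int m * place_val (P k) h"
  using totally_ramified_place.val_Q[OF tr] by (simp add: ext_degree_eq)

lemma Q_val_y: "k \<in> {1..n} \<Longrightarrow> place_val (Q k) y = lam k"
  using totally_ramified_place.val_y_ext_degree(2)[OF tr] lam_coprime by (simp add: lam_eq)

lemma P_residue:
  assumes k: "k \<in> {1..r}" and h: "h \<in> place_ring (P k)"
  shows "\<exists>c. h - rat_const c \<in> P k"
proof -
  obtain u where "gen u" "u \<in> P k" by (rule P_gen[OF k])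
  then show ?thesis using rational_place_residue[OF P_place[OF k]] h by blast
qed

lemma Q_residue:
  assumes "k \<in> {1..n}" "z \<in> place_ring (Q k)"
  shows "\<exists>c. z - \<iota> c \<in> Q k"
  using totally_ramified_place.residue_const[OF tr[OF assms(1)] P_residue[OF le_r[OF assms(1)]] assms(2)]
  by simp

lemma disc: "is_place \<iota> Q' \<Longrightarrow> discrete_valuation (place_val Q')"
  using discrete_placeD(1)[OF place_discrete] .

lemma disc_P: "is_place rat_const R \<Longrightarrow> discrete_valuation (place_val R)"
  using discrete_placeD(1)[OF rat_place_discrete] .

lemma Q_val_term:
  assumes "k \<in> {1..n}" "h \<noteq> 0"
  shows "place_val (Q k) (\<phi> h * y ^ i) = int m * place_val (P k) h + int i * lam k"
proof -
  interpret discrete_valuation "place_val (Q k)" using disc[OF Q_place[OF assms(1)]] .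
  show ?thesis using assms y_nz by (simp add: val_mult val_power Q_val Q_val_y)
qed

text \<open>Modulo \<open>m\<close> the equation reads \<open>i * lam k = j * lam k\<close>, and
  \<open>lam k\<close> is invertible.\<close>

lemma term_val_inj:
  assumes k: "k \<in> {1..n}" and ij: "i < m" "j < m"
    and eq: "int m * a + int i * lam k = int m * b + int j * lam k"
  shows "i = j"
proof -
  have "(int i - int j) * lam k = int m * (b - a)" using eq by (simp add: algebra_simps)
  then have "int m dvd (int i - int j) * lam k" by simp
  then have "int m dvd int i - int j"
    using lam_coprime[OF k] by (simp add: coprime_dvd_mult_left_iff coprime_commute)
  then have "int i mod int m = int j mod int m" by (simp add: mod_eq_dvd_iff)
  then show ?thesis using ij by simp
qed

lemma Q_terms_distinct:
  assumes "k \<in> {1..n}" "i \<in> {..<m}" "j \<in> {..<m}" "\<phi> (h i) * y ^ i \<noteq> 0" "\<phi> (h j) * y ^ j \<noteq> 0"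
    "place_val (Q k) (\<phi> (h i) * y ^ i) = place_val (Q k) (\<phi> (h j) * y ^ j)"
  shows "i = j"
proof -
  have "h i \<noteq> 0" "h j \<noteq> 0" using assms by auto
  then show ?thesis
    using assms(6) Q_val_term[OF assms(1)] term_val_inj[OF assms(1)] assms(2,3) by simp
qed

sublocale kummer_basis m f \<phi> y
proof
  fix h assume s0: "(\<Sum>i<m. \<phi> (h i) * y ^ i) = 0"
  have 1: "1 \<in> {1..n}" using n_bounds by simp
  interpret discrete_valuation "place_val (Q 1)" using disc[OF Q_place[OF 1]] .
  have "\<forall>i\<in>{..<m}. \<phi> (h i) * y ^ i = 0"
    using val_sum_distinct[of "{..<m}" "\<lambda>i. \<phi> (h i) * y ^ i"] Q_terms_distinct[OF 1] s0 by blast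
  then show "\<forall>i<m. h i = 0" using y_nz by simp
qed

text \<open>The local conditions for \<open>\<phi> h * y ^ i\<close> to lie in the Riemann-Roch
  space of \<open>D\<close>, expressed on K(x). Away from the \<open>P k\<close> with
  \<open>k \<le> n\<close> the inequality is the one for \<open>h ^ m * F ^ i\<close>, which avoids
  the value of \<open>y\<close> at places of unknown ramification.\<close>

definition term_ok :: "('f set \<Rightarrow>\<^sub>0 int) \<Rightarrow> nat \<Rightarrow> 'k poly fract \<Rightarrow> bool" where
  "term_ok D i h \<longleftrightarrow> h = 0 \<or>
     (\<forall>k\<in>{1..n}. - d D k \<le> int m * place_val (P k) h + int i * lam k) \<and>
     (\<forall>R. is_place rat_const R \<longrightarrow> R \<notin> P ` {1..n} \<longrightarrow> 0 \<le> int m * place_val R h + int i * place_val R F)"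

text \<open>A place other than the \<open>Q k\<close> lies over none of the totally ramified
  \<open>P k\<close>. There \<open>m\<close> times the value of the term is the ramification index
  times the quantity bounded in \<open>term_ok\<close>.\<close>

lemma term_ok_imp_ge:
  assumes D: "Poly_Mapping.keys D \<subseteq> Q ` {1..n}" and ok: "term_ok D i h" "h \<noteq> 0"
    and Q': "is_place \<iota> Q'"
  shows "- Poly_Mapping.lookup D Q' \<le> place_val Q' (\<phi> h * y ^ i)"
proof (cases "Q' \<in> Q ` {1..n}")
  case True
  then show ?thesis using ok Q_val_term by (auto simp: term_ok_def)
next
  case False
  interpret discrete_valuation "place_val Q'" using disc[OF Q'] .
  have L0: "Poly_Mapping.lookup D Q' = 0" using D False by (auto simp: in_keys_iff)
  define R where "R = {h. \<phi> h \<in> Q'}"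
  have R: "is_place rat_const R" "lies_over \<phi> Q' R"
    using place_below[OF Q'] by (simp_all add: R_def)
  have nR: "R \<notin> P ` {1..n}" using Q_unique[OF _ Q'] R(2) False by blast
  define e where "e = ram_index \<phi> Q' R"
  have val: "place_val Q' (\<phi> z) = int e * place_val R z" if "z \<noteq> 0" for z
    unfolding e_def by (rule ram_index_eq[OF field_hom_axioms rat_place_discrete[OF R(1)] place_discrete[OF Q'] R(2) that])
  have "int m * place_val Q' y = int e * place_val R F"
    using val_power[OF y_nz, of m] val[OF F_nz] by (simp add: y_pow_m)
  then have "int m * place_val Q' (\<phi> h * y ^ i) = int e * (int m * place_val R h + int i * place_val R F)"
    using ok y_nz by (simp add: val_mult val_power val algebra_simps)
  moreover have "0 \<le> int m * place_val R h + int i * place_val R F"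
    using ok nR R(1) by (auto simp: term_ok_def)
  ultimately have "0 \<le> int m * place_val Q' (\<phi> h * y ^ i)" by simp
  then show ?thesis using m_pos L0 by (simp add: zero_le_mult_iff)
qed

lemma rr_space_iff_val_ge:
  "z \<in> rr_space \<iota> D \<longleftrightarrow>
    (\<forall>Q'. is_place \<iota> Q' \<longrightarrow> discrete_valuation.val_ge (place_val Q') (- Poly_Mapping.lookup D Q') z)"
  if "\<exists>Q'. is_place \<iota> Q'"
  using that disc discrete_valuation.val_ge_def by (auto simp: rr_space_def)

lemma ex_place: "\<exists>Q'. is_place \<iota> Q'"
  using Q_place[of 1] n_bounds by auto

lemmas rr_space_iff = rr_space_iff_val_ge[OF ex_place]

text \<open>At \<open>Q k\<close> the terms have different values and cannot cancel. Over any other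
  \<open>R\<close> a term with a pole produces a pole of the sum at some \<open>Q'\<close> over
  \<open>R\<close>; as \<open>D\<close> is supported on the \<open>Q k\<close>, that
  \<open>Q'\<close> would be one of them and \<open>R\<close> would be \<open>P k\<close>.\<close>

lemma rr_space_iff_terms:
  assumes D: "Poly_Mapping.keys D \<subseteq> Q ` {1..n}"
  shows "(\<Sum>i<m. \<phi> (h i) * y ^ i) \<in> rr_space \<iota> D \<longleftrightarrow> (\<forall>i<m. term_ok D i (h i))"
proof
  assume ok: "\<forall>i<m. term_ok D i (h i)"
  show "(\<Sum>i<m. \<phi> (h i) * y ^ i) \<in> rr_space \<iota> D"
    unfolding rr_space_iff
  proof (intro allI impI)
    fix Q' assume Q': "is_place \<iota> Q'"
    interpret discrete_valuation "place_val Q'" using disc[OF Q'] .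
    show "val_ge (- Poly_Mapping.lookup D Q') (\<Sum>i<m. \<phi> (h i) * y ^ i)"
    proof (rule val_ge_sum)
      fix i assume "i \<in> {..<m}"
      then show "val_ge (- Poly_Mapping.lookup D Q') (\<phi> (h i) * y ^ i)"
        using ok term_ok_imp_ge[OF D _ _ Q', of i "h i"] by (cases "h i = 0") (auto simp: val_ge_def)
    qed
  qed
next
  let ?z = "\<Sum>i<m. \<phi> (h i) * y ^ i"
  assume z: "?z \<in> rr_space \<iota> D"
  show "\<forall>i<m. term_ok D i (h i)"
  proof (intro allI impI)
    fix i assume i: "i < m"
    show "term_ok D i (h i)"
    proof (cases "h i = 0")
      case False
      have "- d D k \<le> int m * place_val (P k) (h i) + int i * lam k" if k: "k \<in> {1..n}" for k
      proof -
        interpret discrete_valuation "place_val (Q k)" using disc[OF Q_place[OF k]] .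
        have "val_ge (- d D k) ?z" using z Q_place[OF k] by (simp add: rr_space_iff)
        then have "\<forall>i\<in>{..<m}. val_ge (- d D k) (\<phi> (h i) * y ^ i)"
          by (subst (asm) val_ge_sum_distinct_iff) (use Q_terms_distinct[OF k] in blast)+
        then have "val_ge (- d D k) (\<phi> (h i) * y ^ i)" using i by simp
        then show ?thesis using False y_nz Q_val_term[OF k False] by (simp add: val_ge_def)
      qed
      moreover have "0 \<le> int m * place_val R (h i) + int i * place_val R F"
        if R: "is_place rat_const R" "R \<notin> P ` {1..n}" for R
      proof (rule ccontr)
        assume neg: "\<not> ?thesis"
        interpret R: discrete_valuation "place_val R" using disc_P[OF R(1)] .
        have "place_val R (h i ^ m * F ^ i) < 0"
          using neg False F_nz by (simp add: R.val_mult R.val_power)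
        then have "h i ^ m * F ^ i \<notin> place_ring R"
          using False F_nz by (auto simp: discrete_placeD(3)[OF rat_place_discrete[OF R(1)]])
        then obtain Q' where Q': "is_place \<iota> Q'" "\<phi> ` place_ring R \<subseteq> place_ring Q'" "?z \<notin> place_ring Q'"
          using place_at_term_pole[OF char R(1) i] by metis
        have "?z \<noteq> 0" "place_val Q' ?z < 0"
          using Q'(3) discrete_placeD(3)[OF place_discrete[OF Q'(1)]] by auto
        then have "Poly_Mapping.lookup D Q' \<noteq> 0" using z Q'(1) by (auto simp: rr_space_def)
        then have "Q' \<in> Q ` {1..n}" using D by (auto simp: in_keys_iff)
        then obtain k where k: "k \<in> {1..n}" "Q' = Q k" by blast
        have "place_ring R \<subseteq> place_ring (P k)"
        proof
          fix a assume a: "a \<in> place_ring R"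
          then have "\<phi> a \<in> place_ring (Q k)" using Q'(2) k by blast
          then show "a \<in> place_ring (P k)"
            using Q_val[OF k(1), of a] m_pos
            by (cases "a = 0") (auto simp: zero_le_mult_iff
                discrete_placeD(3)[OF place_discrete[OF Q_place[OF k(1)]]]
                discrete_placeD(3)[OF rat_place_discrete[OF P_place[OF le_r[OF k(1)]]]])
        qed
        then have "R = P k"
          by (intro place_eq_if_ring_subset rat_place_discrete P_place le_r R k)
        then show False using R(2) k by blast
      qed
      ultimately show ?thesis by (auto simp: term_ok_def)
    qed (simp add: term_ok_def)
  qed
qed

end

text \<open>\<open>- (x div m)\<close> is the ceiling of -x/m.\<close>

lemma neg_le_mult_iff_div:
  fixes x v :: int
  assumes "0 < m"
  shows "- x \<le> m * v \<longleftrightarrow> - (x div m) \<le> v"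
proof -
  have *: "x = m * (x div m) + x mod m" "0 \<le> x mod m" "x mod m < m" using assms by simp_all
  show ?thesis
  proof
    assume le: "- x \<le> m * v"
    show "- (x div m) \<le> v"
    proof (rule ccontr)
      assume "\<not> - (x div m) \<le> v"
      then have "v + 1 + x div m \<le> 0" by simp
      then have "m * (v + 1 + x div m) \<le> 0" using assms by (simp add: mult_le_0_iff)
      then show False using le * by (simp add: distrib_left)
    qed
  next
    assume "- (x div m) \<le> v"
    then have "m * (- (x div m)) \<le> m * v" using assms by (intro mult_left_mono) auto
    moreover have "m * (- (x div m)) = - (m * (x div m))" by simp
    ultimately show "- x \<le> m * v" using * by linarith
  qed
qed

section \<open>The rational function field with \<open>P 1\<close> at infinity, and the dimension
  formula\<close>

context kummer_curve
begin

lemma one_le_r: "1 \<in> {1..n}" "1 \<in> {1..r}"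
  using n_bounds by auto

text \<open>A coordinate of K(x) whose only pole is the degree-one place \<open>P 1\<close>.\<close>

definition w where "w = inverse (SOME u. gen u \<and> u \<in> P 1)"

lemma w: "gen w" "inverse w \<in> P 1" "gen (inverse w)"
proof -
  define u where "u = (SOME u. gen u \<and> u \<in> P 1)"
  have "\<exists>u. gen u \<and> u \<in> P 1" using P_gen[OF one_le_r(2)] by metis
  then have "gen u \<and> u \<in> P 1" unfolding u_def by (rule someI_ex)
  moreover have "w = inverse u" by (simp only: w_def u_def)
  ultimately show "gen w" "inverse w \<in> P 1" "gen (inverse w)"
    by (simp_all add: gen_inverse)
qed

lemma in_ring_w_iff:
  assumes R: "is_place rat_const R"
  shows "w \<in> place_ring R \<longleftrightarrow> R \<noteq> P 1"
proof -
  interpret discrete_valuation "place_val R" using disc_P[OF R] .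
  note inR = discrete_placeD(2,3)[OF rat_place_discrete[OF R]]
  have wnz: "w \<noteq> 0" using w(1) by (rule gen_nonzero)
  have "w \<notin> place_ring R \<longleftrightarrow> inverse w \<in> R"
    using wnz by (auto simp: inR val_inverse)
  then show ?thesis using rat_place_eq[OF w(3) R _ P_place[OF one_le_r(2)] w(2)] w(2) by auto
qed

lemma P_1_val_ev: "p \<noteq> 0 \<Longrightarrow> place_val (P 1) (ev w p) = - int (degree p)"
  using place_val_ev_inverse[OF P_place[OF one_le_r(2)] w(3,2)] by simp

text \<open>The residue of \<open>w\<close> at the degree-one place \<open>P k\<close>; it has this
  meaning for \<open>k \<in> {2..r}\<close> only, \<open>P 1\<close> being the pole of
  \<open>w\<close>.\<close>

definition res_w where "res_w k = (SOME c. w - rat_const c \<in> P k)"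

lemma P_neq_1: "k \<in> {2..r} \<Longrightarrow> P k \<noteq> P 1"
  using inj_onD[OF P_inj, of k 1] by auto

lemma P_ne_1E:
  assumes "R \<in> P ` {1..r}" "R \<noteq> P 1"
  obtains k where "k \<in> {2..r}" "R = P k"
proof -
  obtain k where "k \<in> {1..r}" "R = P k" using assms(1) by blast
  moreover from this have "k \<noteq> 1" using assms(2) by blast
  ultimately show thesis using that[of k] by simp
qed

lemma w_minus_res_w: "k \<in> {2..r} \<Longrightarrow> w - rat_const (res_w k) \<in> P k"
proof -
  assume k: "k \<in> {2..r}"
  then have k1: "k \<in> {1..r}" by auto
  have "w \<in> place_ring (P k)" using in_ring_w_iff[OF P_place[OF k1]] P_neq_1[OF k] by simp
  then have "\<exists>c. w - rat_const c \<in> P k" by (rule P_residue[OF k1])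
  then show ?thesis unfolding res_w_def by (rule someI_ex)
qed

lemma gen_w_shift: "gen (w - rat_const c)"
  using gen_shift[OF w(1), of "- c"] by (simp add: rat_const.hom_uminus)

text \<open>The principal divisor of \<open>w - rat_const (res_w k)\<close> is
  \<open>P k - P 1\<close>.\<close>

lemma val_w_minus_res_w:
  assumes k: "k \<in> {2..r}"
  shows "place_val (P k) (w - rat_const (res_w k)) = 1"
    and "place_val (P 1) (w - rat_const c) = - 1"
    and "\<lbrakk>is_place rat_const R; R \<noteq> P 1; R \<noteq> P k\<rbrakk> \<Longrightarrow> place_val R (w - rat_const (res_w k)) = 0"
proof -
  have Pk: "is_place rat_const (P k)" using k by (intro P_place) auto
  show "place_val (P k) (w - rat_const (res_w k)) = 1"
    by (rule rational_place_val[OF Pk gen_w_shift w_minus_res_w[OF k]])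
  have "w - rat_const c = ev w [:- c, 1:]" by (simp add: ev_pCons rat_const.hom_uminus)
  then show "place_val (P 1) (w - rat_const c) = - 1"
    using P_1_val_ev[of "[:- c, 1:]"] by simp
  assume R: "is_place rat_const R" "R \<noteq> P 1" "R \<noteq> P k"
  interpret discrete_valuation "place_val R" using disc_P[OF R(1)] .
  note inR = discrete_placeD(2,3)[OF rat_place_discrete[OF R(1)]]
  have nz: "w - rat_const (res_w k) \<noteq> 0" using gen_w_shift by (rule gen_nonzero)
  have "w - rat_const (res_w k) \<notin> R"
    using rat_place_eq[OF gen_w_shift R(1) _ Pk w_minus_res_w[OF k]] R(3) by blast
  moreover have "val_ge 0 (w - rat_const (res_w k))"
    using in_ring_w_iff[OF R(1)] R(2) rat_place_const_ge_0[OF R(1)]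
    by (intro val_ge_diff) (auto simp: inR val_ge_def)
  ultimately show "place_val R (w - rat_const (res_w k)) = 0"
    using nz by (auto simp: inR val_ge_def)
qed

text \<open>Has order \<open>c k\<close> at \<open>P k\<close> for \<open>k \<in> {2..r}\<close> and
  neither zeros nor poles outside the \<open>P k\<close>; multiplication by it reduces Riemann-Roch
  spaces of K(x) to polynomials in \<open>w\<close>.\<close>

definition G :: "(nat \<Rightarrow> int) \<Rightarrow> 'k poly fract" where
  "G c = (\<Prod>k\<in>{2..r}. (w - rat_const (res_w k)) powi c k)"

lemma G_nz: "G c \<noteq> 0"
  using gen_nonzero[OF gen_w_shift] by (simp add: G_def)

lemma G_val:
  assumes "is_place rat_const R"
  shows "place_val R (G c) = (\<Sum>k\<in>{2..r}. c k * place_val R (w - rat_const (res_w k)))"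
proof -
  interpret discrete_valuation "place_val R" using disc_P[OF assms] .
  show ?thesis
    unfolding G_def using gen_nonzero[OF gen_w_shift] by (subst val_prod) (simp_all add: val_power_int)
qed

lemma G_val_1: "place_val (P 1) (G c) = - (\<Sum>k\<in>{2..r}. c k)"
proof -
  have "place_val (P 1) (G c) = (\<Sum>k\<in>{2..r}. - c k)"
    unfolding G_val[OF P_place[OF one_le_r(2)]] using val_w_minus_res_w(2) by (intro sum.cong) simp_all
  then show ?thesis by (simp add: sum_negf)
qed

lemma G_val_P:
  assumes "l \<in> {2..r}" shows "place_val (P l) (G c) = c l"
proof -
  have Pl: "is_place rat_const (P l)" using assms by (intro P_place) auto
  have "place_val (P l) (G c) = (\<Sum>k\<in>{2..r}. if k = l then c l else 0)"
    unfolding G_val[OF Pl]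
  proof (rule sum.cong)
    fix k assume k: "k \<in> {2..r}"
    show "c k * place_val (P l) (w - rat_const (res_w k)) = (if k = l then c l else 0)"
    proof (cases "k = l")
      case False
      then have "P l \<noteq> P k" using inj_onD[OF P_inj, of l k] k assms by auto
      then show ?thesis using val_w_minus_res_w(3)[OF k Pl P_neq_1[OF assms]] False by simp
    qed (use val_w_minus_res_w(1)[OF k] in simp)
  qed simp
  then show ?thesis using assms by simp
qed

lemma G_val_other:
  assumes "is_place rat_const R" "R \<notin> P ` {1..r}" shows "place_val R (G c) = 0"
proof -
  have "R \<noteq> P 1" using assms(2) one_le_r by blast
  moreover have "R \<noteq> P k" if "k \<in> {2..r}" for k
  proof
    assume "R = P k"
    moreover have "k \<in> {1..r}" using that by auto
    ultimately show False using assms(2) by blast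
  qed
  ultimately show ?thesis unfolding G_val[OF assms(1)] using val_w_minus_res_w(3)[OF _ assms(1)] by simp
qed

text \<open>The Riemann-Roch space in K(x) of the divisor with coefficient \<open>c k\<close> at
  \<open>P k\<close>.\<close>

definition Lspace :: "(nat \<Rightarrow> int) \<Rightarrow> 'k poly fract set" where
  "Lspace c = {h. h = 0 \<or> (\<forall>k\<in>{1..r}. - c k \<le> place_val (P k) h) \<and>
     (\<forall>R. is_place rat_const R \<longrightarrow> R \<notin> P ` {1..r} \<longrightarrow> 0 \<le> place_val R h)}"

lemma r_split: "{1..r} = insert 1 {2..r}" "sum c {1..r} = c 1 + (\<Sum>k\<in>{2..r}. c k)" for c :: "nat \<Rightarrow> int"
proof -
  show "{1..r} = insert 1 {2..r}" using one_le_r by auto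
  then show "sum c {1..r} = c 1 + (\<Sum>k\<in>{2..r}. c k)" by simp
qed

text \<open>The factor \<open>G c\<close> settles all conditions away from \<open>P 1\<close>, and
  at \<open>P 1\<close> the order of a polynomial in \<open>w\<close> is minus its degree.\<close>

lemma ev_over_G_in_Lspace_iff:
  assumes p: "p \<noteq> 0"
  shows "ev w p / G c \<in> Lspace c \<longleftrightarrow> int (degree p) \<le> sum c {1..r}"
proof -
  have nz: "ev w p \<noteq> 0" using p w by simp
  have val: "place_val R (ev w p / G c) = place_val R (ev w p) - place_val R (G c)"
    if "is_place rat_const R" for R
    using discrete_valuation.val_divide[OF disc_P[OF that] nz G_nz] .
  have ge: "0 \<le> place_val R (ev w p)" if R: "is_place rat_const R" "R \<noteq> P 1" for R
    using ev_val_ge_0[OF R(1), of w p] in_ring_w_iff[OF R(1)] R(2) nz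
      discrete_valuation.val_ge_def[OF disc_P[OF R(1)]] by auto
  have "- c k \<le> place_val (P k) (ev w p / G c)" if "k \<in> {2..r}" for k
  proof -
    have "is_place rat_const (P k)" using that by (intro P_place) auto
    then show ?thesis using val ge P_neq_1[OF that] G_val_P[OF that] by simp
  qed
  moreover have "0 \<le> place_val R (ev w p / G c)" if R: "is_place rat_const R" "R \<notin> P ` {1..r}" for R
    using val[OF R(1)] ge[OF R(1)] G_val_other[OF R] R(2) one_le_r by force
  moreover have "- c 1 \<le> place_val (P 1) (ev w p / G c) \<longleftrightarrow> int (degree p) \<le> sum c {1..r}"
    unfolding val[OF P_place[OF one_le_r(2)]] G_val_1 P_1_val_ev[OF p] r_split(2) by linarith
  ultimately show ?thesis
    unfolding Lspace_def r_split(1) using nz G_nz by auto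
qed

text \<open>\<open>h * G c\<close> is regular wherever \<open>w\<close> is, hence a polynomial in
  \<open>w\<close>.\<close>

lemma Lspace_ev:
  assumes "h \<in> Lspace c"
  obtains p where "h = ev w p / G c"
proof (cases "h = 0")
  case True
  then show thesis using that[of 0] by simp
next
  case False
  have "\<exists>p. h * G c = ev w p"
  proof -
    have "h * G c \<in> place_ring R" if R: "is_place rat_const R" "w \<in> place_ring R" for R
    proof -
      interpret discrete_valuation "place_val R" using disc_P[OF R(1)] .
      have R1: "R \<noteq> P 1" using R in_ring_w_iff by simp
      have "0 \<le> place_val R h + place_val R (G c)"
      proof (cases "R \<in> P ` {1..r}")
        case True
        then obtain k where k: "k \<in> {2..r}" "R = P k" using R1 by (rule P_ne_1E)
        then have "- c k \<le> place_val R h" using assms False by (auto simp: Lspace_def)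
        then show ?thesis using G_val_P[OF k(1)] k by simp
      next
        case False
        then show ?thesis using assms \<open>h \<noteq> 0\<close> G_val_other[OF R(1) False] R(1) by (auto simp: Lspace_def)
      qed
      then show ?thesis
        using False G_nz by (simp add: discrete_placeD(3)[OF rat_place_discrete[OF R(1)]] val_mult)
    qed
    then show ?thesis using regular_imp_polynomial[OF w(1)] by metis
  qed
  then obtain p where "h * G c = ev w p" by blast
  then have "h = ev w p / G c" using G_nz by (simp add: field_simps)
  then show thesis by (rule that)
qed

lemma Lspace_eq_image:
  "Lspace c = (\<lambda>p. ev w p / G c) ` {p. p = 0 \<or> int (degree p) \<le> sum c {1..r}}"
proof (intro equalityI subsetI)
  fix h assume h: "h \<in> Lspace c"
  obtain p where p: "h = ev w p / G c" by (rule Lspace_ev[OF h])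
  then show "h \<in> (\<lambda>p. ev w p / G c) ` {p. p = 0 \<or> int (degree p) \<le> sum c {1..r}}"
    using h ev_over_G_in_Lspace_iff[of p c] by (intro image_eqI[where x = p]) (auto simp: p)
next
  fix h assume "h \<in> (\<lambda>p. ev w p / G c) ` {p. p = 0 \<or> int (degree p) \<le> sum c {1..r}}"
  then obtain p where p: "h = ev w p / G c" "p = 0 \<or> int (degree p) \<le> sum c {1..r}" by blast
  then show "h \<in> Lspace c"
    using ev_over_G_in_Lspace_iff[of p c] by (cases "p = 0") (auto simp: Lspace_def)
qed

lemma card_Lspace: "finite (Lspace c)" "card (Lspace c) = CARD('k) ^ nat (sum c {1..r} + 1)"
proof -
  have inj: "inj_on (\<lambda>p. ev w p / G c) S" for S
    using G_nz gen_eq_iff[OF w(1)] by (auto simp: inj_on_def)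
  show "finite (Lspace c)" "card (Lspace c) = CARD('k) ^ nat (sum c {1..r} + 1)"
    unfolding Lspace_eq_image
    by (rule finite_imageI[OF card_polys_degree_le(1)],
        simp only: card_image[OF inj] card_polys_degree_le(2))
qed

text \<open>The principal divisor of \<open>F\<close> has degree 0: \<open>F / G lam\<close> has
  neither zeros nor poles away from \<open>P 1\<close>, so it and its inverse are polynomials in
  \<open>w\<close>, hence constant, and its order at \<open>P 1\<close> is 0 as well.\<close>

lemma sum_lam: "sum lam {1..r} = 0"
proof -
  define h where "h = F / G lam"
  have hnz: "h \<noteq> 0" using F_nz G_nz by (simp add: h_def)
  have v0: "place_val R h = 0" if R: "is_place rat_const R" "R \<noteq> P 1" for R
  proof -
    interpret discrete_valuation "place_val R" using disc_P[OF R(1)] .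
    have "place_val R h = place_val R F - place_val R (G lam)"
      using F_nz G_nz by (simp add: h_def val_divide)
    also have "\<dots> = 0"
    proof (cases "R \<in> P ` {1..r}")
      case True
      then obtain k where k: "k \<in> {2..r}" "R = P k" using R(2) by (rule P_ne_1E)
      then show ?thesis using G_val_P[OF k(1)] by (simp add: lam_eq)
    next
      case False
      then show ?thesis using G_val_other[OF R(1)] val_F_other[OF R(1)] by simp
    qed
    finally show ?thesis .
  qed
  have reg: "\<exists>p. x = ev w p" if "x \<in> {h, inverse h}" for x
  proof -
    have "x \<in> place_ring R" if R: "is_place rat_const R" "w \<in> place_ring R" for R
    proof -
      interpret discrete_valuation "place_val R" using disc_P[OF R(1)] .
      have "place_val R h = 0" using v0 R in_ring_w_iff by simp
      then show ?thesis using \<open>x \<in> {h, inverse h}\<close> hnz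
        by (auto simp: discrete_placeD(3)[OF rat_place_discrete[OF R(1)]] val_inverse)
    qed
    then show ?thesis using regular_imp_polynomial[OF w(1)] by metis
  qed
  obtain p q where pq: "h = ev w p" "inverse h = ev w q" using reg by blast
  then have "ev w (p * q) = ev w 1" using hnz by (simp add: ev_mult flip: pq)
  then have "p * q = 1" using gen_eq_iff[OF w(1)] by blast
  then have p: "p \<noteq> 0" "degree p = 0" by (auto simp: is_unit_iff_degree dest: dvdI[of 1 p q, OF sym])
  interpret discrete_valuation "place_val (P 1)" using disc_P[OF P_place[OF one_le_r(2)]] .
  have "place_val (P 1) h = 0" using P_1_val_ev[OF p(1)] p(2) by (simp add: pq)
  moreover have "place_val (P 1) h = lam 1 - place_val (P 1) (G lam)"
    unfolding h_def lam_eq by (rule val_divide[OF F_nz G_nz])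
  ultimately show ?thesis using G_val_1[of lam] r_split(2)[of lam] by linarith
qed

text \<open>The multiplicity at \<open>P k\<close> of the divisor of \<open>K(x)\<close> that bounds the coefficient of \<open>y\<^sup>i\<close> in \<open>\<L>(D)\<close>.\<close>

definition cc :: "('f set \<Rightarrow>\<^sub>0 int) \<Rightarrow> nat \<Rightarrow> nat \<Rightarrow> int" where
  "cc D i k = ((if k \<le> n then d D k else 0) + int i * lam k) div int m"

text \<open>Each inequality is divided by \<open>m\<close> and rounded. At the \<open>P k\<close>
  with \<open>k > n\<close> the coefficient of \<open>D\<close> is replaced by 0, and outside all
  \<open>P k\<close> the value of \<open>F\<close> is 0.\<close>

lemma term_ok_iff_Lspace:
  "term_ok D i h \<longleftrightarrow> h \<in> Lspace (cc D i)"
proof (cases "h = 0")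
  case False
  have *: "- x \<le> int m * v + int i * l \<longleftrightarrow> - ((x + int i * l) div int m) \<le> v" for x v l
    using neg_le_mult_iff_div[of "int m" "x + int i * l" v] m_pos by (simp add: algebra_simps)
  have 0: "0 \<le> int m * place_val R h \<longleftrightarrow> 0 \<le> place_val R h" for R
    using m_pos by (simp add: zero_le_mult_iff)
  have rn: "{1..r} = {1..n} \<union> {n<..r}" using n_bounds by auto
  have notin: "P k \<notin> P ` {1..n}" if "k \<in> {n<..r}" for k
    using that inj_on_image_mem_iff[OF P_inj, of k "{1..n}"] n_bounds by auto
  have "(\<forall>R. is_place rat_const R \<longrightarrow> R \<notin> P ` {1..n} \<longrightarrow> 0 \<le> int m * place_val R h + int i * place_val R F) \<longleftrightarrow>
    (\<forall>k\<in>{n<..r}. 0 \<le> int m * place_val (P k) h + int i * lam k) \<and>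
    (\<forall>R. is_place rat_const R \<longrightarrow> R \<notin> P ` {1..r} \<longrightarrow> 0 \<le> place_val R h)" (is "?A \<longleftrightarrow> ?B \<and> ?C")
  proof (intro iffI conjI)
    assume A: ?A
    show ?B using A notin P_place rn by (auto simp: lam_eq)
    show ?C
    proof (intro allI impI)
      fix R assume R: "is_place rat_const R" "R \<notin> P ` {1..r}"
      then have "R \<notin> P ` {1..n}" using rn by auto
      then show "0 \<le> place_val R h" using A R val_F_other[OF R] 0 by auto
    qed
  next
    assume BC: "?B \<and> ?C"
    show ?A
    proof (intro allI impI)
      fix R assume R: "is_place rat_const R" "R \<notin> P ` {1..n}"
      show "0 \<le> int m * place_val R h + int i * place_val R F"
      proof (cases "R \<in> P ` {1..r}")
        case True
        then obtain k where "k \<in> {n<..r}" "R = P k" using R(2) rn by auto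
        then show ?thesis using BC by (auto simp: lam_eq)
      next
        case False
        then show ?thesis using BC R(1) val_F_other[OF R(1) False] 0 by auto
      qed
    qed
  qed
  moreover have "(\<forall>k\<in>{1..r}. - cc D i k \<le> place_val (P k) h) \<longleftrightarrow>
    (\<forall>k\<in>{1..n}. - d D k \<le> int m * place_val (P k) h + int i * lam k) \<and>
    (\<forall>k\<in>{n<..r}. 0 \<le> int m * place_val (P k) h + int i * lam k)"
    unfolding rn ball_Un using *[of 0] by (simp add: * cc_def)
  ultimately show ?thesis using False by (auto simp: term_ok_def Lspace_def)
qed (simp add: term_ok_def Lspace_def)

lemma card_rr_space:
  assumes D: "Poly_Mapping.keys D \<subseteq> Q ` {1..n}"
  shows "finite (rr_space \<iota> D)"
    and "card (rr_space \<iota> D) = (\<Prod>i<m. CARD('k) ^ nat (sum (cc D i) {1..r} + 1))"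
proof -
  let ?X = "\<Pi>\<^sub>E i\<in>{..<m}. Lspace (cc D i)"
  let ?g = "\<lambda>h. \<Sum>i<m. \<phi> (h i) * y ^ i"
  have inj: "inj_on ?g ?X"
  proof (rule inj_onI)
    fix h h' assume h: "h \<in> ?X" "h' \<in> ?X" "?g h = ?g h'"
    have "(\<Sum>i<m. \<phi> (h i - h' i) * y ^ i) = 0"
      using h(3) by (simp add: hom_distribs left_diff_distrib sum_subtractf)
    from indep[OF this] show "h = h'" by (intro PiE_ext[OF h(1,2)]) simp
  qed
  have img: "rr_space \<iota> D = ?g ` ?X"
  proof (intro equalityI subsetI)
    fix z assume z: "z \<in> rr_space \<iota> D"
    obtain h where h: "z = ?g h" using expansion by blast
    then have "\<forall>i<m. h i \<in> Lspace (cc D i)" using z rr_space_iff_terms[OF D] term_ok_iff_Lspace by simp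
    then have "restrict h {..<m} \<in> ?X" by auto
    moreover have "?g (restrict h {..<m}) = z" unfolding h by (rule sum.cong) simp_all
    ultimately show "z \<in> ?g ` ?X" by blast
  next
    fix z assume "z \<in> ?g ` ?X"
    then obtain h where "z = ?g h" "h \<in> ?X" by blast
    then show "z \<in> rr_space \<iota> D" using rr_space_iff_terms[OF D] term_ok_iff_Lspace by (auto simp: PiE_iff)
  qed
  show "finite (rr_space \<iota> D)" unfolding img by (intro finite_imageI finite_PiE) (auto simp: card_Lspace)
  show "card (rr_space \<iota> D) = (\<Prod>i<m. CARD('k) ^ nat (sum (cc D i) {1..r} + 1))"
    unfolding img by (simp add: card_image[OF inj] card_PiE card_Lspace)
qed

lemma card_rr_space_dim:
  assumes "finite (rr_space \<iota> D)"
  shows "card (rr_space \<iota> D) = CARD('k) ^ nat (rr_dim \<iota> D)"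
proof -
  have "card (rr_space \<iota> D) = CARD('k) ^ vector_space.dim (\<lambda>c z. \<iota> c * z) (rr_space \<iota> D)"
  proof (rule card_finite_subspace[OF \<iota>_hom assms])
    show "0 \<in> rr_space \<iota> D" by (simp add: rr_space_def)
  next
    fix x z assume xz: "x \<in> rr_space \<iota> D" "z \<in> rr_space \<iota> D"
    show "x + z \<in> rr_space \<iota> D"
      unfolding rr_space_iff
    proof (intro allI impI)
      fix Q' assume Q': "is_place \<iota> Q'"
      interpret discrete_valuation "place_val Q'" using disc[OF Q'] .
      show "val_ge (- Poly_Mapping.lookup D Q') (x + z)"
        using xz Q' by (intro val_ge_add) (simp_all add: rr_space_iff)
    qed
  next
    fix c z assume z: "z \<in> rr_space \<iota> D"
    show "\<iota> c * z \<in> rr_space \<iota> D"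
      unfolding rr_space_iff
    proof (intro allI impI)
      fix Q' assume Q': "is_place \<iota> Q'"
      interpret discrete_valuation "place_val Q'" using disc[OF Q'] .
      have "val_ge 0 (\<iota> c)"
        using place_val_const[OF \<iota>_hom Q' place_discrete[OF Q'], of c] by (cases "c = 0") (auto simp: val_ge_def)
      moreover have "val_ge (- Poly_Mapping.lookup D Q') z" using z Q' by (simp add: rr_space_iff)
      ultimately show "val_ge (- Poly_Mapping.lookup D Q') (\<iota> c * z)" using val_ge_mult[of 0] by fastforce
    qed
  qed
  then show ?thesis by (simp add: rr_dim_def)
qed

lemma card_k_gt_1: "1 < CARD('k)"
proof -
  have "card {0, 1 :: 'k} \<le> CARD('k)" by (rule card_mono) auto
  then show ?thesis by simp
qed

theorem rr_dim_eq:
  assumes D: "Poly_Mapping.keys D \<subseteq> Q ` {1..n}"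
  shows "rr_dim \<iota> D = (\<Sum>i<m. max 0 (sum (cc D i) {1..r} + 1))"
proof -
  have "CARD('k) ^ nat (rr_dim \<iota> D) = CARD('k) ^ (\<Sum>i<m. nat (sum (cc D i) {1..r} + 1))"
    using card_rr_space_dim[OF card_rr_space(1)[OF D]] card_rr_space(2)[OF D] by (simp add: power_sum)
  then have "nat (rr_dim \<iota> D) = (\<Sum>i<m. nat (sum (cc D i) {1..r} + 1))"
    using card_k_gt_1 by (simp add: power_inject_exp)
  moreover have "rr_dim \<iota> D = int (nat (rr_dim \<iota> D))" by (simp add: rr_dim_def)
  ultimately have "rr_dim \<iota> D = int (\<Sum>i<m. nat (sum (cc D i) {1..r} + 1))" by (simp only:)
  also have "\<dots> = (\<Sum>i<m. max 0 (sum (cc D i) {1..r} + 1))"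
    unfolding of_nat_sum by (rule sum.cong) auto
  finally show ?thesis .
qed

end

section \<open>Approximation\<close>

text \<open>If \<open>z\<close> is suitable for \<open>Z\<close> but not at the new place
  \<open>Q'\<close>, and \<open>u\<close> separates \<open>Q0\<close> from \<open>Q'\<close>, then
  \<open>u ^ k + z\<close> works: \<open>k\<close> exceeds all values of \<open>z\<close> on
  \<open>Z\<close> in modulus, so the two summands never have equal values there.\<close>

lemma separating_element:
  assumes "finite Z" "\<And>Q. Q \<in> Z \<Longrightarrow> discrete_place Q" "discrete_place Q0" "Q0 \<notin> Z"
  shows "\<exists>z. z \<noteq> 0 \<and> 0 < place_val Q0 z \<and> (\<forall>Q\<in>Z. place_val Q z < 0)"
  using assms
proof (induction Z rule: finite_induct)
  case empty
  interpret discrete_valuation "place_val Q0" using discrete_placeD(1)[OF empty(2)] .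
  show ?case using ex_uniformizer by (auto intro: exI)
next
  case (insert Q' Z)
  interpret v0: discrete_valuation "place_val Q0" using discrete_placeD(1)[OF insert.prems(2)] .
  have dQ': "discrete_place Q'" using insert.prems by blast
  interpret v': discrete_valuation "place_val Q'" using discrete_placeD(1)[OF dQ'] .
  note in0 = discrete_placeD(3)[OF insert.prems(2)] and in' = discrete_placeD(3)[OF dQ']
  have ne: "Q0 \<noteq> Q'" using insert.prems by blast
  obtain a where a: "a \<in> place_ring Q0" "a \<notin> place_ring Q'"
    using place_eq_if_ring_subset[OF dQ' insert.prems(2)] ne by blast
  obtain b where b: "b \<in> place_ring Q'" "b \<notin> place_ring Q0"
    using place_eq_if_ring_subset[OF insert.prems(2) dQ'] ne by auto
  define u where "u = a / b"
  have nz: "a \<noteq> 0" "b \<noteq> 0" using a(2) b(2) by (auto simp: in0 in')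
  then have u: "u \<noteq> 0" "0 < place_val Q0 u" "place_val Q' u < 0"
    using a b by (auto simp: in0 in' u_def v0.val_divide v'.val_divide)
  obtain z where z: "z \<noteq> 0" "0 < place_val Q0 z" "\<And>Q. Q \<in> Z \<Longrightarrow> place_val Q z < 0"
    using insert.IH insert.prems by blast
  show ?case
  proof (cases "place_val Q' z < 0")
    case True
    then show ?thesis using z by auto
  next
    case False
    define k where "k = Suc (nat (\<Sum>Q\<in>Z. \<bar>place_val Q z\<bar>))"
    have k: "\<bar>place_val Q z\<bar> < int k" if "Q \<in> Z" for Q
    proof -
      have "\<bar>place_val Q z\<bar> \<le> (\<Sum>Q\<in>Z. \<bar>place_val Q z\<bar>)" by (rule member_le_sum) (use insert that in auto)
      then show ?thesis by (simp add: k_def)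
    qed
    have k0: "0 < int k" by (simp only: k_def of_nat_0_less_iff zero_less_Suc)
    have "place_val Q' (u ^ k) < 0" using u k0 by (simp add: v'.val_power mult_pos_neg)
    then have "v'.val_ge (place_val Q' (u ^ k) + 1) z" using False z by (simp add: v'.val_ge_def)
    then have Q's: "u ^ k + z \<noteq> 0" "place_val Q' (u ^ k + z) < 0"
      using v'.val_add_eq[of "u ^ k" z] u \<open>place_val Q' (u ^ k) < 0\<close> by auto
    have "place_val Q (u ^ k + z) < 0" if Q: "Q \<in> Z" for Q
    proof -
      interpret v: discrete_valuation "place_val Q"
        using discrete_placeD(1)[of Q] insert.prems(1)[of Q] Q by blast
      have uk: "place_val Q (u ^ k) = int k * place_val Q u" using u by (simp add: v.val_power)
      show ?thesis
      proof (cases "place_val Q u < 0")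
        case True
        then have "int k * place_val Q u \<le> int k * (-1)" using k0 by (intro mult_left_mono) auto
        then have lt: "place_val Q (u ^ k) < place_val Q z" using uk k[OF Q] by linarith
        then have "v.val_ge (place_val Q (u ^ k) + 1) z" by (simp add: v.val_ge_def)
        then have "place_val Q (u ^ k + z) = place_val Q (u ^ k)" using v.val_add_eq[of "u ^ k" z] u by simp
        then show ?thesis using lt z(3)[OF Q] by linarith
      next
        case False
        then have "0 \<le> place_val Q (u ^ k)" using uk k0 by simp
        then have "v.val_ge (place_val Q z + 1) (u ^ k)" using z(3)[OF Q] by (simp add: v.val_ge_def)
        then have "place_val Q (z + u ^ k) = place_val Q z" using v.val_add_eq[of z "u ^ k"] z by simp
        then show ?thesis using z(3)[OF Q] by (simp add: add.commute)
      qed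
    qed
    moreover have "0 < place_val Q0 (u ^ k + z)"
    proof -
      have "0 < place_val Q0 (u ^ k)" using u k0 by (simp add: v0.val_power)
      then show ?thesis using v0.val_add_min[of "u ^ k" z] u z Q's by simp
    qed
    ultimately show ?thesis using Q's by (intro exI[of _ "u ^ k + z"]) auto
  qed
qed

text \<open>For a separating \<open>z\<close> and large \<open>k\<close> the factor 1/(1 + z^k) is
  close to 1 at \<open>Q0\<close> and close to 0 on \<open>Z\<close>.\<close>

lemma weak_approximation_single:
  assumes "finite Z" "\<And>Q. Q \<in> Z \<Longrightarrow> discrete_place Q" "discrete_place Q0" "Q0 \<notin> Z"
  shows "\<exists>s. discrete_valuation.val_ge (place_val Q0) M (s - x) \<and>
    (\<forall>Q\<in>Z. discrete_valuation.val_ge (place_val Q) M s)"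
proof (cases "x = 0")
  case True
  then show ?thesis
    using discrete_valuation.val_ge_0[OF discrete_placeD(1)] assms(2,3) by (intro exI[of _ 0]) auto
next
  case x: False
  interpret v0: discrete_valuation "place_val Q0" using discrete_placeD(1)[OF assms(3)] .
  obtain z where z: "z \<noteq> 0" "0 < place_val Q0 z" "\<And>Q. Q \<in> Z \<Longrightarrow> place_val Q z < 0"
    using separating_element[OF assms] by blast
  define k where "k = Suc (nat (\<bar>M\<bar> + \<bar>place_val Q0 x\<bar> + (\<Sum>Q\<in>Z. \<bar>place_val Q x\<bar>)))"
  have s0: "0 \<le> (\<Sum>Q\<in>Z. \<bar>place_val Q x\<bar>)" by (rule sum_nonneg) simp
  have kz: "M \<le> int k + place_val Q x" if "Q \<in> Z" for Q
  proof -
    have "\<bar>place_val Q x\<bar> \<le> (\<Sum>Q\<in>Z. \<bar>place_val Q x\<bar>)" by (rule member_le_sum) (use assms that in auto)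
    then show ?thesis unfolding k_def by linarith
  qed
  have k0: "M \<le> int k + place_val Q0 x" "0 < int k" using s0 unfolding k_def by linarith+
  have zk0: "int k \<le> place_val Q0 (z ^ k)"
    using z k0 mult_left_mono[of 1 "place_val Q0 z" "int k"] by (simp add: v0.val_power)
  then have "v0.val_ge (place_val Q0 1 + 1) (z ^ k)" using k0 by (simp add: v0.val_ge_def)
  from v0.val_add_eq[OF _ this] have e: "1 + z ^ k \<noteq> 0" "place_val Q0 (1 + z ^ k) = 0" by simp_all
  define s where "s = x / (1 + z ^ k)"
  have "s - x = - (z ^ k * x / (1 + z ^ k))" using e by (simp add: s_def field_simps)
  then have "v0.val_ge M (s - x)"
    using z x e k0 zk0 by (simp add: v0.val_ge_def v0.val_divide v0.val_mult)
  moreover have "discrete_valuation.val_ge (place_val Q) M s" if Q: "Q \<in> Z" for Q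
  proof -
    interpret v: discrete_valuation "place_val Q" using discrete_placeD(1)[OF assms(2)[OF Q]] .
    have "int k * place_val Q z \<le> int k * (-1)" using k0 z(3)[OF Q] by (intro mult_left_mono) auto
    then have zk: "place_val Q (z ^ k) \<le> - int k" using z by (simp add: v.val_power)
    then have "v.val_ge (place_val Q (z ^ k) + 1) 1" using k0 by (simp add: v.val_ge_def)
    from v.val_add_eq[OF _ this] have "place_val Q (1 + z ^ k) \<le> - int k"
      using z zk by (simp add: add.commute)
    then show ?thesis using kz[OF Q] x e by (simp add: v.val_ge_def s_def v.val_divide)
  qed
  ultimately show ?thesis by blast
qed

text \<open>Solutions of the one-place problems are added, all of them to the common precision
  \<open>N\<close>.\<close>

lemma weak_approximation:
  assumes "finite Z" "\<And>Q. Q \<in> Z \<Longrightarrow> discrete_place Q"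
  shows "\<exists>s. \<forall>Q\<in>Z. discrete_valuation.val_ge (place_val Q) (M Q) (s - x Q)"
proof -
  define N where "N = (\<Sum>Q\<in>Z. \<bar>M Q\<bar>)"
  have MN: "M Q \<le> N" if "Q \<in> Z" for Q
  proof -
    have "\<bar>M Q\<bar> \<le> N" unfolding N_def by (rule member_le_sum) (use assms that in auto)
    then show ?thesis by linarith
  qed
  have "\<forall>Q\<in>Z. \<exists>s. discrete_valuation.val_ge (place_val Q) N (s - x Q) \<and>
      (\<forall>Q'\<in>Z - {Q}. discrete_valuation.val_ge (place_val Q') N s)"
    using assms by (intro ballI weak_approximation_single) auto
  then obtain s where s: "\<And>Q. Q \<in> Z \<Longrightarrow> discrete_valuation.val_ge (place_val Q) N (s Q - x Q)"
      "\<And>Q Q'. Q \<in> Z \<Longrightarrow> Q' \<in> Z - {Q} \<Longrightarrow> discrete_valuation.val_ge (place_val Q') N (s Q)"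
    unfolding bchoice_iff by blast
  show ?thesis
  proof (intro exI[of _ "\<Sum>Q\<in>Z. s Q"] ballI)
    fix Q assume Q: "Q \<in> Z"
    interpret v: discrete_valuation "place_val Q" using discrete_placeD(1)[OF assms(2)[OF Q]] .
    have "(\<Sum>Q\<in>Z. s Q) - x Q = (s Q - x Q) + (\<Sum>Q'\<in>Z - {Q}. s Q')"
      using assms(1) Q by (simp add: sum.remove)
    moreover have "v.val_ge N (\<Sum>Q'\<in>Z - {Q}. s Q')" using s(2) Q by (intro v.val_ge_sum) auto
    ultimately have "v.val_ge N ((\<Sum>Q\<in>Z. s Q) - x Q)" using s(1)[OF Q] by (simp only: v.val_ge_add)
    then show "v.val_ge (M Q) ((\<Sum>Q\<in>Z. s Q) - x Q)" using MN[OF Q] by (rule v.val_ge_mono)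
  qed
qed

section \<open>Counting residue classes\<close>

text \<open>A constant factor cannot compensate an exponential gap: were \<open>C\<close> at least
  \<open>A + 1\<close>, Bernoulli's inequality with exponent \<open>A * B\<close> would make the
  ratio of the powers at least \<open>1 + B\<close>.\<close>

lemma le_if_powers_le:
  fixes A B C :: nat
  assumes A: "0 < A" and le: "\<And>k. C ^ k \<le> B * A ^ k"
  shows "C \<le> A"
proof (rule ccontr)
  assume "\<not> C \<le> A"
  then have C: "A + 1 \<le> C" by simp
  let ?k = "A * B"
  have "1 + real ?k * (1 / real A) \<le> (1 + 1 / real A) ^ ?k"
    by (rule Bernoulli_inequality) (use A in \<open>simp add: order_trans[of _ 0]\<close>)
  then have "1 + real B \<le> (1 + 1 / real A) ^ ?k" using A by simp
  also have "(1 + 1 / real A) = real (A + 1) / real A" using A by (simp add: field_simps)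
  finally have "(1 + real B) * real A ^ ?k \<le> real (A + 1) ^ ?k" using A by (simp add: field_simps power_divide)
  also have "\<dots> \<le> real C ^ ?k" using C by (intro power_mono) auto
  also have "\<dots> \<le> real B * real A ^ ?k" using le[of ?k] by (metis of_nat_le_iff of_nat_mult of_nat_power)
  finally have "real A ^ ?k \<le> 0" by (simp add: distrib_right)
  moreover have "0 < real A ^ ?k" using A by simp
  ultimately show False by linarith
qed

text \<open>The expansion in powers of \<open>g\<close> with the given digits, lowest first; the
  recursion exposes the digit that a congruence modulo \<open>g\<close> determines.\<close>

fun horner :: "'a::comm_ring_1 \<Rightarrow> 'a list \<Rightarrow> 'a" where
  "horner g [] = 0"
| "horner g (x # xs) = x + g * horner g xs"

lemma horner_in:
  assumes "0 \<in> W" "\<And>a b. a \<in> W \<Longrightarrow> b \<in> W \<Longrightarrow> a + b \<in> W" "\<And>a. a \<in> W \<Longrightarrow> g * a \<in> W" "set xs \<subseteq> W"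
  shows "horner g xs \<in> W"
  using assms(4) by (induction xs) (auto intro: assms)

text \<open>The lowest digits are congruent modulo \<open>g\<close>, hence equal; they cancel, and a
  factor \<open>g\<close> is removed.\<close>

lemma horner_inj:
  fixes g :: "'a::idom"
  assumes W: "0 \<in> W" "\<And>a b. a \<in> W \<Longrightarrow> b \<in> W \<Longrightarrow> a + b \<in> W" "\<And>a b. a \<in> W \<Longrightarrow> b \<in> W \<Longrightarrow> a - b \<in> W"
      "\<And>a. a \<in> W \<Longrightarrow> g * a \<in> W"
    and S: "S \<subseteq> W" "\<And>x x' a. x \<in> S \<Longrightarrow> x' \<in> S \<Longrightarrow> a \<in> W \<Longrightarrow> x - x' = g * a \<Longrightarrow> x = x'"
    and g: "g \<noteq> 0"
  shows "\<lbrakk>length xs = length xs'; set xs \<subseteq> S; set xs' \<subseteq> S; horner g xs = horner g xs'\<rbrakk> \<Longrightarrow> xs = xs'"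
proof (induction xs xs' rule: list_induct2)
  case (Cons x xs x' xs')
  have W': "horner g xs \<in> W" "horner g xs' \<in> W"
    using Cons.prems S(1) by (auto intro!: horner_in W)
  have "x - x' = g * (horner g xs' - horner g xs)" using Cons.prems by (simp add: algebra_simps)
  then have x: "x = x'" using S(2)[of x x'] W(3)[OF W'(2,1)] Cons.prems by auto
  then have "horner g xs = horner g xs'" using Cons.prems g by simp
  then show ?case using Cons x by simp
qed simp

section \<open>Counting elements incongruent modulo a polynomial in \<open>w\<close>\<close>

context kummer_curve
begin

text \<open>An increasing family of finite spaces: multiplication by a polynomial in
  \<open>w\<close> raises the index by its degree, and every element of the function field enters
  after a denominator is cleared.\<close>

definition Vb :: "nat \<Rightarrow> 'f set" where
  "Vb c = {\<Sum>i<m. \<phi> (ev w (p i)) * y ^ i | p. \<forall>i<m. degree (p i) \<le> c}"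

lemma card_Vb: "finite (Vb c)" "card (Vb c) \<le> CARD('k) ^ (m * (c + 1))"
proof -
  let ?S = "{p :: 'k poly. p = 0 \<or> int (degree p) \<le> int c}"
  let ?X = "\<Pi>\<^sub>E i\<in>{..<m}. ?S"
  let ?g = "\<lambda>p. \<Sum>i<m. \<phi> (ev w (p i)) * y ^ i"
  have sub: "Vb c \<subseteq> ?g ` ?X"
  proof
    fix z assume "z \<in> Vb c"
    then obtain p where p: "z = ?g p" "\<forall>i<m. degree (p i) \<le> c" by (auto simp: Vb_def)
    then have "restrict p {..<m} \<in> ?X" by auto
    moreover have "?g (restrict p {..<m}) = z" unfolding p(1) by (rule sum.cong) simp_all
    ultimately show "z \<in> ?g ` ?X" by blast
  qed
  have fin: "finite ?X" using card_polys_degree_le(1)[of "int c"] by (intro finite_PiE) auto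
  have "card ?X = (CARD('k) ^ (c + 1)) ^ m"
    using card_polys_degree_le(2)[of "int c", where 'k = 'k] by (simp only: card_PiE finite_lessThan prod_constant card_lessThan nat_int_add nat_int) (simp add: nat_add_distrib)
  then have cX: "card ?X = CARD('k) ^ (m * (c + 1))" by (simp only: power_mult[symmetric] mult.commute)
  show "finite (Vb c)" using sub fin finite_subset by blast
  have "card (Vb c) \<le> card (?g ` ?X)" using sub fin by (intro card_mono) auto
  also have "\<dots> \<le> card ?X" by (rule card_image_le[OF fin])
  finally show "card (Vb c) \<le> CARD('k) ^ (m * (c + 1))" by (simp only: cX)
qed

lemma VbI: "z = (\<Sum>i<m. \<phi> (ev w (p i)) * y ^ i) \<Longrightarrow> \<forall>i<m. degree (p i) \<le> c \<Longrightarrow> z \<in> Vb c"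
  unfolding Vb_def by (intro CollectI exI conjI)

lemma Vb_add: "a \<in> Vb c \<Longrightarrow> b \<in> Vb c \<Longrightarrow> a + b \<in> Vb c"
proof -
  assume "a \<in> Vb c" "b \<in> Vb c"
  then obtain p q where "a = (\<Sum>i<m. \<phi> (ev w (p i)) * y ^ i)" "\<forall>i<m. degree (p i) \<le> c"
    "b = (\<Sum>i<m. \<phi> (ev w (q i)) * y ^ i)" "\<forall>i<m. degree (q i) \<le> c" by (auto simp: Vb_def)
  then have "a + b = (\<Sum>i<m. \<phi> (ev w (p i + q i)) * y ^ i)" "\<forall>i<m. degree (p i + q i) \<le> c"
    by (simp_all only: ev_add hom_add distrib_right sum.distrib) (auto intro: degree_add_le)
  then show ?thesis by (rule VbI)
qed

lemma Vb_mult: "a \<in> Vb c \<Longrightarrow> \<phi> (ev w q) * a \<in> Vb (c + degree q)"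
proof -
  assume "a \<in> Vb c"
  then obtain p where p: "a = (\<Sum>i<m. \<phi> (ev w (p i)) * y ^ i)" "\<forall>i<m. degree (p i) \<le> c" by (auto simp: Vb_def)
  then have "\<phi> (ev w q) * a = (\<Sum>i<m. \<phi> (ev w (q * p i)) * y ^ i)"
    by (simp only: ev_mult hom_mult sum_distrib_left mult.assoc)
  moreover have "\<forall>i<m. degree (q * p i) \<le> c + degree q"
    using p(2) degree_mult_le[of q] by (metis add.commute add_le_mono1 order_trans)
  ultimately show ?thesis by (rule VbI)
qed

lemma Vb_mono: "a \<in> Vb c \<Longrightarrow> c \<le> c' \<Longrightarrow> a \<in> Vb c'"
  unfolding Vb_def by (auto intro: order_trans)

lemma denominator: "\<exists>b c. b \<noteq> 0 \<and> \<phi> (ev w b) * z \<in> Vb c"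
proof -
  obtain h where h: "z = (\<Sum>i<m. \<phi> (h i) * y ^ i)" using expansion by blast
  have "\<forall>i. \<exists>p b. b \<noteq> 0 \<and> h i = ev w p / ev w b" using w(1) unfolding gen_def by blast
  then obtain p b where pb: "\<And>i. b i \<noteq> 0" "\<And>i. h i = ev w (p i) / ev w (b i)" by metis
  define q where "q i = (\<Prod>j\<in>{..<m} - {i}. b j) * p i" for i
  define B where "B = (\<Prod>j<m. b j)"
  have eq: "ev w B * h i = ev w (q i)" if "i < m" for i
  proof -
    have "B = b i * (\<Prod>j\<in>{..<m} - {i}. b j)" unfolding B_def using that by (simp add: prod.remove)
    then show ?thesis using pb w(1) by (simp add: q_def ev_mult)
  qed
  have "\<phi> (ev w B) * z = (\<Sum>i<m. \<phi> (ev w B * h i) * y ^ i)"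
    unfolding h by (simp only: sum_distrib_left hom_mult mult.assoc)
  also have "\<dots> = (\<Sum>i<m. \<phi> (ev w (q i)) * y ^ i)" by (rule sum.cong) (simp_all add: eq)
  finally have "\<phi> (ev w B) * z \<in> Vb (\<Sum>i<m. degree (q i))"
    by (rule VbI) (auto intro: member_le_sum)
  moreover have "B \<noteq> 0" using pb(1) by (simp add: B_def)
  ultimately show ?thesis by blast
qed

lemma common_denominator:
  assumes "finite S" shows "\<exists>b c. b \<noteq> 0 \<and> (\<forall>z\<in>S. \<phi> (ev w b) * z \<in> Vb c)"
  using assms
proof (induction S rule: finite_induct)
  case (insert x S)
  then obtain b c where b: "b \<noteq> 0" "\<And>z. z \<in> S \<Longrightarrow> \<phi> (ev w b) * z \<in> Vb c" by blast
  obtain b' c' where b': "b' \<noteq> 0" "\<phi> (ev w b') * x \<in> Vb c'" using denominator by blast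
  let ?c = "c + degree b' + (c' + degree b)"
  have "\<phi> (ev w (b * b')) * z \<in> Vb ?c" if "z \<in> insert x S" for z
  proof (cases "z = x")
    case True
    have "\<phi> (ev w b) * (\<phi> (ev w b') * x) \<in> Vb (c' + degree b)" by (rule Vb_mult[OF b'(2)])
    also have "\<phi> (ev w b) * (\<phi> (ev w b') * x) = \<phi> (ev w (b * b')) * z"
      by (simp only: True ev_mult hom_mult mult.assoc)
    finally show ?thesis by (rule Vb_mono) simp
  next
    case False
    have "\<phi> (ev w b') * (\<phi> (ev w b) * z) \<in> Vb (c + degree b')" using Vb_mult[OF b(2)] False that by blast
    also have "\<phi> (ev w b') * (\<phi> (ev w b) * z) = \<phi> (ev w (b * b')) * z"
      by (simp only: ev_mult hom_mult mult_ac)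
    finally show ?thesis by (rule Vb_mono) simp
  qed
  then show ?case using b(1) b'(1) by (intro exI[of _ "b * b'"] exI[of _ ?c]) simp
qed (auto intro: exI[of _ 1])

text \<open>
  There are \<open>card S ^ k\<close> distinct sums \<open>\<Sum>l<k. g\<^sup>l s\<^sub>l\<close> with digits in \<open>S\<close>, all lying, up to a fixed
  denominator, in a space of dimension about \<open>k m deg g\<close>.
\<close>

lemma card_incongruent_le:
  assumes p: "p \<noteq> 0" and g: "g = \<phi> (ev w p)"
    and W: "0 \<in> W" "\<And>a b. a \<in> W \<Longrightarrow> b \<in> W \<Longrightarrow> a + b \<in> W" "\<And>a b. a \<in> W \<Longrightarrow> b \<in> W \<Longrightarrow> a - b \<in> W"
      "\<And>a. a \<in> W \<Longrightarrow> g * a \<in> W"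
    and S: "finite S" "S \<subseteq> W" "\<And>x x' a. x \<in> S \<Longrightarrow> x' \<in> S \<Longrightarrow> a \<in> W \<Longrightarrow> x - x' = g * a \<Longrightarrow> x = x'"
  shows "card S \<le> CARD('k) ^ (m * degree p)"
proof -
  have gnz: "g \<noteq> 0" using p g w(1) by simp
  obtain b c where bc: "b \<noteq> 0" "\<And>z. z \<in> S \<Longrightarrow> \<phi> (ev w b) * z \<in> Vb c"
    using common_denominator[OF S(1)] by blast
  have bnz: "\<phi> (ev w b) \<noteq> 0" using bc w(1) by simp
  have V0: "0 \<in> Vb c'" for c' by (rule VbI[of _ "\<lambda>_. 0"]) simp_all
  have hV: "set xs \<subseteq> S \<Longrightarrow> \<phi> (ev w b) * horner g xs \<in> Vb (c + degree p * length xs)" for xs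
  proof (induction xs)
    case (Cons x xs)
    have 1: "\<phi> (ev w b) * x \<in> Vb (c + degree p * length (x # xs))"
      using Cons.prems by (intro Vb_mono[OF bc(2)]) auto
    have "\<phi> (ev w p) * (\<phi> (ev w b) * horner g xs) \<in> Vb (c + degree p * length xs + degree p)"
      using Cons by (intro Vb_mult) auto
    then have 2: "\<phi> (ev w b) * (g * horner g xs) \<in> Vb (c + degree p * length (x # xs))"
      by (simp add: g mult_ac add_ac)
    show ?case using Vb_add[OF 1 2] by (simp add: distrib_left)
  qed (simp add: V0)
  \<comment> \<open>The denominator and the digits enter only through \<open>c\<close>, which is
    independent of \<open>k\<close>; letting \<open>k\<close> grow removes their
    contribution.\<close>
  have "card S ^ k \<le> CARD('k) ^ (m * (c + 1)) * (CARD('k) ^ (m * degree p)) ^ k" for k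
  proof -
    let ?L = "{xs. set xs \<subseteq> S \<and> length xs = k}"
    have "inj_on (\<lambda>xs. \<phi> (ev w b) * horner g xs) ?L"
    proof (rule inj_onI)
      fix xs xs' assume L: "xs \<in> ?L" "xs' \<in> ?L" "\<phi> (ev w b) * horner g xs = \<phi> (ev w b) * horner g xs'"
      then have "horner g xs = horner g xs'" using bnz by simp
      then show "xs = xs'" using L by (intro horner_inj[OF W S(2,3) gnz]) auto
    qed
    moreover have "(\<lambda>xs. \<phi> (ev w b) * horner g xs) ` ?L \<subseteq> Vb (c + degree p * k)" using hV by auto
    ultimately have "card ?L \<le> card (Vb (c + degree p * k))" by (rule card_inj_on_le) (rule card_Vb)
    also have "\<dots> \<le> CARD('k) ^ (m * (c + degree p * k + 1))" by (rule card_Vb)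
    also have "\<dots> = CARD('k) ^ (m * (c + 1)) * (CARD('k) ^ (m * degree p)) ^ k"
      by (simp only: power_mult[symmetric] power_add[symmetric]) (simp add: algebra_simps)
    finally show ?thesis using card_lists_length_eq[OF S(1), of k] by simp
  qed
  then show ?thesis by (intro le_if_powers_le[of "CARD('k) ^ (m * degree p)"]) simp_all
qed

end

section \<open>Residue fields\<close>

text \<open>A set of representatives of the residue field, which allows its elements to be counted
  without forming the quotient.\<close>

definition transversal :: "'f::field set \<Rightarrow> 'f set \<Rightarrow> bool" where
  "transversal Q T \<longleftrightarrow> T \<subseteq> place_ring Q \<and> (\<forall>z\<in>place_ring Q. \<exists>!t. t \<in> T \<and> z - t \<in> Q)"

lemma place_congruence:
  assumes "is_place \<iota> Q"
  shows "0 \<in> Q" "a \<in> Q \<Longrightarrow> b \<in> Q \<Longrightarrow> a + b \<in> Q" "a \<in> Q \<Longrightarrow> b \<in> Q \<Longrightarrow> a - b \<in> Q"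
    "a \<in> place_ring Q \<Longrightarrow> b \<in> Q \<Longrightarrow> a * b \<in> Q" "1 \<notin> Q" "Q \<subseteq> place_ring Q"
    "valuation_subring (place_ring Q)" "\<iota> c \<in> place_ring Q"
proof -
  obtain V: "valuation_subring (place_ring Q)" and c: "range \<iota> \<subset> place_ring Q"
    and QM: "Q = valuation_subring.M (place_ring Q)"
    by (rule is_placeE[OF assms])
  interpret V: valuation_subring "place_ring Q" by fact
  show "0 \<in> Q" "a \<in> Q \<Longrightarrow> b \<in> Q \<Longrightarrow> a + b \<in> Q" "a \<in> Q \<Longrightarrow> b \<in> Q \<Longrightarrow> a - b \<in> Q"
    "a \<in> place_ring Q \<Longrightarrow> b \<in> Q \<Longrightarrow> a * b \<in> Q" "1 \<notin> Q" "Q \<subseteq> place_ring Q"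
    using V.M_0 V.M_add V.M_diff V.M_mult V.M_1 V.M_sub by (metis QM)+
  show "valuation_subring (place_ring Q)" "\<iota> c \<in> place_ring Q" using V c by auto
qed

lemma transversal_inj:
  assumes "is_place \<iota> Q" "transversal Q T" "t \<in> T" "t' \<in> T" "t - t' \<in> Q"
  shows "t = t'"
proof -
  have "t \<in> place_ring Q" using assms by (auto simp: transversal_def)
  then have "\<exists>!s. s \<in> T \<and> t - s \<in> Q" using assms(2) by (simp add: transversal_def)
  moreover have "t - t \<in> Q" using place_congruence(1)[OF assms(1)] by simp
  ultimately show ?thesis using assms by blast
qed

lemma transversal_card_le:
  assumes Q: "is_place \<iota> Q" and T: "transversal Q T" and T': "transversal Q T'" "finite T'"
  shows "card T \<le> card T'"
proof -
  define c where "c z = (SOME t. t \<in> T' \<and> z - t \<in> Q)" for z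
  have c: "c z \<in> T' \<and> z - c z \<in> Q" if "z \<in> T" for z
  proof -
    have "\<exists>t. t \<in> T' \<and> z - t \<in> Q" using T T' that unfolding transversal_def by blast
    then show ?thesis unfolding c_def by (rule someI_ex)
  qed
  have "inj_on c T"
  proof (rule inj_onI)
    fix t t' assume t: "t \<in> T" "t' \<in> T" "c t = c t'"
    then have "(t - c t) - (t' - c t') \<in> Q" using c place_congruence(3)[OF Q] by blast
    then show "t = t'" using t transversal_inj[OF Q T] by simp
  qed
  then show ?thesis using c T'(2) by (intro card_inj_on_le[of c]) auto
qed

lemma transversal_of_basis:
  fixes \<iota> :: "'k::{field,finite} \<Rightarrow> 'f::field"
  assumes Q: "is_place \<iota> Q" and B: "residue_basis \<iota> Q B"
  shows "\<exists>T. transversal Q T \<and> finite T \<and> card T = CARD('k) ^ card B"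
proof -
  define S where "S c = (\<Sum>b\<in>B. \<iota> (c b) * b)" for c
  let ?X = "B \<rightarrow>\<^sub>E (UNIV :: 'k set)"
  interpret V: valuation_subring "place_ring Q" by (rule place_congruence(7)[OF Q])
  have fB: "finite B" "B \<subseteq> place_ring Q" using B by (auto simp: residue_basis_def)
  have ex1: "\<exists>!c. c \<in> ?X \<and> z - S c \<in> Q" if "z \<in> place_ring Q" for z
    using B that by (simp add: residue_basis_def S_def)
  have SR: "S c \<in> place_ring Q" for c
    unfolding S_def using fB place_congruence(8)[OF Q] by (intro V.R_sum V.R_mult) auto
  have inj: "inj_on S ?X"
  proof (rule inj_onI)
    fix c c' assume c: "c \<in> ?X" "c' \<in> ?X" "S c = S c'"
    have "S c - S c \<in> Q" "S c - S c' \<in> Q" using c place_congruence(1)[OF Q] by simp_all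
    then show "c = c'" using ex1[OF SR[of c]] c by blast
  qed
  have "transversal Q (S ` ?X)"
    unfolding transversal_def
  proof (intro conjI ballI)
    show "S ` ?X \<subseteq> place_ring Q" using SR by blast
    fix z assume "z \<in> place_ring Q"
    from ex1[OF this] show "\<exists>!t. t \<in> S ` ?X \<and> z - t \<in> Q" by blast
  qed
  moreover have "finite ?X" using fB by (intro finite_PiE) auto
  moreover have "card (S ` ?X) = CARD('k) ^ card B"
    using card_image[OF inj] fB by (simp add: card_PiE)
  ultimately show ?thesis by blast
qed

text \<open>A maximal independent set exists because its \<open>CARD('k) ^ card B\<close>
  combinations are pairwise incongruent and hence bounded in number; an element outside its span
  modulo \<open>Q\<close> could be added to it.\<close>

lemma residue_basis_if_bounded:
  fixes \<iota> :: "'k::{field,finite} \<Rightarrow> 'f::field"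
  assumes \<iota>: "field_hom \<iota>" and Q: "is_place \<iota> Q"
    and bound: "\<And>S. \<lbrakk>finite S; S \<subseteq> place_ring Q; \<And>x x'. x \<in> S \<Longrightarrow> x' \<in> S \<Longrightarrow> x - x' \<in> Q \<Longrightarrow> x = x'\<rbrakk>
      \<Longrightarrow> card S \<le> N"
  shows "\<exists>B. residue_basis \<iota> Q B"
proof -
  interpret field_hom \<iota> by fact
  interpret V: valuation_subring "place_ring Q" by (rule place_congruence(7)[OF Q])
  note Qc = place_congruence[OF Q]
  define S where "S B c = (\<Sum>b\<in>B. \<iota> (c b) * b)" for B c
  define I where "I B \<longleftrightarrow> finite B \<and> B \<subseteq> place_ring Q \<and>
    (\<forall>c\<in>B \<rightarrow>\<^sub>E UNIV. \<forall>c'\<in>B \<rightarrow>\<^sub>E UNIV. S B c - S B c' \<in> Q \<longrightarrow> c = c')" for B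
  have SR: "S B c \<in> place_ring Q" if "B \<subseteq> place_ring Q" for B c
    unfolding S_def using that Qc(8) by (intro V.R_sum V.R_mult) auto
  have S_cong: "S B c = S B c'" if "\<And>b. b \<in> B \<Longrightarrow> c b = c' b" for B c c'
    unfolding S_def using that by (intro sum.cong) simp_all
  have bd: "card B \<le> N" if B: "I B" for B
  proof -
    let ?X = "B \<rightarrow>\<^sub>E (UNIV :: 'k set)"
    have fB: "finite B" "B \<subseteq> place_ring Q" using B by (auto simp: I_def)
    have inj: "inj_on (S B) ?X"
      using B Qc(1) unfolding I_def inj_on_def by (metis diff_self)
    have fX: "finite ?X" using fB by (intro finite_PiE) auto
    have "card (S B ` ?X) \<le> N"
      using B fX SR[OF fB(2)] unfolding I_def by (intro bound) auto
    then have "CARD('k) ^ card B \<le> N" using card_image[OF inj] fB by (simp add: card_PiE)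
    moreover have "2 \<le> CARD('k)"
    proof -
      have "card {0, 1 :: 'k} \<le> CARD('k)" by (rule card_mono) auto
      then show ?thesis by simp
    qed
    then have "2 ^ card B \<le> CARD('k) ^ card B" by (intro power_mono) auto
    ultimately show ?thesis using less_exp[of "card B"] by linarith
  qed
  have "I {}" by (auto simp: I_def)
  then obtain B where B: "I B" "\<And>B'. I B' \<Longrightarrow> card B' \<le> card B"
    using ex_has_greatest_nat[of I "{}" card "Suc N"] bd by (auto simp: less_Suc_eq_le)
  have fB: "finite B" "B \<subseteq> place_ring Q" using B by (auto simp: I_def)
  have ind: "c = c'" if "c \<in> B \<rightarrow>\<^sub>E UNIV" "c' \<in> B \<rightarrow>\<^sub>E UNIV" "S B c - S B c' \<in> Q" for c c'
    using B(1) that by (auto simp: I_def)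
  have span: "\<exists>c\<in>B \<rightarrow>\<^sub>E UNIV. z - S B c \<in> Q" if z: "z \<in> place_ring Q" for z
  proof (rule ccontr)
    assume neg: "\<not> ?thesis"
    have neg': "z - S B c \<notin> Q" for c
      using neg S_cong[of B c "restrict c B"] by auto
    have "z \<notin> B"
    proof
      assume zB: "z \<in> B"
      have "S B (\<lambda>b. if b = z then 1 else 0) = (\<Sum>b\<in>B. if b = z then z else 0)"
        unfolding S_def by (rule sum.cong) simp_all
      also have "\<dots> = z" using zB fB by simp
      finally show False using neg'[of "\<lambda>b. if b = z then 1 else 0"] Qc(1) by simp
    qed
    have Si: "S (insert z B) c = \<iota> (c z) * z + S B c" for c
      unfolding S_def using fB \<open>z \<notin> B\<close> by simp
    have "I (insert z B)"
      unfolding I_def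
    proof (intro conjI ballI impI)
      show "finite (insert z B)" "insert z B \<subseteq> place_ring Q" using fB z by auto
      fix c c' assume c: "c \<in> insert z B \<rightarrow>\<^sub>E UNIV" "c' \<in> insert z B \<rightarrow>\<^sub>E UNIV"
        and diff: "S (insert z B) c - S (insert z B) c' \<in> Q"
      have eqz: "c z = c' z"
      proof (rule ccontr)
        assume ne: "c z \<noteq> c' z"
        \<comment> \<open>If the coefficients of \<open>z\<close> differed, dividing by their
          difference would express \<open>z\<close> modulo \<open>Q\<close> through
          \<open>B\<close>.\<close>
        define u where "u b = (c' b - c b) / (c z - c' z)" for b
        have "\<iota> (c z - c' z) * S B u = S B c' - S B c"
          unfolding S_def sum_distrib_left sum_subtractf[symmetric]
          by (rule sum.cong) (use ne in \<open>simp_all add: u_def hom_distribs field_simps\<close>)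
        then have e: "S (insert z B) c - S (insert z B) c' = \<iota> (c z - c' z) * (z - S B u)"
          by (simp add: Si hom_distribs algebra_simps)
        have "\<iota> (inverse (c z - c' z)) * (\<iota> (c z - c' z) * (z - S B u)) \<in> Q"
          by (rule Qc(4)[OF Qc(8)]) (use diff e in \<open>simp only:\<close>)
        also have "\<iota> (inverse (c z - c' z)) * (\<iota> (c z - c' z) * (z - S B u)) = z - S B u"
          using ne by (simp add: hom_inverse flip: mult.assoc)
        finally show False using neg' by blast
      qed
      then have "S B (restrict c B) - S B (restrict c' B) \<in> Q"
        using diff S_cong[of B c "restrict c B"] S_cong[of B c' "restrict c' B"] by (simp add: Si)
      then have "restrict c B = restrict c' B" by (intro ind) auto
      then have "c b = c' b" if "b \<in> B" for b using that by (metis restrict_apply')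
      then show "c = c'" using eqz by (intro PiE_ext[OF c]) auto
    qed
    from B(2)[OF this] show False using \<open>z \<notin> B\<close> fB by simp
  qed
  have "residue_basis \<iota> Q B"
    unfolding residue_basis_def
  proof (intro conjI ballI fB)
    fix z assume "z \<in> place_ring Q"
    then obtain c where c: "c \<in> B \<rightarrow>\<^sub>E UNIV" "z - S B c \<in> Q" using span by blast
    show "\<exists>!c. c \<in> B \<rightarrow>\<^sub>E UNIV \<and> z - (\<Sum>b\<in>B. \<iota> (c b) * b) \<in> Q"
      unfolding S_def[symmetric]
    proof (rule ex1I[of _ c])
      fix c' assume c': "c' \<in> B \<rightarrow>\<^sub>E UNIV \<and> z - S B c' \<in> Q"
      have "(z - S B c) - (z - S B c') \<in> Q" by (rule Qc(3)[OF c(2) conjunct2[OF c']])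
      then have "S B c' - S B c \<in> Q" by simp
      then show "c' = c" using c c' by (intro ind) auto
    qed (use c in auto)
  qed
  then show ?thesis by blast
qed

text \<open>Each basis yields a set of \<open>CARD('k) ^ card B\<close> representatives, so all
  bases have equal size and the description is unique.\<close>

lemma place_degree_eq:
  fixes \<iota> :: "'k::{field,finite} \<Rightarrow> 'f::field"
  assumes Q: "is_place \<iota> Q" and B: "residue_basis \<iota> Q B"
  shows "place_degree \<iota> Q = card B"
  unfolding place_degree_def
proof (rule the_equality)
  show "\<exists>B'. residue_basis \<iota> Q B' \<and> card B' = card B" using B by blast
  fix d assume "\<exists>B'. residue_basis \<iota> Q B' \<and> card B' = d"
  then obtain B' where B': "residue_basis \<iota> Q B'" "card B' = d" by blast
  obtain T where T: "transversal Q T" "finite T" "card T = CARD('k) ^ card B"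
    using transversal_of_basis[OF Q B] by blast
  obtain T' where T': "transversal Q T'" "finite T'" "card T' = CARD('k) ^ card B'"
    using transversal_of_basis[OF Q B'(1)] by blast
  have "card T = card T'"
    using transversal_card_le[OF Q T(1) T'(1,2)] transversal_card_le[OF Q T'(1) T(1,2)] by simp
  moreover have "1 < CARD('k)"
  proof -
    have "card {0, 1 :: 'k} \<le> CARD('k)" by (rule card_mono) auto
    then show ?thesis by simp
  qed
  ultimately show "d = card B" using T T' B'(2) by (simp add: power_inject_exp)
qed

text \<open>The lowest digits agree modulo \<open>Q\<close>, hence are equal; removing them costs
  one factor \<open>t\<close> and thus one unit of precision, matching the number of digits
  left.\<close>

lemma horner_digits_unique:
  assumes Q: "is_place \<iota> Q" "discrete_place Q" and T: "transversal Q T"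
    and t: "t \<noteq> 0" "place_val Q t = 1"
  shows "\<lbrakk>length xs = length xs'; set xs \<subseteq> T; set xs' \<subseteq> T;
    discrete_valuation.val_ge (place_val Q) (int (length xs)) (horner t xs - horner t xs')\<rbrakk> \<Longrightarrow> xs = xs'"
proof (induction xs xs' rule: list_induct2)
  case (Cons x xs x' xs')
  interpret discrete_valuation "place_val Q" using discrete_placeD(1)[OF Q(2)] .
  interpret V: valuation_subring "place_ring Q" by (rule place_congruence(7)[OF Q(1)])
  note inQ = discrete_placeD(2,3)[OF Q(2)]
  have TR: "T \<subseteq> place_ring Q" using T by (simp add: transversal_def)
  have tR: "t \<in> place_ring Q" using t by (simp add: inQ)
  have hR: "horner t ys \<in> place_ring Q" if "set ys \<subseteq> T" for ys
    using that TR tR by (intro horner_in V.R_0 V.R_add V.R_mult) auto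
  let ?D = "horner t xs - horner t xs'"
  have D0: "val_ge 0 ?D"
    using V.R_diff[OF hR hR, of xs xs'] Cons.prems by (auto simp: inQ val_ge_def)
  have tD: "val_ge 1 (t * ?D)" using D0 t by (simp add: val_ge_mult_iff)
  have all: "val_ge (int (Suc (length xs))) ((x - x') + t * ?D)"
    using Cons.prems by (simp add: algebra_simps)
  then have "val_ge 1 ((x - x') + t * ?D)" by (rule val_ge_mono) simp
  from val_ge_diff[OF this tD] have "val_ge 1 (x - x')" by simp
  then have "x - x' \<in> Q" by (auto simp: inQ val_ge_def)
  then have x: "x = x'" using transversal_inj[OF Q(1) T] Cons.prems by auto
  then have "val_ge (int (length xs)) ?D" using all t by (simp add: val_ge_mult_iff)
  then show ?case using Cons x by auto
qed simp

section \<open>Residue degrees, and zeros of polynomials in \<open>w\<close> on the curve\<close>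

context kummer_curve
begin

text \<open>\<open>Q 1\<close> is the only place over the pole \<open>P 1\<close> of
  \<open>w\<close>.\<close>

lemma w_in_ring:
  assumes Q': "is_place \<iota> Q'" "Q' \<noteq> Q 1"
  shows "\<phi> w \<in> place_ring Q'"
proof -
  have "{h. \<phi> h \<in> Q'} \<noteq> P 1"
    using place_below(2)[OF Q'(1)] Q_unique[OF one_le_r(1) Q'(1)] Q'(2) by auto
  then show ?thesis
    using place_below(1,3)[OF Q'(1)] in_ring_w_iff by blast
qed

lemma min_poly_at:
  assumes Q': "is_place \<iota> Q'" "Q' \<noteq> Q 1"
  obtains p where "p \<noteq> 0" "\<phi> (ev w p) \<in> Q'"
proof -
  obtain V: "valuation_subring (place_ring Q')" and c: "range \<iota> \<subset> place_ring Q'"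
    and nU: "place_ring Q' \<noteq> UNIV" and QM: "Q' = valuation_subring.M (place_ring Q')"
    by (rule is_placeE[OF Q'(1)])
  have c': "range \<iota> \<subseteq> place_ring Q'" using c by blast
  obtain p where p: "p \<noteq> 0" "\<And>c. \<phi> (ev w c) \<in> valuation_subring.M (place_ring Q') \<longleftrightarrow> p dvd c"
    using place_min_poly[OF V c' nU w(1) w_in_ring[OF Q']] by metis
  then have "\<phi> (ev w p) \<in> Q'" using QM by (metis dvd_refl)
  then show thesis using that p(1) by blast
qed

lemma ev_in_place_ring: "is_place \<iota> Q' \<Longrightarrow> Q' \<noteq> Q 1 \<Longrightarrow> \<phi> (ev w p) \<in> place_ring Q'"
  using ev_in_ring[OF place_congruence(7) _ w_in_ring] place_congruence(8) by (metis image_subsetI)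

text \<open>Every residue field is finite: at \<open>Q 1\<close> residues are constants; elsewhere
  some polynomial in \<open>w\<close> lies in \<open>Q'\<close>, and elements incongruent modulo
  \<open>Q'\<close> are incongruent modulo that polynomial, so \<open>card_incongruent_le\<close>
  applies.\<close>

lemma incongruent_bounded:
  assumes Q': "is_place \<iota> Q'"
  shows "\<exists>N. \<forall>S. finite S \<longrightarrow> S \<subseteq> place_ring Q' \<longrightarrow>
    (\<forall>x\<in>S. \<forall>x'\<in>S. x - x' \<in> Q' \<longrightarrow> x = x') \<longrightarrow> card S \<le> N"
proof (cases "Q' = Q 1")
  case True
  define c where "c z = (SOME c. z - \<iota> c \<in> Q 1)" for z
  have c: "z - \<iota> (c z) \<in> Q 1" if "z \<in> place_ring (Q 1)" for z
    unfolding c_def using Q_residue[OF one_le_r(1) that] by (rule someI_ex)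
  have "card S \<le> CARD('k)"
    if S: "S \<subseteq> place_ring Q'" "\<forall>x\<in>S. \<forall>x'\<in>S. x - x' \<in> Q' \<longrightarrow> x = x'" for S
  proof -
    have "inj_on c S"
    proof (rule inj_onI)
      fix x x' assume x: "x \<in> S" "x' \<in> S" "c x = c x'"
      have R: "x \<in> place_ring (Q 1)" "x' \<in> place_ring (Q 1)" using x S(1) unfolding True by blast+
      have "(x - \<iota> (c x)) - (x' - \<iota> (c x')) \<in> Q 1"
        by (rule place_congruence(3)[OF Q_place[OF one_le_r(1)] c[OF R(1)] c[OF R(2)]])
      then have "x - x' \<in> Q'" unfolding True x(3) by simp
      then show "x = x'" using x S(2) by blast
    qed
    then show ?thesis by (intro card_inj_on_le[of c]) auto
  qed
  then show ?thesis by blast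
next
  case False
  obtain p where p: "p \<noteq> 0" "\<phi> (ev w p) \<in> Q'" by (rule min_poly_at[OF Q' False])
  interpret V: valuation_subring "place_ring Q'" by (rule place_congruence(7)[OF Q'])
  have "card S \<le> CARD('k) ^ (m * degree p)"
    if S: "finite S" "S \<subseteq> place_ring Q'" "\<forall>x\<in>S. \<forall>x'\<in>S. x - x' \<in> Q' \<longrightarrow> x = x'" for S
  proof (rule card_incongruent_le[OF p(1) refl, of "place_ring Q'"])
    fix x x' b assume x: "x \<in> S" "x' \<in> S" "b \<in> place_ring Q'" "x - x' = \<phi> (ev w p) * b"
    have "b * \<phi> (ev w p) \<in> Q'" using place_congruence(4)[OF Q' x(3) p(2)] .
    then show "x = x'" using x S(3) by (simp add: mult.commute)
  qed (use S ev_in_place_ring[OF Q' False] in \<open>auto intro: V.R_0 V.R_add V.R_diff V.R_mult\<close>)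
  then show ?thesis by blast
qed

lemma transversal_exists:
  assumes Q': "is_place \<iota> Q'"
  obtains T where "transversal Q' T" "finite T" "card T = CARD('k) ^ place_degree \<iota> Q'"
proof -
  obtain N where N: "\<forall>S. finite S \<longrightarrow> S \<subseteq> place_ring Q' \<longrightarrow>
      (\<forall>x\<in>S. \<forall>x'\<in>S. x - x' \<in> Q' \<longrightarrow> x = x') \<longrightarrow> card S \<le> N"
    using incongruent_bounded[OF Q'] by (rule exE)
  have "\<exists>B. residue_basis \<iota> Q' B"
    by (rule residue_basis_if_bounded[OF \<iota>_hom Q', of N]) (use N in simp)
  then obtain B where B: "residue_basis \<iota> Q' B" by (rule exE)
  show thesis
    using transversal_of_basis[OF Q' B] place_degree_eq[OF Q' B] that by auto
qed

lemma place_degree_pos: "is_place \<iota> Q' \<Longrightarrow> 0 < place_degree \<iota> Q'"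
proof (rule ccontr)
  assume Q': "is_place \<iota> Q'" and "\<not> 0 < place_degree \<iota> Q'"
  then obtain T where T: "transversal Q' T" "finite T" "card T = 1"
    by (metis transversal_exists neq0_conv power_0)
  then obtain t where t: "T = {t}" by (auto simp: card_1_singleton_iff)
  interpret V: valuation_subring "place_ring Q'" by (rule place_congruence(7)[OF Q'])
  have "0 - t \<in> Q'" "1 - t \<in> Q'" using T(1) V.R_0 V.R_1 unfolding transversal_def t by blast+
  then have "(1 - t) - (0 - t) \<in> Q'" using place_congruence(3)[OF Q'] by blast
  then show False using place_congruence(5)[OF Q'] by simp
qed

lemma place_degree_Q:
  assumes k: "k \<in> {1..n}"
  shows "place_degree \<iota> (Q k) = 1"
proof -
  note Qk = Q_place[OF k]
  interpret \<iota>: field_hom \<iota> by (rule \<iota>_hom)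
  have "transversal (Q k) (range \<iota>)"
    unfolding transversal_def
  proof (intro conjI ballI)
    show "range \<iota> \<subseteq> place_ring (Q k)" using place_congruence(8)[OF Qk] by blast
    fix z assume "z \<in> place_ring (Q k)"
    then obtain c where c: "z - \<iota> c \<in> Q k" using Q_residue[OF k] by blast
    show "\<exists>!t. t \<in> range \<iota> \<and> z - t \<in> Q k"
    proof (rule ex1I[of _ "\<iota> c"])
      show "\<iota> c \<in> range \<iota> \<and> z - \<iota> c \<in> Q k" using c by blast
      fix t assume t: "t \<in> range \<iota> \<and> z - t \<in> Q k"
      then obtain c' where c': "t = \<iota> c'" "z - \<iota> c' \<in> Q k" by blast
      have "(z - \<iota> c) - (z - \<iota> c') \<in> Q k" by (rule place_congruence(3)[OF Qk c c'(2)])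
      then have d: "\<iota> (c' - c) \<in> Q k" by (simp add: hom_minus rat_const.hom_minus)
      have "c' = c"
      proof (rule ccontr)
        assume "c' \<noteq> c"
        then have inv: "inverse (c' - c) * (c' - c) = 1" by simp
        have "\<iota> (inverse (c' - c)) * \<iota> (c' - c) = 1"
          by (simp only: \<iota>.hom_mult[symmetric] inv \<iota>.hom_one)
        then show False using place_congruence(4,5)[OF Qk] place_congruence(8)[OF Qk] d by metis
      qed
      then show "t = \<iota> c" using c' by simp
    qed
  qed
  moreover have "finite (range \<iota>)" by simp
  moreover obtain T where T: "transversal (Q k) T" "finite T" "card T = CARD('k) ^ place_degree \<iota> (Q k)"
    by (rule transversal_exists[OF Qk])
  ultimately have "card (range \<iota>) = CARD('k) ^ place_degree \<iota> (Q k)"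
    using transversal_card_le[OF Qk] by (metis le_antisym)
  moreover have "card (range \<iota>) = CARD('k)" by (rule card_image) (rule \<iota>.inj_f)
  ultimately have "CARD('k) ^ 1 = CARD('k) ^ place_degree \<iota> (Q k)" by simp
  then show ?thesis using card_k_gt_1 by (simp only: power_inject_exp)
qed

text \<open>Weak approximation prescribes, independently at all places of \<open>Z\<close>, the
  digits of a local expansion up to the order of the zero. The elements so obtained are pairwise
  incongruent modulo \<open>g\<close> in the ring \<open>W\<close>, and
  \<open>card_incongruent_le\<close> bounds their number.\<close>

theorem sum_zeros_le:
  assumes p: "p \<noteq> 0" and Z: "finite Z" "\<And>Q'. Q' \<in> Z \<Longrightarrow> is_place \<iota> Q' \<and> Q' \<noteq> Q 1"
  shows "(\<Sum>Q'\<in>Z. nat (place_val Q' (\<phi> (ev w p))) * place_degree \<iota> Q') \<le> m * degree p"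
proof -
  define g where "g = \<phi> (ev w p)"
  define e where "e Q' = nat (place_val Q' g)" for Q'
  have gnz: "g \<noteq> 0" using p w(1) by (simp add: g_def)
  have "\<forall>Q'\<in>Z. \<exists>T. transversal Q' T \<and> finite T \<and> card T = CARD('k) ^ place_degree \<iota> Q'"
    using transversal_exists Z(2) by metis
  then obtain T where T: "\<And>Q'. Q' \<in> Z \<Longrightarrow> transversal Q' (T Q')" "\<And>Q'. Q' \<in> Z \<Longrightarrow> finite (T Q')"
      "\<And>Q'. Q' \<in> Z \<Longrightarrow> card (T Q') = CARD('k) ^ place_degree \<iota> Q'"
    unfolding bchoice_iff by blast
  have dZ: "discrete_place Q'" if "Q' \<in> Z" for Q' using Z(2)[OF that] place_discrete by blast
  have "\<forall>Q'\<in>Z. \<exists>t. t \<noteq> 0 \<and> place_val Q' t = 1"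
    using discrete_valuation.ex_uniformizer[OF discrete_placeD(1)[OF dZ]] by blast
  then obtain t where t: "\<And>Q'. Q' \<in> Z \<Longrightarrow> t Q' \<noteq> 0" "\<And>Q'. Q' \<in> Z \<Longrightarrow> place_val Q' (t Q') = 1"
    unfolding bchoice_iff by blast
  define L where "L Q' = {xs. set xs \<subseteq> T Q' \<and> length xs = e Q'}" for Q'
  define Ds where "Ds = Pi\<^sub>E Z L"
  have "\<exists>s. \<forall>Q'\<in>Z. discrete_valuation.val_ge (place_val Q') (int (e Q')) (s - horner (t Q') (\<Delta> Q'))" for \<Delta>
    by (rule weak_approximation[OF Z(1) dZ])
  then obtain s where s: "\<And>\<Delta> Q'. Q' \<in> Z \<Longrightarrow>
      discrete_valuation.val_ge (place_val Q') (int (e Q')) (s \<Delta> - horner (t Q') (\<Delta> Q'))"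
    by metis
  define W where "W = {z. \<forall>Q'\<in>Z. z \<in> place_ring Q'}"
  have VZ: "valuation_subring (place_ring Q')" if "Q' \<in> Z" for Q'
    using place_congruence(7) Z(2)[OF that] by blast
  have W0: "0 \<in> W" and Wadd: "\<And>a b. a \<in> W \<Longrightarrow> b \<in> W \<Longrightarrow> a + b \<in> W"
    and Wdiff: "\<And>a b. a \<in> W \<Longrightarrow> b \<in> W \<Longrightarrow> a - b \<in> W" and Wg: "\<And>a. a \<in> W \<Longrightarrow> g * a \<in> W"
    unfolding W_def g_def using ev_in_place_ring Z(2)
    by (auto intro: valuation_subring.R_0[OF VZ] valuation_subring.R_add[OF VZ]
        valuation_subring.R_diff[OF VZ] valuation_subring.R_mult[OF VZ])
  \<comment> \<open>A difference divisible by \<open>g\<close> vanishes to order at least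
    \<open>e Q'\<close> at each place, which makes the prescribed digits agree.\<close>
  have key: "\<Delta> = \<Delta>'" if D: "\<Delta> \<in> Ds" "\<Delta>' \<in> Ds" and b: "b \<in> W" "s \<Delta> - s \<Delta>' = g * b" for \<Delta> \<Delta>' b
  proof (rule PiE_ext[OF D[unfolded Ds_def]])
    fix Q' assume Q': "Q' \<in> Z"
    interpret discrete_valuation "place_val Q'" using discrete_placeD(1)[OF dZ[OF Q']] .
    have L: "\<Delta> Q' \<in> L Q'" "\<Delta>' Q' \<in> L Q'" using D Q' by (auto simp: Ds_def)
    have "val_ge 0 b" using b(1) Q' discrete_placeD(3)[OF dZ[OF Q']] by (auto simp: W_def val_ge_def)
    moreover have "val_ge (int (e Q')) g"
    proof -
      have "g \<in> place_ring Q'" unfolding g_def using ev_in_place_ring Z(2)[OF Q'] by blast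
      then have "0 \<le> place_val Q' g" using gnz discrete_placeD(3)[OF dZ[OF Q']] by auto
      then show ?thesis by (simp add: e_def val_ge_def)
    qed
    ultimately have "val_ge (int (e Q')) (s \<Delta> - s \<Delta>')" unfolding b(2) using val_ge_mult[of "int (e Q')" g 0 b] by simp
    from val_ge_add[OF val_ge_diff[OF this s[OF Q', of \<Delta>]] s[OF Q', of \<Delta>']]
    have "val_ge (int (e Q')) (horner (t Q') (\<Delta> Q') - horner (t Q') (\<Delta>' Q'))"
      by (simp add: algebra_simps)
    then show "\<Delta> Q' = \<Delta>' Q'"
      using L Z(2)[OF Q'] by (intro horner_digits_unique[OF _ dZ[OF Q'] T(1)[OF Q'] t(1)[OF Q'] t(2)[OF Q']])
        (auto simp: L_def)
  qed
  have finL: "finite (L Q')" "card (L Q') = CARD('k) ^ (e Q' * place_degree \<iota> Q')" if "Q' \<in> Z" for Q'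
    using card_lists_length_eq[OF T(2)[OF that], of "e Q'"] finite_lists_length_eq[OF T(2)[OF that], of "e Q'"] T(3)[OF that]
    by (simp_all add: L_def power_mult mult.commute flip: power_mult)
  have finX: "finite Ds" unfolding Ds_def using finL Z(1) by (intro finite_PiE) auto
  have "inj_on s Ds" using key[OF _ _ W0] by (auto intro!: inj_onI)
  then have "card (s ` Ds) = card Ds" by (rule card_image)
  also have "\<dots> = CARD('k) ^ (\<Sum>Q'\<in>Z. e Q' * place_degree \<iota> Q')"
    unfolding Ds_def using Z(1) finL by (simp add: card_PiE power_sum)
  finally have cs: "card (s ` Ds) = CARD('k) ^ (\<Sum>Q'\<in>Z. e Q' * place_degree \<iota> Q')" .
  have sW: "s \<Delta> \<in> W" if D: "\<Delta> \<in> Ds" for \<Delta>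
    unfolding W_def
  proof (intro CollectI ballI)
    fix Q' assume Q': "Q' \<in> Z"
    interpret discrete_valuation "place_val Q'" using discrete_placeD(1)[OF dZ[OF Q']] .
    interpret V: valuation_subring "place_ring Q'" by (rule VZ[OF Q'])
    note inQ = discrete_placeD(3)[OF dZ[OF Q']]
    have "val_ge 0 (s \<Delta> - horner (t Q') (\<Delta> Q'))" using s[OF Q'] by (rule val_ge_mono) simp
    then have 1: "s \<Delta> - horner (t Q') (\<Delta> Q') \<in> place_ring Q'" by (auto simp: inQ val_ge_def)
    have "\<Delta> Q' \<in> L Q'" using D Q' unfolding Ds_def by (rule PiE_mem)
    then have "set (\<Delta> Q') \<subseteq> T Q'" by (simp add: L_def)
    also have "\<dots> \<subseteq> place_ring Q'" using T(1)[OF Q'] by (simp add: transversal_def)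
    finally have "horner (t Q') (\<Delta> Q') \<in> place_ring Q'"
      using t[OF Q'] by (intro horner_in V.R_0 V.R_add V.R_mult) (auto simp: inQ)
    from V.R_add[OF 1 this] show "s \<Delta> \<in> place_ring Q'" by simp
  qed
  have "card (s ` Ds) \<le> CARD('k) ^ (m * degree p)"
  proof (rule card_incongruent_le[OF p g_def W0 Wadd Wdiff Wg])
    show "finite (s ` Ds)" using finX by simp
    show "s ` Ds \<subseteq> W" using sW by (rule image_subsetI)
    fix x x' b assume x: "x \<in> s ` Ds" "x' \<in> s ` Ds" "b \<in> W" "x - x' = g * b"
    obtain \<Delta> where D: "x = s \<Delta>" "\<Delta> \<in> Ds" using x(1) by (rule imageE)
    obtain \<Delta>' where D': "x' = s \<Delta>'" "\<Delta>' \<in> Ds" using x(2) by (rule imageE)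
    have "\<Delta> = \<Delta>'" using key[OF D(2) D'(2) x(3)] x(4) D D' by simp
    then show "x = x'" using D D' by simp
  qed
  then show ?thesis unfolding cs using card_k_gt_1 by (simp add: e_def g_def)
qed

text \<open>Each zero contributes at least 1 to the sum bounded by
  \<open>sum_zeros_le\<close>.\<close>

lemma finite_zeros:
  assumes p: "p \<noteq> 0"
  shows "finite {Q'. is_place \<iota> Q' \<and> Q' \<noteq> Q 1 \<and> 0 < place_val Q' (\<phi> (ev w p))}" (is "finite ?Z")
proof (rule ccontr)
  assume inf: "infinite ?Z"
  obtain Z where "finite Z \<and> card Z = Suc (m * degree p) \<and> Z \<subseteq> ?Z"
    using infinite_arbitrarily_large[OF inf] by (rule exE)
  then have Z: "Z \<subseteq> ?Z" "finite Z" "card Z = Suc (m * degree p)" by simp_all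
  have "card Z = (\<Sum>Q'\<in>Z. 1)" by simp
  also have "\<dots> \<le> (\<Sum>Q'\<in>Z. nat (place_val Q' (\<phi> (ev w p))) * place_degree \<iota> Q')"
  proof (rule sum_mono)
    fix Q' assume "Q' \<in> Z"
    then have "1 \<le> nat (place_val Q' (\<phi> (ev w p)))" "1 \<le> place_degree \<iota> Q'"
      using Z(1) place_degree_pos[of Q'] by auto
    then show "1 \<le> nat (place_val Q' (\<phi> (ev w p))) * place_degree \<iota> Q'"
      using mult_le_mono[of 1 _ 1] by simp
  qed
  also have "\<dots> \<le> m * degree p" using Z by (intro sum_zeros_le[OF p]) auto
  finally show False using Z(3) by simp
qed

end

section \<open>The genus\<close>

context kummer_curve
begin

lemma div_degree_superset:
  assumes "finite S" "Poly_Mapping.keys D \<subseteq> S"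
  shows "div_degree \<iota> D = (\<Sum>Q'\<in>S. Poly_Mapping.lookup D Q' * int (place_degree \<iota> Q'))"
  unfolding div_degree_def using assms by (intro sum.mono_neutral_left) (auto simp: in_keys_iff)

lemma div_degree_add: "div_degree \<iota> (A + B) = div_degree \<iota> A + div_degree \<iota> B"
proof -
  let ?S = "Poly_Mapping.keys A \<union> Poly_Mapping.keys B"
  have "finite ?S" "Poly_Mapping.keys (A + B) \<subseteq> ?S" by (simp_all add: keys_add)
  then show ?thesis
    by (simp add: div_degree_superset[of ?S] lookup_add distrib_right sum.distrib)
qed

lemma div_degree_single: "div_degree \<iota> (Poly_Mapping.single Q' c) = c * int (place_degree \<iota> Q')"
  by (subst div_degree_superset[of "{Q'}"]) (auto simp: lookup_single split: if_splits)

text \<open>After scaling by \<open>s\<close>, whose order is one more than the coefficient of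
  \<open>D\<close>, the elements of the larger space are regular at \<open>Q'\<close>, and those
  with residue 0 form the smaller space. So the index is at most the size of the residue
  field.\<close>

lemma card_rr_space_add_place:
  assumes Q': "is_place \<iota> Q'" and fin: "finite (rr_space \<iota> (D + Poly_Mapping.single Q' 1))"
  shows "card (rr_space \<iota> (D + Poly_Mapping.single Q' 1)) \<le> CARD('k) ^ place_degree \<iota> Q' * card (rr_space \<iota> D)"
    and "rr_space \<iota> D \<subseteq> rr_space \<iota> (D + Poly_Mapping.single Q' 1)"
proof -
  let ?L = "rr_space \<iota> D" and ?L' = "rr_space \<iota> (D + Poly_Mapping.single Q' 1)"
  have look: "Poly_Mapping.lookup (D + Poly_Mapping.single Q' 1) R = Poly_Mapping.lookup D R + (if R = Q' then 1 else 0)" for R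
    by (simp add: lookup_add lookup_single when_def)
  show sub: "?L \<subseteq> ?L'"
    unfolding rr_space_def look by fastforce
  obtain T where T: "transversal Q' T" "finite T" "card T = CARD('k) ^ place_degree \<iota> Q'"
    by (rule transversal_exists[OF Q'])
  interpret v: discrete_valuation "place_val Q'" using disc[OF Q'] .
  note inQ = discrete_placeD(2,3)[OF place_discrete[OF Q']]
  obtain t where t: "t \<noteq> 0" "place_val Q' t = 1" using v.ex_uniformizer by blast
  define s where "s = t powi (Poly_Mapping.lookup D Q' + 1)"
  have s: "s \<noteq> 0" "place_val Q' s = Poly_Mapping.lookup D Q' + 1"
    using t by (simp_all add: s_def v.val_power_int)
  define c where "c z = (SOME x. x \<in> T \<and> s * z - x \<in> Q')" for z
  have c: "c z \<in> T" "s * z - c z \<in> Q'" if z: "z \<in> ?L'" for z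
  proof -
    have "v.val_ge (- Poly_Mapping.lookup D Q' - 1) z"
      using z Q' unfolding rr_space_iff by (auto simp: look)
    then have "v.val_ge 0 (s * z)" using s by (simp add: v.val_ge_mult_iff)
    then have "s * z \<in> place_ring Q'" by (auto simp: inQ v.val_ge_def)
    then have "\<exists>x. x \<in> T \<and> s * z - x \<in> Q'" using T(1) unfolding transversal_def by blast
    then have "c z \<in> T \<and> s * z - c z \<in> Q'" unfolding c_def by (rule someI_ex)
    then show "c z \<in> T" "s * z - c z \<in> Q'" by blast+
  qed
  \<comment> \<open>A fixed element of the larger space for each residue that occurs;
    \<open>z\<close> is recovered from its residue and the difference \<open>z - rep (c z)\<close>,
    which lies in the smaller space.\<close>
  define rep where "rep x = (SOME z. z \<in> ?L' \<and> c z = x)" for x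
  have rep: "rep (c z) \<in> ?L' \<and> c (rep (c z)) = c z" if "z \<in> ?L'" for z
    unfolding rep_def by (rule someI_ex) (use that in blast)
  have diff: "z - rep (c z) \<in> ?L" if z: "z \<in> ?L'" for z
    unfolding rr_space_iff
  proof (intro allI impI)
    fix R assume R: "is_place \<iota> R"
    interpret R: discrete_valuation "place_val R" using disc[OF R] .
    show "R.val_ge (- Poly_Mapping.lookup D R) (z - rep (c z))"
    proof (cases "R = Q'")
      case False
      have "R.val_ge (- Poly_Mapping.lookup D R) x" if "x \<in> ?L'" for x
      proof -
        have "R.val_ge (- Poly_Mapping.lookup (D + Poly_Mapping.single Q' 1) R) x"
          using that R unfolding rr_space_iff by blast
        then show ?thesis by (simp only: look False if_False add_0_right)
      qed
      then show ?thesis using z rep[OF z] by (intro R.val_ge_diff) blast+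
    next
      case True
      have "(s * z - c z) - (s * rep (c z) - c (rep (c z))) \<in> Q'"
        by (rule place_congruence(3)[OF Q' c(2)[OF z] c(2)[OF conjunct1[OF rep[OF z]]]])
      then have "s * (z - rep (c z)) \<in> Q'" using rep[OF z] by (simp add: right_diff_distrib)
      then have "v.val_ge 1 (s * (z - rep (c z)))" by (auto simp: inQ v.val_ge_def)
      then show ?thesis using s True by (simp add: v.val_ge_mult_iff)
    qed
  qed
  have "inj_on (\<lambda>z. (c z, z - rep (c z))) ?L'" by (auto simp: inj_on_def)
  moreover have "(\<lambda>z. (c z, z - rep (c z))) ` ?L' \<subseteq> T \<times> ?L" using c diff by auto
  moreover have "finite (T \<times> ?L)" using T sub fin finite_subset by blast
  ultimately have "card ?L' \<le> card (T \<times> ?L)" by (rule card_inj_on_le)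
  then show "card ?L' \<le> CARD('k) ^ place_degree \<iota> Q' * card ?L" using T by (simp add: card_cartesian_product)
qed

lemma rr_dim_nonneg: "0 \<le> rr_dim \<iota> D"
  by (simp add: rr_dim_def)

lemma defect_add_place:
  assumes Q': "is_place \<iota> Q'" and fin: "finite (rr_space \<iota> (D + Poly_Mapping.single Q' 1))"
  shows "div_degree \<iota> D - rr_dim \<iota> D
    \<le> div_degree \<iota> (D + Poly_Mapping.single Q' 1) - rr_dim \<iota> (D + Poly_Mapping.single Q' 1)"
proof -
  note L = card_rr_space_add_place[OF Q' fin]
  have "finite (rr_space \<iota> D)" using L(2) fin finite_subset by blast
  then have "CARD('k) ^ nat (rr_dim \<iota> (D + Poly_Mapping.single Q' 1))
      \<le> CARD('k) ^ (place_degree \<iota> Q' + nat (rr_dim \<iota> D))"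
    using L(1) card_rr_space_dim fin by (simp add: power_add)
  then have "nat (rr_dim \<iota> (D + Poly_Mapping.single Q' 1)) \<le> place_degree \<iota> Q' + nat (rr_dim \<iota> D)"
    using card_k_gt_1 by simp
  then show ?thesis
    using rr_dim_nonneg[of D] by (simp add: div_degree_add div_degree_single)
qed

text \<open>Adding a place raises the degree by the degree of that place and the dimension by no
  more. Places are added one at a time, with induction on the total gap between \<open>A\<close> and
  \<open>B\<close>.\<close>

lemma defect_mono:
  assumes "is_divisor \<iota> A" "is_divisor \<iota> B" "\<And>R. Poly_Mapping.lookup A R \<le> Poly_Mapping.lookup B R"
    and fin: "finite (rr_space \<iota> B)"
  shows "div_degree \<iota> A - rr_dim \<iota> A \<le> div_degree \<iota> B - rr_dim \<iota> B"
  using assms(1,3)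
proof (induction "nat (\<Sum>R\<in>Poly_Mapping.keys A \<union> Poly_Mapping.keys B. Poly_Mapping.lookup B R - Poly_Mapping.lookup A R)"
    arbitrary: A rule: less_induct)
  case less
  show ?case
  proof (cases "A = B")
    case False
    then obtain Q' where "Poly_Mapping.lookup A Q' \<noteq> Poly_Mapping.lookup B Q'"
      by (metis poly_mapping_eqI)
    then have lt: "Poly_Mapping.lookup A Q' < Poly_Mapping.lookup B Q'" using less.prems(2)[of Q'] by simp
    then have QK: "Q' \<in> Poly_Mapping.keys A \<union> Poly_Mapping.keys B" by (auto simp: in_keys_iff)
    then have Q': "is_place \<iota> Q'" using less.prems(1) assms(2) by (auto simp: is_divisor_def)
    define A' where "A' = A + Poly_Mapping.single Q' 1"
    have look: "Poly_Mapping.lookup A' R = Poly_Mapping.lookup A R + (if R = Q' then 1 else 0)" for R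
      by (simp add: A'_def lookup_add lookup_single when_def)
    have le: "Poly_Mapping.lookup A' R \<le> Poly_Mapping.lookup B R" for R
      using less.prems(2)[of R] lt by (simp add: look)
    have kA': "Poly_Mapping.keys A' \<subseteq> insert Q' (Poly_Mapping.keys A)"
      by (auto simp: in_keys_iff look split: if_splits)
    then have div: "is_divisor \<iota> A'" using less.prems(1) Q' by (auto simp: is_divisor_def)
    let ?K = "Poly_Mapping.keys A \<union> Poly_Mapping.keys B"
    have "(\<Sum>R\<in>Poly_Mapping.keys A' \<union> Poly_Mapping.keys B. Poly_Mapping.lookup B R - Poly_Mapping.lookup A' R)
        = (\<Sum>R\<in>?K. Poly_Mapping.lookup B R - Poly_Mapping.lookup A' R)"
      using kA' QK by (intro sum.mono_neutral_left) (auto simp: in_keys_iff)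
    also have "\<dots> < (\<Sum>R\<in>?K. Poly_Mapping.lookup B R - Poly_Mapping.lookup A R)"
      using QK by (intro sum_strict_mono_ex1) (auto simp: look)
    finally have "nat (\<Sum>R\<in>Poly_Mapping.keys A' \<union> Poly_Mapping.keys B. Poly_Mapping.lookup B R - Poly_Mapping.lookup A' R)
        < nat (\<Sum>R\<in>?K. Poly_Mapping.lookup B R - Poly_Mapping.lookup A R)"
      using sum_nonneg[of "Poly_Mapping.keys A' \<union> Poly_Mapping.keys B"
          "\<lambda>R. Poly_Mapping.lookup B R - Poly_Mapping.lookup A' R"] le by simp
    from less.hyps[OF this div le] have IH: "div_degree \<iota> A' - rr_dim \<iota> A' \<le> div_degree \<iota> B - rr_dim \<iota> B" .
    have "rr_space \<iota> A' \<subseteq> rr_space \<iota> B"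
      unfolding rr_space_def using le by (auto intro: order_trans[OF le_imp_neg_le])
    then have "finite (rr_space \<iota> A')" using fin finite_subset by blast
    then have "div_degree \<iota> A - rr_dim \<iota> A \<le> div_degree \<iota> A' - rr_dim \<iota> A'"
      unfolding A'_def by (rule defect_add_place[OF Q'])
    then show ?thesis using IH by simp
  qed simp
qed

text \<open>The degree of the divisor of K(x) that bounds the coefficient of \<open>y ^ i\<close>
  when \<open>D = 0\<close>.\<close>

definition floor_sum :: "nat \<Rightarrow> int" where
  "floor_sum i = (\<Sum>k\<in>{1..r}. (int i * lam k) div int m)"

text \<open>Chosen so that the sum of \<open>l + floor_sum i + 1\<close> over \<open>i < m\<close>
  equals \<open>m * l + 1 - g0\<close>.\<close>

definition g0 :: int where
  "g0 = 1 - int m - (\<Sum>i<m. floor_sum i)"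

text \<open>For \<open>l \<ge> l0\<close> all \<open>l + floor_sum i\<close> with
  \<open>i < m\<close> are nonnegative, so none of the maxima in \<open>rr_dim_eq\<close>
  truncates.\<close>

definition l0 :: int where
  "l0 = (\<Sum>i<m. \<bar>floor_sum i\<bar>)"

lemma rr_single_Q1:
  assumes "l0 \<le> l"
  defines "D \<equiv> Poly_Mapping.single (Q 1) (int m * l)"
  shows "finite (rr_space \<iota> D)" "rr_dim \<iota> D = int m * l + 1 - g0"
proof -
  have keys: "Poly_Mapping.keys D \<subseteq> Q ` {1..n}" using one_le_r by (auto simp: D_def split: if_splits)
  show "finite (rr_space \<iota> D)" by (rule card_rr_space(1)[OF keys])
  have dk: "d D k = (if k = 1 then int m * l else 0)" if "k \<in> {1..n}" for k
    using inj_onD[OF Q_inj, of k 1] that one_le_r by (auto simp: D_def lookup_single when_def)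
  have "sum (cc D i) {1..r} = l + floor_sum i" for i
  proof -
    have "cc D i k = (if k = 1 then l else 0) + (int i * lam k) div int m" if "k \<in> {1..r}" for k
      using that dk[of k] m_pos one_le_r by (auto simp: cc_def)
    then have "sum (cc D i) {1..r} = (\<Sum>k\<in>{1..r}. (if k = 1 then l else 0) + (int i * lam k) div int m)"
      by (intro sum.cong) auto
    also have "\<dots> = l + floor_sum i"
      unfolding sum.distrib floor_sum_def using one_le_r by simp
    finally show ?thesis .
  qed
  moreover have "0 \<le> l + floor_sum i" if "i < m" for i
  proof -
    have "\<bar>floor_sum i\<bar> \<le> l0" unfolding l0_def by (rule member_le_sum) (use that in auto)
    then show ?thesis using assms(1) by linarith
  qed
  ultimately have "rr_dim \<iota> D = (\<Sum>i<m. l + floor_sum i + 1)"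
    unfolding rr_dim_eq[OF keys] by (intro sum.cong) auto
  also have "\<dots> = int m * l + 1 - g0"
    by (simp add: sum.distrib g0_def algebra_simps)
  finally show "rr_dim \<iota> D = int m * l + 1 - g0" .
qed

text \<open>
  Every divisor is dominated by the sum of a large multiple of \<open>Q 1\<close> and the zeros of a
  polynomial in \<open>w\<close>, and multiplication by that polynomial reduces to a multiple of \<open>Q 1\<close>.
\<close>

lemma defect_le:
  assumes A: "is_divisor \<iota> A"
  shows "div_degree \<iota> A - rr_dim \<iota> A + 1 \<le> g0"
proof -
  let ?Z0 = "Poly_Mapping.keys A - {Q 1}"
  have "\<forall>Q'\<in>?Z0. \<exists>p. p \<noteq> 0 \<and> \<phi> (ev w p) \<in> Q'"
    using min_poly_at A unfolding is_divisor_def by (metis DiffE insertI1)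
  then obtain pz where pz: "\<And>Q'. Q' \<in> ?Z0 \<Longrightarrow> pz Q' \<noteq> 0" "\<And>Q'. Q' \<in> ?Z0 \<Longrightarrow> \<phi> (ev w (pz Q')) \<in> Q'"
    unfolding bchoice_iff by blast
  \<comment> \<open>Vanishes at each place of \<open>?Z0\<close> at least to the order that
    \<open>A\<close> demands; \<open>nat\<close> turns negative coefficients into 0.\<close>
  define p where "p = (\<Prod>Q'\<in>?Z0. pz Q' ^ nat (Poly_Mapping.lookup A Q'))"
  define g where "g = \<phi> (ev w p)"
  have pnz: "p \<noteq> 0" using pz(1) by (simp add: p_def)
  then have gnz: "g \<noteq> 0" using w(1) by (simp add: g_def)
  have ge0: "0 \<le> place_val R (\<phi> (ev w q))" if "is_place \<iota> R" "R \<noteq> Q 1" "q \<noteq> 0" for R q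
    using ev_in_place_ring[OF that(1,2), of q] that(3) w(1)
      discrete_placeD(3)[OF place_discrete[OF that(1)]] by auto
  have gA: "Poly_Mapping.lookup A R \<le> place_val R g" if R: "R \<in> ?Z0" for R
  proof -
    have R': "is_place \<iota> R" "R \<noteq> Q 1" using R A by (auto simp: is_divisor_def)
    interpret discrete_valuation "place_val R" using disc[OF R'(1)] .
    define q where "q = (\<Prod>Q'\<in>?Z0 - {R}. pz Q' ^ nat (Poly_Mapping.lookup A Q'))"
    have "p = pz R ^ nat (Poly_Mapping.lookup A R) * q"
      unfolding p_def q_def using R by (subst prod.remove[of _ R]) auto
    then have "g = \<phi> (ev w (pz R)) ^ nat (Poly_Mapping.lookup A R) * \<phi> (ev w q)"
      by (simp add: g_def ev_mult ev_power hom_mult hom_power)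
    moreover have qnz: "q \<noteq> 0" using pz(1) by (simp add: q_def)
    moreover have rnz: "\<phi> (ev w (pz R)) \<noteq> 0" using pz(1)[OF R] w(1) by simp
    ultimately have "place_val R g = int (nat (Poly_Mapping.lookup A R)) * place_val R (\<phi> (ev w (pz R))) + place_val R (\<phi> (ev w q))"
      using w(1) by (simp add: val_mult val_power)
    moreover have "0 \<le> place_val R (\<phi> (ev w q))" by (rule ge0[OF R' qnz])
    moreover have "1 \<le> place_val R (\<phi> (ev w (pz R)))"
      using pz(2)[OF R] rnz discrete_placeD(2)[OF place_discrete[OF R'(1)]] by auto
    then have "int (nat (Poly_Mapping.lookup A R)) * 1 \<le> int (nat (Poly_Mapping.lookup A R)) * place_val R (\<phi> (ev w (pz R)))"
      by (intro mult_left_mono) auto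
    ultimately show ?thesis by linarith
  qed
  define Z where "Z = {R. is_place \<iota> R \<and> R \<noteq> Q 1 \<and> 0 < place_val R g}"
  have finZ: "finite Z" unfolding Z_def g_def by (rule finite_zeros[OF pnz])
  have gQ1: "place_val (Q 1) g = - int m * int (degree p)"
    using Q_val[OF one_le_r(1), of "ev w p"] pnz w(1) P_1_val_ev[OF pnz] by (simp add: g_def)
  \<comment> \<open>Makes \<open>m * l\<close> at least the coefficient of \<open>A\<close> at
    \<open>Q 1\<close> and keeps \<open>l \<ge> l0\<close>.\<close>
  define l where "l = l0 + \<bar>Poly_Mapping.lookup A (Q 1)\<bar>"
  define B where "B = (\<Sum>R\<in>Z. Poly_Mapping.single R (place_val R g)) + Poly_Mapping.single (Q 1) (int m * l)"
  have lookB: "Poly_Mapping.lookup B R = (if R \<in> Z then place_val R g else 0) + (if R = Q 1 then int m * l else 0)" for R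
    using finZ by (simp add: B_def lookup_add lookup_sum lookup_single when_def)
  have lookZ: "Poly_Mapping.lookup B R = place_val R g" if "is_place \<iota> R" "R \<noteq> Q 1" for R
    using that ge0[OF that pnz] by (auto simp: lookB Z_def g_def)
  have look1: "Poly_Mapping.lookup B (Q 1) = int m * l" by (simp add: lookB Z_def)
  have Bdiv: "is_divisor \<iota> B"
    using Q_place[OF one_le_r(1)] by (auto simp: is_divisor_def in_keys_iff lookB Z_def split: if_splits)
  have l0: "0 \<le> l0" unfolding l0_def by (rule sum_nonneg) simp
  have AB: "Poly_Mapping.lookup A R \<le> Poly_Mapping.lookup B R" for R
  proof (cases "R = Q 1")
    case True
    have "1 * l \<le> int m * l" using l0 m_pos by (intro mult_right_mono) (auto simp: l_def)
    then show ?thesis using True look1 l0 by (simp add: l_def)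
  next
    case False
    show ?thesis
    proof (cases "R \<in> Poly_Mapping.keys A")
      case True
      then show ?thesis using gA[of R] lookZ[of R] False A by (simp add: is_divisor_def)
    next
      case notA: False
      then have "Poly_Mapping.lookup A R = 0" by (simp add: in_keys_iff)
      then show ?thesis using False by (auto simp: lookB Z_def)
    qed
  qed
  \<comment> \<open>Multiplication by \<open>g\<close> cancels the zeros recorded in
    \<open>B\<close> and adds a pole of order \<open>m * degree p\<close> at
    \<open>Q 1\<close>.\<close>
  define E where "E = Poly_Mapping.single (Q 1) (int m * (l + int (degree p)))"
  have l0': "l0 \<le> l + int (degree p)" by (simp add: l_def)
  have lookE: "Poly_Mapping.lookup E R = (if R = Q 1 then int m * (l + int (degree p)) else 0)" for R
    by (simp add: E_def lookup_single when_def)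
  have bij: "z \<in> rr_space \<iota> B \<longleftrightarrow> g * z \<in> rr_space \<iota> E" for z
    unfolding rr_space_iff
  proof (intro all_cong1 imp_cong refl)
    fix R assume R: "is_place \<iota> R"
    interpret discrete_valuation "place_val R" using disc[OF R] .
    have "Poly_Mapping.lookup B R = Poly_Mapping.lookup E R + place_val R g"
    proof (cases "R = Q 1")
      case True
      then show ?thesis using look1 gQ1 by (simp add: lookE algebra_simps)
    next
      case False
      then show ?thesis using lookZ[OF R False] by (simp add: lookE)
    qed
    then show "val_ge (- Poly_Mapping.lookup B R) z \<longleftrightarrow> val_ge (- Poly_Mapping.lookup E R) (g * z)"
      using gnz by (simp add: val_ge_mult_iff)
  qed
  have img: "rr_space \<iota> E = (\<lambda>z. g * z) ` rr_space \<iota> B"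
  proof (intro equalityI subsetI)
    fix z assume z: "z \<in> rr_space \<iota> E"
    have "z = g * (z / g)" using gnz by simp
    moreover from this have "z / g \<in> rr_space \<iota> B" using z bij[of "z / g"] by simp
    ultimately show "z \<in> (\<lambda>z. g * z) ` rr_space \<iota> B" by (rule image_eqI)
  qed (use bij in auto)
  have inj: "inj_on (\<lambda>z. g * z) (rr_space \<iota> B)" using gnz by (auto simp: inj_on_def)
  note E = rr_single_Q1[OF l0', folded E_def]
  have finB: "finite (rr_space \<iota> B)" using E(1) inj unfolding img by (rule finite_imageD)
  have "card (rr_space \<iota> B) = card (rr_space \<iota> E)" unfolding img by (rule card_image[OF inj, symmetric])
  then have "CARD('k) ^ nat (rr_dim \<iota> B) = CARD('k) ^ nat (rr_dim \<iota> E)"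
    using card_rr_space_dim[OF finB] card_rr_space_dim[OF E(1)] by simp
  then have dimB: "rr_dim \<iota> B = rr_dim \<iota> E"
    using card_k_gt_1 eq_nat_nat_iff[OF rr_dim_nonneg rr_dim_nonneg] by simp
  have "div_degree \<iota> B = (\<Sum>R\<in>insert (Q 1) Z. Poly_Mapping.lookup B R * int (place_degree \<iota> R))"
    using finZ by (intro div_degree_superset) (auto simp: in_keys_iff lookB split: if_splits)
  also have "\<dots> = int m * l + (\<Sum>R\<in>Z. Poly_Mapping.lookup B R * int (place_degree \<iota> R))"
    using finZ place_degree_Q[OF one_le_r(1)] look1 by (subst sum.insert) (auto simp: Z_def)
  also have "(\<Sum>R\<in>Z. Poly_Mapping.lookup B R * int (place_degree \<iota> R))
      = int (\<Sum>R\<in>Z. nat (place_val R g) * place_degree \<iota> R)"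
    unfolding of_nat_sum by (rule sum.cong) (auto simp: lookB Z_def)
  also have "\<dots> \<le> int (m * degree p)"
    unfolding of_nat_le_iff g_def by (rule sum_zeros_le[OF pnz finZ]) (simp add: Z_def)
  finally have "div_degree \<iota> B \<le> int m * (l + int (degree p))" by (simp only: distrib_left of_nat_mult)
  moreover have "div_degree \<iota> A - rr_dim \<iota> A \<le> div_degree \<iota> B - rr_dim \<iota> B"
    by (rule defect_mono[OF A Bdiv AB finB])
  ultimately show ?thesis using dimB E(2) by linarith
qed

text \<open>The bound of \<open>defect_le\<close> is attained by \<open>m * l0\<close> times
  \<open>Q 1\<close>.\<close>

theorem genus_eq: "genus \<iota> = g0"
  unfolding genus_def
proof (rule Greatest_equality)
  let ?A = "Poly_Mapping.single (Q 1) (int m * l0)"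
  have "is_divisor \<iota> ?A" using Q_place[OF one_le_r(1)] by (auto simp: is_divisor_def split: if_splits)
  moreover have "g0 = div_degree \<iota> ?A - rr_dim \<iota> ?A + 1"
    using rr_single_Q1(2)[of l0] place_degree_Q[OF one_le_r(1)] by (simp add: div_degree_single)
  ultimately show "\<exists>A. is_divisor \<iota> A \<and> g0 = div_degree \<iota> A - rr_dim \<iota> A + 1" by blast
next
  fix g assume "\<exists>A. is_divisor \<iota> A \<and> g = div_degree \<iota> A - rr_dim \<iota> A + 1"
  then show "g \<le> g0" using defect_le by blast
qed

end

section \<open>Non-special divisors\<close>

text \<open>As \<open>l\<close> is invertible modulo \<open>m\<close>, the numbers
  \<open>c + i * l\<close> form a complete residue system.\<close>

lemma sum_mod_coprime:
  fixes c l :: int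
  assumes m: "0 < m" and cop: "coprime l (int m)"
  shows "(\<Sum>i<m. (c + int i * l) mod int m) = (\<Sum>x\<in>{0..<int m}. x)"
proof -
  let ?g = "\<lambda>i. (c + int i * l) mod int m"
  have inj: "inj_on ?g {..<m}"
  proof (rule inj_onI)
    fix i i' assume i: "i \<in> {..<m}" "i' \<in> {..<m}" "?g i = ?g i'"
    then have "int m dvd (c + int i * l) - (c + int i' * l)" by (simp only: mod_eq_dvd_iff)
    also have "(c + int i * l) - (c + int i' * l) = (int i - int i') * l" by (simp add: algebra_simps)
    finally have "int m dvd int i - int i'" using cop by (simp add: coprime_dvd_mult_left_iff coprime_commute)
    then have "int i mod int m = int i' mod int m" by (simp only: mod_eq_dvd_iff)
    then show "i = i'" using i by simp
  qed
  have "?g ` {..<m} = {0..<int m}"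
  proof (rule card_subset_eq)
    show "?g ` {..<m} \<subseteq> {0..<int m}" using m by auto
    show "card (?g ` {..<m}) = card {0..<int m}" using card_image[OF inj] by simp
  qed simp
  then show ?thesis using sum.reindex[OF inj, of "\<lambda>x. x"] by simp
qed

text \<open>The remainders with and without \<open>c\<close> are the same up to order, so adding
  \<open>c\<close> to all \<open>m\<close> numerators raises the sum of the quotients by exactly
  \<open>c\<close>. This makes the sum of the \<open>bb D i\<close> depend on \<open>D\<close>
  through its degree alone.\<close>

lemma sum_div_coprime:
  fixes c l :: int
  assumes m: "0 < m" and cop: "coprime l (int m)"
  shows "(\<Sum>i<m. (c + int i * l) div int m - (int i * l) div int m) = c"
proof -
  have "int m * (\<Sum>i<m. (c + int i * l) div int m - (int i * l) div int m)
      = (\<Sum>i<m. int m * ((c + int i * l) div int m) - int m * ((int i * l) div int m))"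
    by (simp add: sum_distrib_left right_diff_distrib)
  also have "\<dots> = (\<Sum>i<m. c - ((c + int i * l) mod int m - (0 + int i * l) mod int m))"
    by (rule sum.cong) (simp_all add: minus_mod_eq_mult_div[symmetric])
  also have "\<dots> = int m * c"
    using sum_mod_coprime[OF m cop, of c] sum_mod_coprime[OF m cop, of 0] by (simp add: sum_subtractf)
  finally show ?thesis using m by simp
qed

text \<open>Equality of the two sums rules out negative \<open>b i\<close>, and nonnegative integers
  with sum 1 have a single nonzero member.\<close>

lemma sum_max_eq_1_iff:
  fixes b :: "'a \<Rightarrow> int"
  assumes "finite I"
  shows "(\<Sum>i\<in>I. max 0 (b i)) = 1 \<and> (\<Sum>i\<in>I. b i) = 1 \<longleftrightarrow> (\<exists>l\<in>I. b l = 1 \<and> (\<forall>i\<in>I - {l}. b i = 0))"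
proof
  assume s: "(\<Sum>i\<in>I. max 0 (b i)) = 1 \<and> (\<Sum>i\<in>I. b i) = 1"
  then have "(\<Sum>i\<in>I. max 0 (b i) - b i) = 0" by (simp add: sum_subtractf)
  then have "\<forall>i\<in>I. max 0 (b i) - b i = 0" using assms by (subst (asm) sum_nonneg_eq_0_iff) auto
  then have nn: "0 \<le> b i" if "i \<in> I" for i using that by fastforce
  have "\<exists>l\<in>I. b l \<noteq> 0" using s by (metis (no_types, lifting) sum.neutral zero_neq_one)
  then obtain l where l: "l \<in> I" "b l \<noteq> 0" by blast
  have "sum b I = b l + sum b (I - {l})" using assms l(1) by (rule sum.remove)
  moreover have "0 \<le> sum b (I - {l})" using nn by (intro sum_nonneg) auto
  ultimately have *: "b l = 1" "sum b (I - {l}) = 0" using s l nn[OF l(1)] by linarith+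
  have "\<forall>i\<in>I - {l}. b i = 0" using *(2) assms nn by (subst (asm) sum_nonneg_eq_0_iff) auto
  then show "\<exists>l\<in>I. b l = 1 \<and> (\<forall>i\<in>I - {l}. b i = 0)" using l(1) *(1) by blast
next
  assume "\<exists>l\<in>I. b l = 1 \<and> (\<forall>i\<in>I - {l}. b i = 0)"
  then obtain l where l: "l \<in> I" "b l = 1" "\<forall>i\<in>I - {l}. b i = 0" by blast
  then show "(\<Sum>i\<in>I. max 0 (b i)) = 1 \<and> (\<Sum>i\<in>I. b i) = 1"
    using assms by (simp add: sum.remove[of I l])
qed

lemma ceiling_divide_eq: "\<lceil>real_of_int x / real m\<rceil> = - ((- x) div int m)"
proof -
  have "\<lceil>real_of_int x / real m\<rceil> = - \<lfloor>real_of_int (- x) / real_of_int (int m)\<rfloor>"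
    by (simp add: ceiling_def)
  then show ?thesis by (simp only: floor_divide_of_int_eq)
qed

lemma floor_divide_eq: "\<lfloor>real_of_int x / real m\<rfloor> = x div int m"
  using floor_divide_of_int_eq[of x "int m"] by simp

context kummer_curve
begin

lemma div_degree_eq:
  assumes D: "Poly_Mapping.keys D \<subseteq> Q ` {1..n}"
  shows "div_degree \<iota> D = (\<Sum>k\<in>{1..n}. d D k)"
proof -
  have "div_degree \<iota> D = (\<Sum>R\<in>Q ` {1..n}. Poly_Mapping.lookup D R * int (place_degree \<iota> R))"
    by (rule div_degree_superset[OF _ D]) simp
  also have "\<dots> = (\<Sum>k\<in>{1..n}. d D k * int (place_degree \<iota> (Q k)))"
    using sum.reindex[OF Q_inj] by simp
  also have "\<dots> = (\<Sum>k\<in>{1..n}. d D k)"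
    by (rule sum.cong[OF refl]) (subst place_degree_Q, auto)
  finally show ?thesis .
qed

text \<open>The degree of the bounding divisor plus 1: the dimension of the coefficient space of
  \<open>y ^ i\<close> whenever this number is nonnegative.\<close>

definition bb :: "('f set \<Rightarrow>\<^sub>0 int) \<Rightarrow> nat \<Rightarrow> int" where
  "bb D i = sum (cc D i) {1..r} + 1"

lemma r_union: "{1..r} = {1..n} \<union> {n<..r}"
  using n_bounds by auto

lemma sum_bb:
  assumes D: "Poly_Mapping.keys D \<subseteq> Q ` {1..n}"
  shows "(\<Sum>i<m. bb D i) = div_degree \<iota> D + 1 - g0"
proof -
  have diff: "sum (cc D i) {1..r} - floor_sum i = (\<Sum>k\<in>{1..n}. (d D k + int i * lam k) div int m - (int i * lam k) div int m)" for i
  proof -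
    have "sum (cc D i) {1..r} = (\<Sum>k\<in>{1..n}. cc D i k) + (\<Sum>k\<in>{n<..r}. cc D i k)"
      "floor_sum i = (\<Sum>k\<in>{1..n}. (int i * lam k) div int m) + (\<Sum>k\<in>{n<..r}. (int i * lam k) div int m)"
      unfolding floor_sum_def r_union by (rule sum.union_disjoint; auto)+
    moreover have "(\<Sum>k\<in>{n<..r}. cc D i k) = (\<Sum>k\<in>{n<..r}. (int i * lam k) div int m)"
      by (rule sum.cong) (auto simp: cc_def)
    moreover have "(\<Sum>k\<in>{1..n}. cc D i k) = (\<Sum>k\<in>{1..n}. (d D k + int i * lam k) div int m)"
      by (rule sum.cong) (auto simp: cc_def)
    ultimately show ?thesis by (simp add: sum_subtractf)
  qed
  have "(\<Sum>i<m. sum (cc D i) {1..r} - floor_sum i) = (\<Sum>k\<in>{1..n}. d D k)"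
    unfolding diff
    by (subst sum.swap) (intro sum.cong refl sum_div_coprime m_pos lam_coprime)
  then show ?thesis
    by (simp add: bb_def sum.distrib sum_subtractf g0_def div_degree_eq[OF D])
qed

text \<open>In degree \<open>genus \<iota>\<close> non-speciality means dimension 1, and
  \<open>sum_bb\<close> turns the degree condition into the statement that the \<open>bb D i\<close>
  have sum 1.\<close>

lemma non_special_genus_iff:
  assumes D: "Poly_Mapping.keys D \<subseteq> Q ` {1..n}"
  shows "non_special \<iota> D \<and> div_degree \<iota> D = genus \<iota> \<longleftrightarrow>
    (\<exists>l\<in>{..<m}. bb D l = 1 \<and> (\<forall>i\<in>{..<m} - {l}. bb D i = 0))"
proof -
  have "rr_dim \<iota> D = (\<Sum>i<m. max 0 (bb D i))" by (simp add: rr_dim_eq[OF D] bb_def)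
  then have "non_special \<iota> D \<and> div_degree \<iota> D = genus \<iota> \<longleftrightarrow> (\<Sum>i<m. max 0 (bb D i)) = 1 \<and> (\<Sum>i<m. bb D i) = 1"
    unfolding non_special_def genus_eq sum_bb[OF D] by auto
  then show ?thesis by (simp only: sum_max_eq_1_iff[OF finite_lessThan])
qed

context
  fixes D :: "'f set \<Rightarrow>\<^sub>0 int" and j \<alpha> :: "nat \<Rightarrow> int"
  assumes dD: "\<And>k. k \<in> {1..n} \<Longrightarrow> d D k = int m * j k + \<alpha> k"
    and \<alpha>: "\<And>k. k \<in> {1..n} \<Longrightarrow> 0 \<le> \<alpha> k \<and> \<alpha> k \<le> int m - 1"
begin

lemma bb_0: "bb D 0 = (\<Sum>k\<in>{1..n}. j k) + 1"
proof -
  have "sum (cc D 0) {1..r} = (\<Sum>k\<in>{1..n}. cc D 0 k) + (\<Sum>k\<in>{n<..r}. cc D 0 k)"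
    unfolding r_union by (rule sum.union_disjoint) auto
  also have "(\<Sum>k\<in>{n<..r}. cc D 0 k) = 0" by (rule sum.neutral) (simp add: cc_def)
  also have "(\<Sum>k\<in>{1..n}. cc D 0 k) = (\<Sum>k\<in>{1..n}. j k)"
  proof (rule sum.cong)
    fix k assume k: "k \<in> {1..n}"
    then have "\<alpha> k div int m = 0" using \<alpha>[OF k] by (intro div_pos_pos_trivial) auto
    then show "cc D 0 k = j k" using k dD[OF k] m_pos by (simp add: cc_def)
  qed simp
  finally show ?thesis by (simp add: bb_def)
qed

text \<open>The coefficient of \<open>y\<^sup>m\<^sup>-\<^sup>i\<close> corresponds to the index \<open>i\<close> of the theorem.\<close>

lemma bb_compl:
  assumes i: "i \<in> {1..m - 1}"
  shows "bb D (m - i) = (\<Sum>k\<in>{1..n}. j k) + int n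
    + (\<Sum>k\<in>{1..n}. \<lfloor>real_of_int (\<alpha> k - (int i * lam k) mod int m) / real m\<rfloor>)
    - (\<Sum>k\<in>{1..r}. \<lceil>real_of_int (int i * lam k) / real m\<rceil>) + 1"
proof -
  have im: "int (m - i) = int m - int i" by (rule of_nat_diff) (use i in auto)
  have mnz: "int m \<noteq> 0" using m_pos by simp
  have 1: "cc D (m - i) k = lam k + (j k + 1 + (\<alpha> k - (int i * lam k) mod int m) div int m) - - ((- (int i * lam k)) div int m)"
    if k: "k \<in> {1..n}" for k
  proof -
    let ?a = "int i * lam k"
    have "\<not> int m dvd ?a"
    proof
      assume "int m dvd ?a"
      then have "int m dvd int i" using lam_coprime[OF k] by (simp add: coprime_dvd_mult_left_iff coprime_commute)
      then show False using i by (auto dest: dvd_imp_le)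
    qed
    \<comment> \<open>For a non-multiple of \<open>m\<close> the floor of the negative is one less
      than the negative of the floor; these units, one for each \<open>k \<le> n\<close>, add up to
      the \<open>int n\<close> of the formula.\<close>
    then have neg: "(- ?a) div int m = - (?a div int m) - 1"
      using zdiv_zminus1_eq_if[OF mnz, of ?a] by (simp add: dvd_eq_mod_eq_0)
    \<comment> \<open>The factor \<open>int m - int i\<close> is split, and
      \<open>int i * lam k\<close> is divided by \<open>m\<close> with remainder; that remainder is
      \<open>t k i\<close> in the theorem.\<close>
    have eq: "d D k + int (m - i) * lam k = (\<alpha> k - ?a mod int m) + int m * (j k + lam k - ?a div int m)"
      using dD[OF k] mult_div_mod_eq[of "int m" ?a] unfolding im by (simp add: algebra_simps)
    have "cc D (m - i) k = (d D k + int (m - i) * lam k) div int m" using k by (simp add: cc_def)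
    also note eq
    also have "((\<alpha> k - ?a mod int m) + int m * (j k + lam k - ?a div int m)) div int m = j k + lam k - ?a div int m + (\<alpha> k - ?a mod int m) div int m"
      using mnz by simp
    finally show ?thesis unfolding neg by simp
  qed
  have 2: "cc D (m - i) k = lam k - - ((- (int i * lam k)) div int m)" if k: "k \<in> {n<..r}" for k
  proof -
    have "cc D (m - i) k = (- (int i * lam k) + int m * lam k) div int m"
      using k by (simp add: cc_def im algebra_simps)
    also have "\<dots> = lam k + (- (int i * lam k)) div int m" using mnz by (rule div_mult_self2)
    finally show ?thesis by simp
  qed
  have "sum (cc D (m - i)) {1..r} = (\<Sum>k\<in>{1..r}. lam k
      + (if k \<le> n then j k + 1 + (\<alpha> k - (int i * lam k) mod int m) div int m else 0)
      - - ((- (int i * lam k)) div int m))"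
    by (rule sum.cong) (use 1 2 in auto)
  also have "\<dots> = sum lam {1..r}
      + (\<Sum>k\<in>{1..r}. if k \<le> n then j k + 1 + (\<alpha> k - (int i * lam k) mod int m) div int m else 0)
      - (\<Sum>k\<in>{1..r}. - ((- (int i * lam k)) div int m))"
    by (simp only: sum.distrib sum_subtractf)
  also have "(\<Sum>k\<in>{1..r}. if k \<le> n then j k + 1 + (\<alpha> k - (int i * lam k) mod int m) div int m else 0)
      = (\<Sum>k\<in>{1..n}. j k + 1 + (\<alpha> k - (int i * lam k) mod int m) div int m)"
    by (rule sum.mono_neutral_cong_right) (use n_bounds in auto)
  also have "\<dots> = (\<Sum>k\<in>{1..n}. j k) + int n + (\<Sum>k\<in>{1..n}. (\<alpha> k - (int i * lam k) mod int m) div int m)"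
    by (simp add: sum.distrib)
  finally show ?thesis
    by (simp only: bb_def sum_lam ceiling_divide_eq floor_divide_eq)
qed

end

end

section \<open>Translation of the criterion on the \<open>bb D i\<close> into the floor sums of the
  statement\<close>

theorem theorem3p7:
  fixes f :: "'k::{field,finite} poly"
    and \<phi> :: "'k poly fract \<Rightarrow> 'f::field"
    and y :: 'f
    and \<iota> :: "'k \<Rightarrow> 'f"
    and m n r :: nat
    and P :: "nat \<Rightarrow> 'k poly fract set"
    and Q :: "nat \<Rightarrow> 'f set"
    and lam :: "nat \<Rightarrow> int"
    and t :: "nat \<Rightarrow> nat \<Rightarrow> int"
    and \<beta> :: "nat \<Rightarrow> int"
    and D :: "'f set \<Rightarrow>\<^sub>0 int"
    and j \<alpha> :: "nat \<Rightarrow> int"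
  assumes "\<iota> = \<phi> \<circ> rat_const"
    and "m \<ge> 2" and "\<not> CHAR('k) dvd m"
    and "degree f \<ge> 2"
    and "\<forall>z :: 'k alg_closure. poly (map_poly to_ac f) z = 0 \<longrightarrow> z \<in> range to_ac"
    and "\<forall>d\<ge>2. d dvd m \<longrightarrow> (\<nexists>h :: 'k poly fract. h ^ d = to_fract f)"
    and "kummer_function_field m f \<phi> y"
    and "genus \<iota> \<ge> 1"
    and "bij_betw P {1..r} {R. is_place rat_const R \<and> place_val R (to_fract f) \<noteq> 0}"
    and "\<forall>k. lam k = place_val (P k) (to_fract f)"
    and "n \<le> r" and "2 \<le> n" and "n \<le> card (UNIV :: 'k set)"
    and "\<forall>k\<in>{1..n}. totally_ramified \<phi> (P k) (Q k)"
    and "inj_on Q {1..n}"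
    and "\<forall>k i. t k i = (int i * lam k) mod int m"
    and "\<forall>i. \<beta> i = (\<Sum>k=1..r. \<lceil>real_of_int (int i * lam k) / real m\<rceil>) - 1"
    and "is_divisor \<iota> D" and "Poly_Mapping.keys D \<subseteq> Q ` {1..n}"
    and "D = (\<Sum>k=1..n. Poly_Mapping.single (Q k) (int m * j k + \<alpha> k))"
    and "\<forall>k\<in>{1..n}. 0 \<le> \<alpha> k \<and> \<alpha> k \<le> int m - 1"
  shows
    "(non_special \<iota> D \<and> div_degree \<iota> D = genus \<iota> \<longleftrightarrow>
        ((\<Sum>k=1..n. j k) = 0 \<and>
         (\<forall>i\<in>{1..m-1}.
            int n + (\<Sum>k=1..n. \<lfloor>real_of_int (\<alpha> k - t k i) / real m\<rfloor>) = \<beta> i)) \<or>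
        ((\<Sum>k=1..n. j k) = -1 \<and>
         (\<exists>l\<in>{1..m-1}.
            int n - 2 + (\<Sum>k=1..n. \<lfloor>real_of_int (\<alpha> k - t k l) / real m\<rfloor>) = \<beta> l \<and>
            (\<forall>i\<in>{1..m-1}. i \<noteq> l \<longrightarrow>
               int n - 1 + (\<Sum>k=1..n. \<lfloor>real_of_int (\<alpha> k - t k i) / real m\<rfloor>) = \<beta> i)))) \<and>
     (effective D \<and> non_special \<iota> D \<and> div_degree \<iota> D = genus \<iota> \<longleftrightarrow>
        D = (\<Sum>k=1..n. Poly_Mapping.single (Q k) (\<alpha> k)) \<and>
        (\<forall>k\<in>{1..n}. 0 \<le> \<alpha> k \<and> \<alpha> k \<le> int m - 1) \<and>
        (\<forall>i\<in>{1..m-1}.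
           int n + (\<Sum>k=1..n. \<lfloor>real_of_int (\<alpha> k - t k i) / real m\<rfloor>) = \<beta> i))"
proof -
  interpret K: kummer_curve m f \<phi> y n r P Q lam
    using assms by unfold_locales auto
  note \<iota> = assms(1)
  have keys: "Poly_Mapping.keys D \<subseteq> Q ` {1..n}" by fact
  have Q_inj: "inj_on Q {1..n}" by fact
  have \<alpha>: "0 \<le> \<alpha> k \<and> \<alpha> k \<le> int m - 1" if "k \<in> {1..n}" for k using assms(21) that by blast
  have look: "Poly_Mapping.lookup (\<Sum>k=1..n. Poly_Mapping.single (Q k) (c k)) (Q k) = c k"
    if "k \<in> {1..n}" for k and c :: "nat \<Rightarrow> int"
  proof -
    have "Poly_Mapping.lookup (\<Sum>k=1..n. Poly_Mapping.single (Q k) (c k)) (Q k) = (\<Sum>i=1..n. if i = k then c k else 0)"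
      unfolding lookup_sum lookup_single
      by (rule sum.cong) (use inj_onD[OF Q_inj] that in \<open>auto simp: when_def\<close>)
    then show ?thesis using that by simp
  qed
  have D: "D = (\<Sum>k=1..n. Poly_Mapping.single (Q k) (int m * j k + \<alpha> k))" by fact
  have dD: "Poly_Mapping.lookup D (Q k) = int m * j k + \<alpha> k" if "k \<in> {1..n}" for k
    using look[OF that, of "\<lambda>k. int m * j k + \<alpha> k"] D by simp
  define J where "J = (\<Sum>k=1..n. j k)"
  \<comment> \<open>The excess of the left-hand side in (i) over \<open>\<beta> i\<close>; the
    conditions of the theorem then read \<open>a i = 0\<close>, \<open>a i = 1\<close> and
    \<open>a i = 2\<close>.\<close>
  define a where "a i = int n + (\<Sum>k=1..n. \<lfloor>real_of_int (\<alpha> k - t k i) / real m\<rfloor>) - \<beta> i" for i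
  have b0: "K.bb D 0 = J + 1" unfolding J_def by (rule K.bb_0[OF dD \<alpha>])
  have bi: "K.bb D (m - i) = J + a i" if "i \<in> {1..m - 1}" for i
    using K.bb_compl[OF dD \<alpha> that] assms(16,17) by (simp add: J_def a_def)
  have m: "2 \<le> m" by fact
  have compl: "m - i \<in> {1..m - 1}" if "i \<in> {..<m} - {0}" for i using that by auto
  have bi': "K.bb D i = J + a (m - i)" if "i \<in> {..<m} - {0}" for i
    using bi[OF compl[OF that]] that by simp
  have main: "non_special \<iota> D \<and> div_degree \<iota> D = genus \<iota> \<longleftrightarrow>
      J = 0 \<and> (\<forall>i\<in>{1..m-1}. a i = 0) \<or> J = -1 \<and> (\<exists>l\<in>{1..m-1}. a l = 2 \<and> (\<forall>i\<in>{1..m-1}. i \<noteq> l \<longrightarrow> a i = 1))"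
    (is "_ \<longleftrightarrow> ?R1 \<or> ?R2")
    unfolding \<iota> K.non_special_genus_iff[OF keys]
  proof
    assume "\<exists>l\<in>{..<m}. K.bb D l = 1 \<and> (\<forall>i\<in>{..<m} - {l}. K.bb D i = 0)"
    then obtain l where l: "l < m" "K.bb D l = 1" "\<And>i. i < m \<Longrightarrow> i \<noteq> l \<Longrightarrow> K.bb D i = 0" by auto
    show "?R1 \<or> ?R2"
    \<comment> \<open>\<open>bb D 0\<close> is 1 for \<open>l = 0\<close> and 0 otherwise, which
      fixes the sum of the \<open>j k\<close> as 0 or -1.\<close>
    proof (cases "l = 0")
      case True
      then have J: "J = 0" using l(2) b0 by simp
      moreover have "a i = 0" if "i \<in> {1..m - 1}" for i
        using bi[OF that] l(3)[of "m - i"] that True J by auto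
      ultimately show ?thesis by blast
    next
      case False
      then have J: "J = -1" using l(3)[of 0] b0 m by simp
      have "a (m - l) = 2" using bi'[of l] l(1,2) False J by simp
      moreover have "a i = 1" if "i \<in> {1..m - 1}" "i \<noteq> m - l" for i
        using bi[OF that(1)] l(3)[of "m - i"] that J l(1) by auto
      moreover have "m - l \<in> {1..m - 1}" using False l(1) by auto
      ultimately show ?thesis using J by blast
    qed
  next
    assume "?R1 \<or> ?R2"
    then show "\<exists>l\<in>{..<m}. K.bb D l = 1 \<and> (\<forall>i\<in>{..<m} - {l}. K.bb D i = 0)"
    proof
      assume R: ?R1
      have "K.bb D i = 0" if "i \<in> {..<m} - {0}" for i
        using bi'[OF that] compl[OF that] R by simp
      then show ?thesis using b0 R m by (intro bexI[of _ 0]) auto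
    next
      assume R: ?R2
      then obtain l where l: "l \<in> {1..m - 1}" "a l = 2" "\<And>i. i \<in> {1..m - 1} \<Longrightarrow> i \<noteq> l \<Longrightarrow> a i = 1" by blast
      have "K.bb D i = 0" if i: "i \<in> {..<m} - {m - l}" for i
      proof (cases "i = 0")
        case True
        then show ?thesis using b0 R by simp
      next
        case False
        then have i0: "i \<in> {..<m} - {0}" using i by simp
        have "m - i \<noteq> l" using i l(1) by auto
        then show ?thesis using bi'[OF i0] l(3)[OF compl[OF i0]] R by simp
      qed
      moreover have "K.bb D (m - l) = 1" using bi[OF l(1)] l(2) R by simp
      moreover have "m - l \<in> {..<m}" using l(1) by auto
      ultimately show ?thesis by blast
    qed
  qed
  have r0: "a i = 0 \<longleftrightarrow> int n + (\<Sum>k=1..n. \<lfloor>real_of_int (\<alpha> k - t k i) / real m\<rfloor>) = \<beta> i"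
    and r1: "a i = 1 \<longleftrightarrow> int n - 1 + (\<Sum>k=1..n. \<lfloor>real_of_int (\<alpha> k - t k i) / real m\<rfloor>) = \<beta> i"
    and r2: "a i = 2 \<longleftrightarrow> int n - 2 + (\<Sum>k=1..n. \<lfloor>real_of_int (\<alpha> k - t k i) / real m\<rfloor>) = \<beta> i" for i
    unfolding a_def by linarith+
  have eff: "effective D \<and> non_special \<iota> D \<and> div_degree \<iota> D = genus \<iota> \<longleftrightarrow>
      D = (\<Sum>k=1..n. Poly_Mapping.single (Q k) (\<alpha> k)) \<and> (\<forall>k\<in>{1..n}. 0 \<le> \<alpha> k \<and> \<alpha> k \<le> int m - 1) \<and>
      (\<forall>i\<in>{1..m-1}. a i = 0)"
    (is "_ \<longleftrightarrow> ?E")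
  proof
    assume L: "effective D \<and> non_special \<iota> D \<and> div_degree \<iota> D = genus \<iota>"
    \<comment> \<open>Nonnegativity of \<open>m * j k + \<alpha> k\<close> with
      \<open>\<alpha> k < m\<close> excludes negative \<open>j k\<close>; so effectivity rules out
      case (ii).\<close>
    have j0: "0 \<le> j k" if k: "k \<in> {1..n}" for k
    proof (rule ccontr)
      assume "\<not> 0 \<le> j k"
      then have "int m * j k \<le> int m * (-1)" by (intro mult_left_mono) auto
      moreover have "0 \<le> int m * j k + \<alpha> k" using L dD[OF k] by (metis effective_def)
      ultimately show False using \<alpha>[OF k] by linarith
    qed
    then have "0 \<le> J" unfolding J_def by (intro sum_nonneg) auto
    then have R: "J = 0" "\<forall>i\<in>{1..m-1}. a i = 0" using main L by auto
    have "\<forall>k\<in>{1..n}. j k = 0"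
      using R(1) j0 unfolding J_def by (subst (asm) sum_nonneg_eq_0_iff) auto
    then have "D = (\<Sum>k=1..n. Poly_Mapping.single (Q k) (\<alpha> k))"
      unfolding D by (intro sum.cong) auto
    then show ?E using R \<alpha> by blast
  next
    assume E: ?E
    have "j k = 0" if k: "k \<in> {1..n}" for k
    proof -
      have "int m * j k = 0" using dD[OF k] look[OF k, of \<alpha>] E by simp
      then show ?thesis using m by simp
    qed
    then have "J = 0" by (simp add: J_def)
    moreover have "effective D"
      unfolding effective_def
    proof
      fix R
      show "0 \<le> Poly_Mapping.lookup D R"
      proof (cases "R \<in> Q ` {1..n}")
        case True
        then obtain k where "k \<in> {1..n}" "R = Q k" by blast
        then show ?thesis using look[of k \<alpha>] E \<alpha>[of k] by simp
      next
        case False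
        then have "R \<notin> Poly_Mapping.keys D" using keys by blast
        then show ?thesis by (simp add: in_keys_iff)
      qed
    qed
    ultimately show "effective D \<and> non_special \<iota> D \<and> div_degree \<iota> D = genus \<iota>" using main E by blast
  qed
  show ?thesis
    using main eff unfolding r0 r1 r2 J_def by blast
qed

end
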